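(* Let $\Gamma\curvearrowright(P,\tau)$ be a trace preserving action on a finite von Neumann algebra $P$ and consider the crossed product von Neumann algebra $P\rtimes\Gamma$. Let $P_0\subseteq P$ be a $\Gamma$-invariant von Neumann subalgebra. Assume that $P_0\rtimes\Gamma\subseteq N\subseteq P\rtimes\Gamma$ is an intermediate von Neumann subalgebra. Then there is a $\Gamma$-invariant von Neumann subalgebra $P_0\subseteq Q\subseteq P$ such that $N=Q\rtimes\Gamma$ if and only if $E_N(P)\subseteq P$.
   Context: $\Gamma$ is a countable discrete group, $\tau$ is a faithful normal trace on $P$, and $E_N:P\rtimes\Gamma\to N$ denotes the trace-preserving conditional expectation onto $N$ with respect to the canonical trace of $P\rtimes\Gamma$ extending $\tau$. *)

theory Defs
  imports "HOL-Analysis.Analysis"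
begin

text \<open>The inner product is linear in the first argument.\<close>

class chilbert_space = banach +
  fixes scaleC :: "complex \<Rightarrow> 'a \<Rightarrow> 'a" (infixr \<open>*\<^sub>C\<close> 75)
    and cinner :: "'a \<Rightarrow> 'a \<Rightarrow> complex"
  assumes scaleC_add_right: "c *\<^sub>C (x + y) = c *\<^sub>C x + c *\<^sub>C y"
    and scaleC_add_left: "(c + d) *\<^sub>C x = c *\<^sub>C x + d *\<^sub>C x"
    and scaleC_scaleC: "c *\<^sub>C d *\<^sub>C x = (c * d) *\<^sub>C x"
    and scaleC_of_real: "complex_of_real r *\<^sub>C x = r *\<^sub>R x"
    and cinner_commute: "cinner x y = cnj (cinner y x)"
    and cinner_add_left: "cinner (x + y) z = cinner x z + cinner y z"
    and cinner_scaleC_left: "cinner (c *\<^sub>C x) y = c * cinner x y"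
    and norm_eq_sqrt_cinner: "norm x = sqrt (Re (cinner x x))"

instantiation complex :: chilbert_space
begin

definition scaleC_complex :: "complex \<Rightarrow> complex \<Rightarrow> complex" where
  "scaleC_complex c x = c * x"

definition cinner_complex :: "complex \<Rightarrow> complex \<Rightarrow> complex" where
  "cinner_complex x y = x * cnj y"

instance
proof
  fix x :: complex
  show "norm x = sqrt (Re (cinner x x))"
    by (simp add: cinner_complex_def cmod_def power2_eq_square)
qed (auto simp: scaleC_complex_def cinner_complex_def algebra_simps scaleR_conv_of_real)

end

lemma cinner_add_right: "cinner x (y + z) = cinner x y + cinner x (z :: 'a :: chilbert_space)"
  by (metis cinner_add_left cinner_commute complex_cnj_add)

lemma cinner_scaleC_right: "cinner x (c *\<^sub>C y) = cnj c * cinner x (y :: 'a :: chilbert_space)"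
  by (metis cinner_commute cinner_scaleC_left complex_cnj_mult)

lemma cinner_self: "cinner x x = complex_of_real ((norm (x :: 'a :: chilbert_space))\<^sup>2)"
proof -
  have "0 \<le> Re (cinner x x)"
    using norm_ge_zero[of x] norm_eq_sqrt_cinner[of x] by simp
  moreover have "Im (cinner x x) = 0"
    using arg_cong[OF cinner_commute[of x x], of Im] by simp
  ultimately show ?thesis
    by (simp add: norm_eq_sqrt_cinner complex_eq_iff)
qed

lemma norm_scaleC: "norm (c *\<^sub>C (x :: 'a :: chilbert_space)) = cmod c * norm x"
proof -
  have "complex_of_real ((norm (c *\<^sub>C x))\<^sup>2) = complex_of_real ((cmod c * norm x)\<^sup>2)"
    unfolding cinner_self[symmetric] cinner_scaleC_left cinner_scaleC_right
    by (simp add: cinner_self power_mult_distrib complex_norm_square mult.assoc del: of_real_power)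
  then have "(norm (c *\<^sub>C x))\<^sup>2 = (cmod c * norm x)\<^sup>2"
    using of_real_eq_iff by blast
  then show ?thesis
    by (simp add: power2_eq_iff_nonneg)
qed

lemma Re_cinner_le: "Re (cinner x y) \<le> norm x * norm (y :: 'a :: chilbert_space)"
proof -
  have "complex_of_real ((norm (x + y))\<^sup>2) = cinner x x + cinner y y + (cinner x y + cnj (cinner x y))"
    unfolding cinner_self[symmetric] using cinner_commute[of y x]
    by (simp add: cinner_add_left cinner_add_right)
  then have "Re (complex_of_real ((norm (x + y))\<^sup>2)) =
      Re (cinner x x + cinner y y + (cinner x y + cnj (cinner x y)))"
    by simp
  then have "(norm (x + y))\<^sup>2 = (norm x)\<^sup>2 + (norm y)\<^sup>2 + 2 * Re (cinner x y)"
    by (simp add: cinner_self del: of_real_power)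
  moreover have "(norm (x + y))\<^sup>2 \<le> (norm x + norm y)\<^sup>2"
    by (simp add: norm_triangle_ineq power_mono)
  ultimately show ?thesis
    by (simp add: power2_sum)
qed

lemma norm_cinner_le: "cmod (cinner x y) \<le> norm x * norm (y :: 'a :: chilbert_space)"
proof (cases "cinner x y = 0")
  case False
  define u where "u = cnj (cinner x y) / complex_of_real (cmod (cinner x y))"
  have u: "cmod u = 1"
    using False by (simp add: u_def norm_divide)
  have "u * cinner x y = complex_of_real (cmod (cinner x y))"
    using False
    by (simp add: u_def complex_norm_square[symmetric] power2_eq_square mult.commute)
  then have "cmod (cinner x y) = Re (cinner (u *\<^sub>C x) y)"
    by (simp add: cinner_scaleC_left)
  also have "\<dots> \<le> norm (u *\<^sub>C x) * norm y"
    by (rule Re_cinner_le)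
  finally show ?thesis
    by (simp add: norm_scaleC u)
qed simp

typedef (overloaded) ('g, 'h) ell2 =
  "{f :: 'g \<Rightarrow> 'h :: real_normed_vector. (\<lambda>g. (norm (f g))\<^sup>2) summable_on UNIV}"
  by (rule exI[of _ "\<lambda>_. 0"]) simp

setup_lifting type_definition_ell2

lemma square_summable_iff:
  "(\<lambda>g. (norm (f g))\<^sup>2) summable_on UNIV \<longleftrightarrow>
    (\<exists>B. \<forall>F. finite F \<longrightarrow> L2_set (\<lambda>g. norm (f g)) F \<le> B)"
proof
  assume *: "(\<lambda>g. (norm (f g))\<^sup>2) summable_on UNIV"
  have "L2_set (\<lambda>g. norm (f g)) F \<le> sqrt (\<Sum>\<^sub>\<infinity>g. (norm (f g))\<^sup>2)" if "finite F" for F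
    unfolding L2_set_def using finite_sum_le_infsum[OF * that] by simp
  then show "\<exists>B. \<forall>F. finite F \<longrightarrow> L2_set (\<lambda>g. norm (f g)) F \<le> B"
    by blast
next
  assume "\<exists>B. \<forall>F. finite F \<longrightarrow> L2_set (\<lambda>g. norm (f g)) F \<le> B"
  then obtain B where B: "\<And>F. finite F \<Longrightarrow> L2_set (\<lambda>g. norm (f g)) F \<le> B"
    by blast
  have "(\<Sum>g\<in>F. (norm (f g))\<^sup>2) \<le> B\<^sup>2" if "finite F" for F
    using B[OF that] unfolding L2_set_def by (simp add: sqrt_le_D)
  then show "(\<lambda>g. (norm (f g))\<^sup>2) summable_on UNIV"
    by (intro nonneg_bdd_above_summable_on bdd_aboveI[of _ "B\<^sup>2"]) auto
qed

lemma square_summable_add: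
  assumes "(\<lambda>g. (norm (a g))\<^sup>2) summable_on UNIV" and "(\<lambda>g. (norm (b g))\<^sup>2) summable_on UNIV"
  shows "(\<lambda>g. (norm (a g + b g))\<^sup>2) summable_on UNIV"
proof -
  obtain A B where AB: "\<And>F. finite F \<Longrightarrow> L2_set (\<lambda>g. norm (a g)) F \<le> A"
      "\<And>F. finite F \<Longrightarrow> L2_set (\<lambda>g. norm (b g)) F \<le> B"
    using assms unfolding square_summable_iff by blast
  have "L2_set (\<lambda>g. norm (a g + b g)) F \<le> A + B" if "finite F" for F
  proof -
    have "L2_set (\<lambda>g. norm (a g + b g)) F \<le> L2_set (\<lambda>g. norm (a g) + norm (b g)) F"
      by (rule L2_set_mono) (auto simp: norm_triangle_ineq)
    also have "\<dots> \<le> L2_set (\<lambda>g. norm (a g)) F + L2_set (\<lambda>g. norm (b g)) F"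
      by (rule L2_set_triangle_ineq)
    finally show ?thesis
      using AB[OF that] by simp
  qed
  then show ?thesis
    unfolding square_summable_iff by blast
qed

instantiation ell2 :: (type, real_normed_vector) real_vector
begin

lift_definition zero_ell2 :: "('a, 'b) ell2" is "\<lambda>_. 0"
  by simp

lift_definition plus_ell2 :: "('a, 'b) ell2 \<Rightarrow> ('a, 'b) ell2 \<Rightarrow> ('a, 'b) ell2" is "\<lambda>a b g. a g + b g"
  by (rule square_summable_add)

lift_definition uminus_ell2 :: "('a, 'b) ell2 \<Rightarrow> ('a, 'b) ell2" is "\<lambda>a g. - a g"
  by simp

lift_definition minus_ell2 :: "('a, 'b) ell2 \<Rightarrow> ('a, 'b) ell2 \<Rightarrow> ('a, 'b) ell2" is "\<lambda>a b g. a g - b g"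
proof -
  fix a b :: "'a \<Rightarrow> 'b"
  assume "(\<lambda>g. (norm (a g))\<^sup>2) summable_on UNIV" and "(\<lambda>g. (norm (b g))\<^sup>2) summable_on UNIV"
  then show "(\<lambda>g. (norm (a g - b g))\<^sup>2) summable_on UNIV"
    using square_summable_add[of a "\<lambda>g. - b g"] by simp
qed

lift_definition scaleR_ell2 :: "real \<Rightarrow> ('a, 'b) ell2 \<Rightarrow> ('a, 'b) ell2" is "\<lambda>r a g. r *\<^sub>R a g"
  by (simp add: power_mult_distrib summable_on_cmult_right)

instance
proof
  fix a b c :: "('a, 'b) ell2" and r s :: real
  show "a + b + c = a + (b + c)" by transfer (simp add: add.assoc)
  show "a + b = b + a" by transfer (simp add: add.commute)
  show "0 + a = a" by transfer simp
  show "- a + a = 0" by transfer simp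
  show "a - b = a + - b" by transfer simp
  show "r *\<^sub>R (a + b) = r *\<^sub>R a + r *\<^sub>R b" by transfer (simp add: scaleR_add_right)
  show "(r + s) *\<^sub>R a = r *\<^sub>R a + s *\<^sub>R a" by transfer (simp add: scaleR_add_left)
  show "r *\<^sub>R s *\<^sub>R a = (r * s) *\<^sub>R a" by transfer simp
  show "1 *\<^sub>R a = a" by transfer simp
qed

end

instantiation ell2 :: (type, real_normed_vector) real_normed_vector
begin

lift_definition norm_ell2 :: "('a, 'b) ell2 \<Rightarrow> real" is "\<lambda>a. sqrt (\<Sum>\<^sub>\<infinity>g. (norm (a g))\<^sup>2)" .

definition dist_ell2 :: "('a, 'b) ell2 \<Rightarrow> ('a, 'b) ell2 \<Rightarrow> real" where
  "dist_ell2 a b = norm (a - b)"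

definition sgn_ell2 :: "('a, 'b) ell2 \<Rightarrow> ('a, 'b) ell2" where
  "sgn_ell2 a = a /\<^sub>R norm a"

definition uniformity_ell2 :: "(('a, 'b) ell2 \<times> ('a, 'b) ell2) filter" where
  "uniformity_ell2 = (INF e\<in>{0 <..}. principal {(x, y). dist x y < e})"

definition open_ell2 :: "('a, 'b) ell2 set \<Rightarrow> bool" where
  "open_ell2 U \<longleftrightarrow> (\<forall>x\<in>U. eventually (\<lambda>(x', y). x' = x \<longrightarrow> y \<in> U) uniformity)"

lemma L2_set_le_norm_ell2:
  assumes "finite F"
  shows "L2_set (\<lambda>g. norm (Rep_ell2 a g)) F \<le> norm (a :: ('a, 'b) ell2)"
  unfolding L2_set_def norm_ell2.rep_eq
  using Rep_ell2[of a] assms by (auto intro!: finite_sum_le_infsum)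

lemma norm_ell2_leI:
  assumes "\<And>F. finite F \<Longrightarrow> L2_set (\<lambda>g. norm (Rep_ell2 a g)) F \<le> c"
  shows "norm (a :: ('a, 'b) ell2) \<le> c"
proof -
  have c: "0 \<le> c"
    using assms[of "{}"] by simp
  have "(\<Sum>\<^sub>\<infinity>g. (norm (Rep_ell2 a g))\<^sup>2) \<le> c\<^sup>2"
    using Rep_ell2[of a] assms by (intro infsum_le_finite_sums) (auto simp: L2_set_def sqrt_le_D)
  then show ?thesis
    unfolding norm_ell2.rep_eq using c real_le_lsqrt by simp
qed

lemma norm_component_le_norm_ell2: "norm (Rep_ell2 a g) \<le> norm (a :: ('a, 'b) ell2)"
  using L2_set_le_norm_ell2[of "{g}" a] by simp

instance
proof
  fix a b :: "('a, 'b) ell2" and r :: real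
  show "sgn a = a /\<^sub>R norm a" by (rule sgn_ell2_def)
  show "dist a b = norm (a - b)" by (rule dist_ell2_def)
  show "(uniformity :: (('a, 'b) ell2 \<times> ('a, 'b) ell2) filter) =
      (INF e\<in>{0 <..}. principal {(x, y). dist x y < e})"
    by (rule uniformity_ell2_def)
  show "open U \<longleftrightarrow> (\<forall>x\<in>U. eventually (\<lambda>(x', y). x' = x \<longrightarrow> y \<in> U) uniformity)"
    for U :: "('a, 'b) ell2 set"
    by (rule open_ell2_def)
  show "norm a = 0 \<longleftrightarrow> a = 0"
  proof
    assume "norm a = 0"
    then have "Rep_ell2 a g = 0" for g
      using norm_component_le_norm_ell2[of a g] by simp
    then show "a = 0"
      by transfer auto
  qed (transfer, simp)
  show "norm (a + b) \<le> norm a + norm b"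
  proof (rule norm_ell2_leI)
    fix F :: "'a set"
    assume F: "finite F"
    have "L2_set (\<lambda>g. norm (Rep_ell2 (a + b) g)) F
        \<le> L2_set (\<lambda>g. norm (Rep_ell2 a g) + norm (Rep_ell2 b g)) F"
      by (rule L2_set_mono) (auto simp: plus_ell2.rep_eq norm_triangle_ineq)
    also have "\<dots> \<le> L2_set (\<lambda>g. norm (Rep_ell2 a g)) F + L2_set (\<lambda>g. norm (Rep_ell2 b g)) F"
      by (rule L2_set_triangle_ineq)
    finally show "L2_set (\<lambda>g. norm (Rep_ell2 (a + b) g)) F \<le> norm a + norm b"
      using L2_set_le_norm_ell2[OF F, of a] L2_set_le_norm_ell2[OF F, of b] by simp
  qed
  show "norm (r *\<^sub>R a) = \<bar>r\<bar> * norm a"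
    by transfer (simp add: power_mult_distrib infsum_cmult_right' real_sqrt_mult)
qed

end

instance ell2 :: (type, banach) banach
proof
  fix X :: "nat \<Rightarrow> ('a, 'b) ell2"
  assume X: "Cauchy X"
  have "Cauchy (\<lambda>n. Rep_ell2 (X n) g)" for g
  proof (rule CauchyI)
    fix e :: real
    assume "0 < e"
    then obtain M where M: "\<And>m n. m \<ge> M \<Longrightarrow> n \<ge> M \<Longrightarrow> norm (X m - X n) < e"
      using CauchyD[OF X] by blast
    have "norm (Rep_ell2 (X m) g - Rep_ell2 (X n) g) < e" if "m \<ge> M" "n \<ge> M" for m n
      using norm_component_le_norm_ell2[of "X m - X n" g] M[OF that]
      by (simp add: minus_ell2.rep_eq)
    then show "\<exists>M. \<forall>m\<ge>M. \<forall>n\<ge>M. norm (Rep_ell2 (X m) g - Rep_ell2 (X n) g) < e"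
      by blast
  qed
  then have "\<exists>l. (\<lambda>n. Rep_ell2 (X n) g) \<longlonglongrightarrow> l" for g
    using Cauchy_convergent convergent_def by blast
  then obtain f where f: "\<And>g. (\<lambda>n. Rep_ell2 (X n) g) \<longlonglongrightarrow> f g"
    by metis
  have key: "L2_set (\<lambda>g. norm (Rep_ell2 (X m) g - f g)) F \<le> e"
    if "\<And>n. n \<ge> M \<Longrightarrow> norm (X m - X n) \<le> e" and F: "finite F" for m M e F
  proof (rule LIMSEQ_le_const2)
    show "(\<lambda>n. L2_set (\<lambda>g. norm (Rep_ell2 (X m) g - Rep_ell2 (X n) g)) F)
        \<longlonglongrightarrow> L2_set (\<lambda>g. norm (Rep_ell2 (X m) g - f g)) F"
      unfolding L2_set_def by (intro tendsto_intros f)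
    have "L2_set (\<lambda>g. norm (Rep_ell2 (X m) g - Rep_ell2 (X n) g)) F \<le> e" if "n \<ge> M" for n
      using L2_set_le_norm_ell2[OF F, of "X m - X n"] \<open>\<And>n. n \<ge> M \<Longrightarrow> norm (X m - X n) \<le> e\<close>[OF that]
      by (simp add: minus_ell2.rep_eq)
    then show "\<exists>N. \<forall>n\<ge>N. L2_set (\<lambda>g. norm (Rep_ell2 (X m) g - Rep_ell2 (X n) g)) F \<le> e"
      by blast
  qed
  obtain M where M: "\<And>m n. m \<ge> M \<Longrightarrow> n \<ge> M \<Longrightarrow> norm (X m - X n) < 1"
    using CauchyD[OF X, of 1] by auto
  have "L2_set (\<lambda>g. norm (Rep_ell2 (X M) g - f g)) F \<le> 1" if "finite F" for F
    by (rule key[OF _ that, of M]) (use M[of M] in \<open>auto intro: less_imp_le\<close>)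
  then have "(\<lambda>g. (norm (Rep_ell2 (X M) g - f g))\<^sup>2) summable_on UNIV"
    unfolding square_summable_iff by blast
  from square_summable_add[OF _ this[unfolded norm_minus_commute[of "Rep_ell2 (X M) _"]], of "Rep_ell2 (X M)"]
  have "(\<lambda>g. (norm (f g))\<^sup>2) summable_on UNIV"
    using Rep_ell2[of "X M"] by simp
  then have repf: "Rep_ell2 (Abs_ell2 f) = f"
    by (simp add: Abs_ell2_inverse)
  have "X \<longlonglongrightarrow> Abs_ell2 f"
  proof (rule LIMSEQ_I)
    fix e :: real
    assume e: "0 < e"
    then obtain M where M: "\<And>m n. m \<ge> M \<Longrightarrow> n \<ge> M \<Longrightarrow> norm (X m - X n) < e / 2"
      using CauchyD[OF X, of "e / 2"] by auto
    have "norm (X n - Abs_ell2 f) < e" if "n \<ge> M" for n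
    proof -
      have "norm (X n - Abs_ell2 f) \<le> e / 2"
      proof (rule norm_ell2_leI)
        fix F :: "'a set"
        assume F: "finite F"
        show "L2_set (\<lambda>g. norm (Rep_ell2 (X n - Abs_ell2 f) g)) F \<le> e / 2"
          unfolding minus_ell2.rep_eq repf
          by (rule key[OF _ F, of M]) (use M[OF that] in \<open>auto intro: less_imp_le\<close>)
      qed
      then show ?thesis
        using e by simp
    qed
    then show "\<exists>M. \<forall>n\<ge>M. norm (X n - Abs_ell2 f) < e"
      by blast
  qed
  then show "convergent X"
    by (rule convergentI)
qed

lemma cinner_summable:
  fixes a b :: "('g, 'h :: chilbert_space) ell2"
  shows "(\<lambda>g. cinner (Rep_ell2 a g) (Rep_ell2 b g)) summable_on UNIV"
proof (rule Infinite_Sum.abs_summable_summable, rule Infinite_Sum.abs_summable_on_comparison_test')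
  show "(\<lambda>g. (norm (Rep_ell2 a g))\<^sup>2 + (norm (Rep_ell2 b g))\<^sup>2) summable_on UNIV"
    using Rep_ell2[of a] Rep_ell2[of b] by (auto intro: summable_on_add)
  show "cmod (cinner (Rep_ell2 a g) (Rep_ell2 b g))
      \<le> (norm (Rep_ell2 a g))\<^sup>2 + (norm (Rep_ell2 b g))\<^sup>2" for g
  proof -
    have "cmod (cinner (Rep_ell2 a g) (Rep_ell2 b g)) \<le> norm (Rep_ell2 a g) * norm (Rep_ell2 b g)"
      by (rule norm_cinner_le)
    also have "\<dots> \<le> 2 * norm (Rep_ell2 a g) * norm (Rep_ell2 b g)"
      by simp
    also have "\<dots> \<le> (norm (Rep_ell2 a g))\<^sup>2 + (norm (Rep_ell2 b g))\<^sup>2"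
      by (rule sum_squares_bound)
    finally show ?thesis .
  qed
qed

instantiation ell2 :: (type, chilbert_space) chilbert_space
begin

lift_definition scaleC_ell2 :: "complex \<Rightarrow> ('a, 'b) ell2 \<Rightarrow> ('a, 'b) ell2" is "\<lambda>c a g. c *\<^sub>C a g"
  by (simp add: norm_scaleC power_mult_distrib summable_on_cmult_right)

definition cinner_ell2 :: "('a, 'b) ell2 \<Rightarrow> ('a, 'b) ell2 \<Rightarrow> complex" where
  "cinner_ell2 a b = (\<Sum>\<^sub>\<infinity>g. cinner (Rep_ell2 a g) (Rep_ell2 b g))"

instance
proof
  fix a b c :: "('a, 'b) ell2" and u v :: complex and r :: real
  show "u *\<^sub>C (a + b) = u *\<^sub>C a + u *\<^sub>C b" by transfer (simp add: scaleC_add_right)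
  show "(u + v) *\<^sub>C a = u *\<^sub>C a + v *\<^sub>C a" by transfer (simp add: scaleC_add_left)
  show "u *\<^sub>C v *\<^sub>C a = (u * v) *\<^sub>C a" by transfer (simp add: scaleC_scaleC)
  show "complex_of_real r *\<^sub>C a = r *\<^sub>R a" by transfer (simp add: scaleC_of_real)
  show "cinner a b = cnj (cinner b a)"
    unfolding cinner_ell2_def infsum_cnj[symmetric] by (intro infsum_cong cinner_commute)
  show "cinner (a + b) c = cinner a c + cinner b c"
    unfolding cinner_ell2_def
    by (simp add: plus_ell2.rep_eq cinner_add_left infsum_add cinner_summable)
  show "cinner (u *\<^sub>C a) b = u * cinner a b"
    unfolding cinner_ell2_def
    by (simp add: scaleC_ell2.rep_eq cinner_scaleC_left infsum_cmult_right')
  have "Re (cinner a a) = (\<Sum>\<^sub>\<infinity>g. Re (cinner (Rep_ell2 a g) (Rep_ell2 a g)))"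
    unfolding cinner_ell2_def by (rule infsum_Re[symmetric]) (rule cinner_summable)
  then show "norm a = sqrt (Re (cinner a a))"
    by (simp add: norm_ell2.rep_eq cinner_self del: of_real_power)
qed

end

lift_definition single_ell2 :: "'g \<Rightarrow> 'h :: real_normed_vector \<Rightarrow> ('g, 'h) ell2" is
  "\<lambda>g v k. if k = g then v else 0"
proof -
  fix g :: 'g and v :: 'h
  show "(\<lambda>k. (norm (if k = g then v else 0))\<^sup>2) summable_on UNIV"
    by (subst summable_on_cong_neutral[where T = "{g}"]) auto
qed

definition bounded_ops :: "('h :: chilbert_space \<Rightarrow> 'h) set" where
  "bounded_ops = {T. bounded_linear T \<and> (\<forall>c v. T (c *\<^sub>C v) = c *\<^sub>C T v)}"

definition adj :: "('h :: chilbert_space \<Rightarrow> 'h) \<Rightarrow> 'h \<Rightarrow> 'h" where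
  "adj T = (THE S. \<forall>v w. cinner (T v) w = cinner v (S w))"

definition commutant :: "('h :: chilbert_space \<Rightarrow> 'h) set \<Rightarrow> ('h \<Rightarrow> 'h) set" where
  "commutant A = {T \<in> bounded_ops. \<forall>S\<in>A. T \<circ> S = S \<circ> T}"

text \<open>A von Neumann algebra on a Hilbert space is a *-subalgebra of the bounded operators that
  equals its bicommutant; closure under the algebra operations and the presence of the identity
  operator follow from the last clause. In particular subalgebras share the unit of the ambient
  algebra.\<close>

definition von_neumann_algebra :: "('h :: chilbert_space \<Rightarrow> 'h) set \<Rightarrow> bool" where
  "von_neumann_algebra A \<longleftrightarrow>
    A \<subseteq> bounded_ops \<and> (\<forall>T\<in>A. adj T \<in> A) \<and> commutant (commutant A) = A"

definition finite_von_neumann_algebra :: "('h :: chilbert_space \<Rightarrow> 'h) set \<Rightarrow> bool" where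
  "finite_von_neumann_algebra A \<longleftrightarrow>
    von_neumann_algebra A \<and> (\<forall>T\<in>A. adj T \<circ> T = id \<longrightarrow> T \<circ> adj T = id)"

definition positive_op :: "('h :: chilbert_space \<Rightarrow> 'h) \<Rightarrow> bool" where
  "positive_op T \<longleftrightarrow> T \<in> bounded_ops \<and> (\<forall>v. cinner (T v) v \<in> \<real> \<and> 0 \<le> Re (cinner (T v) v))"

definition op_le :: "('h :: chilbert_space \<Rightarrow> 'h) \<Rightarrow> ('h \<Rightarrow> 'h) \<Rightarrow> bool" where
  "op_le S T \<longleftrightarrow> positive_op (\<lambda>v. T v - S v)"

definition linear_map_on ::
  "('h :: chilbert_space \<Rightarrow> 'h) set \<Rightarrow> (('h \<Rightarrow> 'h) \<Rightarrow> 'k \<Rightarrow> 'k :: chilbert_space) \<Rightarrow> bool" where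
  "linear_map_on A \<phi> \<longleftrightarrow>
    (\<forall>S\<in>A. \<forall>T\<in>A. \<phi> (\<lambda>v. S v + T v) = (\<lambda>v. \<phi> S v + \<phi> T v)) \<and>
    (\<forall>c. \<forall>T\<in>A. \<phi> (\<lambda>v. c *\<^sub>C T v) = (\<lambda>v. c *\<^sub>C \<phi> T v))"

text \<open>Traces are finite, but not normalised.\<close>

definition trace_on ::
  "('h :: chilbert_space \<Rightarrow> 'h) set \<Rightarrow> (('h \<Rightarrow> 'h) \<Rightarrow> complex) \<Rightarrow> bool" where
  "trace_on A \<tau> \<longleftrightarrow>
    (\<forall>S\<in>A. \<forall>T\<in>A. \<tau> (\<lambda>v. S v + T v) = \<tau> S + \<tau> T) \<and>
    (\<forall>c. \<forall>T\<in>A. \<tau> (\<lambda>v. c *\<^sub>C T v) = c * \<tau> T) \<and>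
    (\<forall>T\<in>A. positive_op T \<longrightarrow> \<tau> T \<in> \<real> \<and> 0 \<le> Re (\<tau> T)) \<and>
    (\<forall>S\<in>A. \<forall>T\<in>A. \<tau> (S \<circ> T) = \<tau> (T \<circ> S))"

definition faithful_on ::
  "('h :: chilbert_space \<Rightarrow> 'h) set \<Rightarrow> (('h \<Rightarrow> 'h) \<Rightarrow> complex) \<Rightarrow> bool" where
  "faithful_on A \<tau> \<longleftrightarrow> (\<forall>T\<in>A. \<tau> (adj T \<circ> T) = 0 \<longrightarrow> T = (\<lambda>_. 0))"

text \<open>Normality: \<open>\<tau>\<close> preserves suprema of upward directed families of positive elements of \<open>A\<close>
  having a least upper bound in \<open>A\<close>.\<close>

definition normal_on ::
  "('h :: chilbert_space \<Rightarrow> 'h) set \<Rightarrow> (('h \<Rightarrow> 'h) \<Rightarrow> complex) \<Rightarrow> bool" where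
  "normal_on A \<tau> \<longleftrightarrow>
    (\<forall>D s. D \<subseteq> A \<and> D \<noteq> {} \<and> (\<forall>T\<in>D. positive_op T) \<and>
        (\<forall>S\<in>D. \<forall>T\<in>D. \<exists>R\<in>D. op_le S R \<and> op_le T R) \<and>
        s \<in> A \<and> (\<forall>T\<in>D. op_le T s) \<and> (\<forall>b\<in>A. (\<forall>T\<in>D. op_le T b) \<longrightarrow> op_le s b)
      \<longrightarrow> Re (\<tau> s) = (SUP T\<in>D. Re (\<tau> T)))"

text \<open>Groups are written additively, using the (not necessarily commutative) class
  \<^class>\<open>group_add\<close>.\<close>

definition star_automorphism ::
  "('h :: chilbert_space \<Rightarrow> 'h) set \<Rightarrow> (('h \<Rightarrow> 'h) \<Rightarrow> 'h \<Rightarrow> 'h) \<Rightarrow> bool" where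
  "star_automorphism A \<theta> \<longleftrightarrow>
    bij_betw \<theta> A A \<and> linear_map_on A \<theta> \<and>
    (\<forall>S\<in>A. \<forall>T\<in>A. \<theta> (S \<circ> T) = \<theta> S \<circ> \<theta> T) \<and> (\<forall>T\<in>A. \<theta> (adj T) = adj (\<theta> T))"

definition trace_preserving_action ::
  "('g :: group_add \<Rightarrow> ('h :: chilbert_space \<Rightarrow> 'h) \<Rightarrow> 'h \<Rightarrow> 'h) \<Rightarrow>
    ('h \<Rightarrow> 'h) set \<Rightarrow> (('h \<Rightarrow> 'h) \<Rightarrow> complex) \<Rightarrow> bool" where
  "trace_preserving_action \<sigma> A \<tau> \<longleftrightarrow>
    (\<forall>g. star_automorphism A (\<sigma> g)) \<and>
    (\<forall>T\<in>A. \<sigma> 0 T = T) \<and> (\<forall>g h. \<forall>T\<in>A. \<sigma> (g + h) T = \<sigma> g (\<sigma> h T)) \<and>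
    (\<forall>g. \<forall>T\<in>A. \<tau> (\<sigma> g T) = \<tau> T)"

definition invariant_under ::
  "('g \<Rightarrow> ('h \<Rightarrow> 'h) \<Rightarrow> 'h \<Rightarrow> 'h) \<Rightarrow> ('h \<Rightarrow> 'h) set \<Rightarrow> bool" where
  "invariant_under \<sigma> A \<longleftrightarrow> (\<forall>g. \<sigma> g ` A \<subseteq> A)"

text \<open>The crossed product acts on the square-summable functions from the group to \<open>'h\<close>. The
  functions under \<^const>\<open>Abs_ell2\<close> are square-summable: translation is isometric, and
  *-automorphisms preserve the operator norm.\<close>

definition alg_embed ::
  "('g :: group_add \<Rightarrow> ('h :: chilbert_space \<Rightarrow> 'h) \<Rightarrow> 'h \<Rightarrow> 'h) \<Rightarrow>
    ('h \<Rightarrow> 'h) \<Rightarrow> ('g, 'h) ell2 \<Rightarrow> ('g, 'h) ell2" where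
  "alg_embed \<sigma> T \<xi> = Abs_ell2 (\<lambda>g. \<sigma> (- g) T (Rep_ell2 \<xi> g))"

definition translation ::
  "'g :: group_add \<Rightarrow> ('g, 'h :: chilbert_space) ell2 \<Rightarrow> ('g, 'h) ell2" where
  "translation h \<xi> = Abs_ell2 (\<lambda>g. Rep_ell2 \<xi> (- h + g))"

definition crossed_product ::
  "('g :: group_add \<Rightarrow> ('h :: chilbert_space \<Rightarrow> 'h) \<Rightarrow> 'h \<Rightarrow> 'h) \<Rightarrow>
    ('h \<Rightarrow> 'h) set \<Rightarrow> (('g, 'h) ell2 \<Rightarrow> ('g, 'h) ell2) set" where
  "crossed_product \<sigma> A = von_neumann_algebra hull (alg_embed \<sigma> ` A \<union> range translation)"

text \<open>The canonical trace is \<open>\<tau>\<close> of the matrix entry at the neutral element, so that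
  \<open>\<Sum>g. a\<^sub>g u\<^sub>g\<close> is mapped to \<open>\<tau>\<close> of the coefficient at the neutral element.\<close>

definition canonical_trace ::
  "(('h :: chilbert_space \<Rightarrow> 'h) \<Rightarrow> complex) \<Rightarrow>
    (('g :: group_add, 'h) ell2 \<Rightarrow> ('g, 'h) ell2) \<Rightarrow> complex" where
  "canonical_trace \<tau> X = \<tau> (\<lambda>v. Rep_ell2 (X (single_ell2 0 v)) 0)"

text \<open>For a faithful normal trace \<open>t\<close> on \<open>M\<close> such a map exists and is unique on \<open>M\<close>; its values
  outside \<open>M\<close> play no role.\<close>

definition trace_preserving_conditional_expectation ::
  "(('k :: chilbert_space \<Rightarrow> 'k) \<Rightarrow> complex) \<Rightarrow> ('k \<Rightarrow> 'k) set \<Rightarrow> ('k \<Rightarrow> 'k) set \<Rightarrow>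
    (('k \<Rightarrow> 'k) \<Rightarrow> 'k \<Rightarrow> 'k) \<Rightarrow> bool" where
  "trace_preserving_conditional_expectation t M N E \<longleftrightarrow>
    E ` M \<subseteq> N \<and> linear_map_on M E \<and> (\<forall>X\<in>N. E X = X) \<and>
    (\<forall>X\<in>M. positive_op X \<longrightarrow> positive_op (E X)) \<and>
    (\<forall>X\<in>M. \<forall>Y\<in>N. \<forall>Z\<in>N. E (Y \<circ> X \<circ> Z) = Y \<circ> E X \<circ> Z) \<and>
    (\<forall>X\<in>M. t (E X) = t X)"

end

theory Submission
  imports Defs
begin

text \<open>Write \<open>X\<^bsub>g,h\<^esub>\<close> for the matrix entries (\<open>entry X g h\<close>) of an operator \<open>X\<close> on \<open>\<ell>\<^sup>2(\<Gamma>, H)\<close>.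
  If \<open>Q \<subseteq> P\<close> is an invariant von Neumann subalgebra, then \<open>X\<close> belongs to \<open>Q \<rtimes> \<Gamma>\<close> if and only if its
  entries lie in \<open>Q\<close> and satisfy \<open>X\<^bsub>g,h\<^esub> = \<sigma>\<^bsub>-g\<^esub>(X\<^bsub>0,h-g\<^esub>)\<close>. For sufficiency one compares the series
  for the entries of \<open>X T\<close> and \<open>T X\<close>, where \<open>T\<close> commutes with the generators. For necessity \<open>X\<close> is
  approximated by elements of the algebraic crossed product.

  If \<open>N = Q \<rtimes> \<Gamma>\<close> and \<open>X = E(x)\<close> with \<open>x \<in> P\<close>, then \<open>\<tau>(X\<^bsub>0,k\<^esub> q) = 0\<close> for \<open>k \<noteq> 0\<close> and all \<open>q \<in> Q\<close>, so the
  off-diagonal entries of \<open>X\<close> vanish and \<open>X \<in> P\<close>. Conversely, if \<open>E\<close> maps \<open>P\<close> into itself, let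
  \<open>Q = P \<inter> N\<close>. For \<open>X \<in> N\<close> and \<open>a \<in> P\<close> we have \<open>\<tau>(X\<^bsub>0,0\<^esub> a) = \<tau>(X\<^bsub>0,0\<^esub> E(a)) = \<tau>(E(X\<^bsub>0,0\<^esub>) a)\<close>, hence
  \<open>X\<^bsub>0,0\<^esub> = E(X\<^bsub>0,0\<^esub>) \<in> Q\<close>. Applied to the products of \<open>X\<close> with translations, this puts all entries
  of \<open>X\<close> into \<open>Q\<close>.

  Both the necessity of the covariance relation and the fact that \<open>Q\<close> is a von Neumann algebra on \<open>H\<close>
  need a weak form of normality. Strong approximants \<open>a\<close> of a selfadjoint operator need not be bounded,
  but their resolvents \<open>(a + i)\<inverse>\<close> are contractions, and on bounded sets strong convergence implies
  convergence in the norm \<open>\<tau>(b\<^sup>* b)\<^sup>1\<^sup>/\<^sup>2\<close>, because \<open>\<tau>\<close> is normal.\<close>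

subsection \<open>Hilbert spaces and adjoints\<close>

text \<open>\<open>P\<close> acts on an arbitrary Hilbert space, so \<open>\<tau>\<close> need not
  be a vector functional, and no \<open>\<sigma> g\<close> is assumed to be unitarily implemented or
  strongly continuous. Closeness of operators on finitely many vectors is therefore not visibly
  respected by \<open>\<sigma> g\<close>; the norm of the trace is. Passing from the former to the
  latter shapes the proof: covariance compares entries at different positions through
  \<open>\<sigma>\<close>, and \<open>Q\<close> is defined by \<open>alg_embed \<sigma>\<close>,
  which contains all the \<open>\<sigma> (- g)\<close>.

  Resolvents permit the passage because
  \<open>(a + i)^-1 - (b + i)^-1 = (a + i)^-1 (b - a) (b + i)^-1\<close>. The left factor is a
  contraction, so only the values of \<open>a\<close> and \<open>b\<close> on the vectors
  \<open>(b + i)^-1 w\<close> matter, and these do not depend on the approximant \<open>a\<close>.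
  This requires selfadjoint approximants, hence a density theorem for the selfadjoint part of an
  algebra. Normality, given as preservation of suprema, has to be turned into a smallness criterion
  on finitely many vectors.\<close>

lemma scaleC_one [simp]: "1 *\<^sub>C x = (x :: 'a :: chilbert_space)"
  using scaleC_of_real[of 1 x] by simp

lemma scaleC_zero_left [simp]: "0 *\<^sub>C x = (0 :: 'a :: chilbert_space)"
  using scaleC_of_real[of 0 x] by simp

lemma scaleC_zero_right [simp]: "c *\<^sub>C 0 = (0 :: 'a :: chilbert_space)"
  using norm_scaleC[of c "0 :: 'a"] by simp

lemma scaleC_minus_left: "(- c) *\<^sub>C x = - (c *\<^sub>C (x :: 'a :: chilbert_space))"
  using scaleC_add_left[of "- c" c x] by (simp add: eq_neg_iff_add_eq_0)

lemma scaleC_minus_right: "c *\<^sub>C (- x) = - (c *\<^sub>C (x :: 'a :: chilbert_space))"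
  using scaleC_add_right[of c "- x" x] by (simp add: eq_neg_iff_add_eq_0)

lemma scaleC_diff_right: "c *\<^sub>C (x - y) = c *\<^sub>C x - c *\<^sub>C (y :: 'a :: chilbert_space)"
  using scaleC_add_right[of c x "- y"] by (simp add: scaleC_minus_right)

lemma scaleR_scaleC: "r *\<^sub>R x = complex_of_real r *\<^sub>C (x :: 'a :: chilbert_space)"
  by (simp add: scaleC_of_real)

lemma cinner_zero [simp]: "cinner 0 x = 0" "cinner x 0 = (0 :: complex)" for x :: "'a :: chilbert_space"
  using norm_cinner_le[of 0 x] norm_cinner_le[of x 0] by simp_all

lemma cinner_minus_left: "cinner (- x) y = - cinner x (y :: 'a :: chilbert_space)"
  using cinner_add_left[of x "- x" y] by (simp add: eq_neg_iff_add_eq_0 add.commute)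

lemma cinner_minus_right: "cinner x (- y) = - cinner x (y :: 'a :: chilbert_space)"
  using cinner_add_right[of x y "- y"] by (simp add: eq_neg_iff_add_eq_0 add.commute)

lemma cinner_diff_left: "cinner (x - y) z = cinner x z - cinner y (z :: 'a :: chilbert_space)"
  using cinner_add_left[of x "- y" z] by (simp add: cinner_minus_left)

lemma cinner_diff_right: "cinner x (y - z) = cinner x y - cinner x (z :: 'a :: chilbert_space)"
  using cinner_add_right[of x y "- z"] by (simp add: cinner_minus_right)

lemma cinner_scaleR_left: "cinner (r *\<^sub>R x) y = of_real r * cinner x (y :: 'a :: chilbert_space)"
  by (simp add: scaleR_scaleC cinner_scaleC_left)

lemma cinner_scaleR_right: "cinner x (r *\<^sub>R y) = of_real r * cinner x (y :: 'a :: chilbert_space)"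
  by (simp add: scaleR_scaleC cinner_scaleC_right)

lemmas cinner_simps = cinner_add_left cinner_add_right cinner_diff_left cinner_diff_right
  cinner_minus_left cinner_minus_right cinner_scaleC_left cinner_scaleC_right
  cinner_scaleR_left cinner_scaleR_right

lemma Re_cinner_self: "Re (cinner x x) = (norm (x :: 'a :: chilbert_space))\<^sup>2"
  by (simp add: cinner_self del: of_real_power)

lemma Re_cinner_commute: "Re (cinner x y) = Re (cinner y (x :: 'a :: chilbert_space))"
  by (metis cinner_commute complex_cnj(1) complex.sel(1) cnj.simps(1))

lemma norm_add_sq: "(norm (x + y))\<^sup>2 = (norm x)\<^sup>2 + 2 * Re (cinner x y) + (norm (y :: 'a :: chilbert_space))\<^sup>2"
  unfolding Re_cinner_self[symmetric] by (simp add: cinner_simps Re_cinner_commute[of y x])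

lemma norm_diff_sq: "(norm (x - y))\<^sup>2 = (norm x)\<^sup>2 - 2 * Re (cinner x y) + (norm (y :: 'a :: chilbert_space))\<^sup>2"
  using norm_add_sq[of x "- y"] by (simp add: cinner_minus_right)

section \<open>Continuity of the inner product and nearest points\<close>

lemma parallelogram:
  "(norm (x + y))\<^sup>2 + (norm (x - y))\<^sup>2 = 2 * (norm x)\<^sup>2 + 2 * (norm (y :: 'a :: chilbert_space))\<^sup>2"
  by (simp add: norm_add_sq norm_diff_sq)

lemma bounded_linear_cinner_left: "bounded_linear (\<lambda>x. cinner x (y :: 'a :: chilbert_space))"
  by (rule bounded_linear_intro[where K = "norm y"])
    (auto simp: cinner_simps scaleR_conv_of_real norm_cinner_le)

lemma bounded_linear_cinner_right: "bounded_linear (\<lambda>y. cinner (x :: 'a :: chilbert_space) y)"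
  by (rule bounded_linear_intro[where K = "norm x"])
    (simp_all add: cinner_simps scaleR_conv_of_real norm_cinner_le mult.commute[of "norm _" "norm x"])

lemmas tendsto_cinner_left = bounded_linear.tendsto[OF bounded_linear_cinner_left]
lemmas tendsto_cinner_right = bounded_linear.tendsto[OF bounded_linear_cinner_right]

lemma cinner_ext: "(\<And>w. cinner w x = cinner w y) \<Longrightarrow> x = (y :: 'a :: chilbert_space)"
  using cinner_self[of "x - y"] by (simp add: cinner_diff_right)

text \<open>A minimising sequence is Cauchy by the parallelogram law, since midpoints stay in
  \<open>V\<close>. Only a real subspace is asked for: besides Riesz representation, the result
  serves for the values at a vector of the selfadjoint operators of an algebra, which in general
  form no complex subspace.\<close>

lemma nearest_point:
  fixes V :: "'a :: chilbert_space set"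
  assumes V: "subspace V" "closed V"
  obtains p where "p \<in> V" "\<And>v. v \<in> V \<Longrightarrow> Re (cinner v (x - p)) = 0"
proof -
  define d where "d = infdist x V"
  have ne: "V \<noteq> {}"
    using subspace_0[OF V(1)] by auto
  have d_le: "d \<le> norm (x - v)" if "v \<in> V" for v
    unfolding d_def using infdist_le[OF that, of x] by (simp add: dist_norm)
  have d0: "0 \<le> d"
    unfolding d_def by (rule infdist_nonneg)
  have "\<exists>v\<in>V. norm (x - v) < d + inverse (real (Suc n))" for n
  proof (rule ccontr)
    assume "\<not> ?thesis"
    then have "d + inverse (real (Suc n)) \<le> infdist x V"
      unfolding infdist_notempty[OF ne] using ne by (intro cINF_greatest) (auto simp: dist_norm not_less)
    then show False
      unfolding d_def by (simp add: inverse_eq_divide)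
  qed
  then obtain p where p: "\<And>n. p n \<in> V" "\<And>n. norm (x - p n) < d + inverse (real (Suc n))"
    by metis
  have lim: "(\<lambda>n. norm (x - p n)) \<longlonglongrightarrow> d"
  proof (rule tendsto_sandwich[of "\<lambda>_. d" _ _ "\<lambda>n. d + inverse (real (Suc n))"])
    show "(\<lambda>n. d + inverse (real (Suc n))) \<longlonglongrightarrow> d"
      using tendsto_add[OF tendsto_const LIMSEQ_inverse_real_of_nat, of d] by simp
  qed (use d_le p in \<open>auto intro!: always_eventually less_imp_le\<close>)
  have bound: "(norm (p m - p n))\<^sup>2 \<le> 2 * (norm (x - p m))\<^sup>2 + 2 * (norm (x - p n))\<^sup>2 - 4 * d\<^sup>2" for m n
  proof -
    have "(1/2) *\<^sub>R (p m + p n) \<in> V"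
      using V(1) p(1) by (intro subspace_scale subspace_add)
    from d_le[OF this] have "2 * d \<le> norm (2 *\<^sub>R (x - (1/2) *\<^sub>R (p m + p n)))"
      by simp
    also have "2 *\<^sub>R (x - (1/2) *\<^sub>R (p m + p n)) = (x - p m) + (x - p n)"
      by (simp add: algebra_simps scaleR_2)
    finally have "(2 * d)\<^sup>2 \<le> (norm ((x - p m) + (x - p n)))\<^sup>2"
      using d0 by (intro power_mono) auto
    then show ?thesis
      using parallelogram[of "x - p m" "x - p n"] by (simp add: norm_minus_commute power_mult_distrib)
  qed
  have "Cauchy p"
  proof (rule metric_CauchyI)
    fix e :: real assume e: "0 < e"
    have "(\<lambda>n. (norm (x - p n))\<^sup>2) \<longlonglongrightarrow> d\<^sup>2"
      by (intro tendsto_intros lim)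
    then obtain M where M: "\<And>n. n \<ge> M \<Longrightarrow> \<bar>(norm (x - p n))\<^sup>2 - d\<^sup>2\<bar> < e\<^sup>2 / 4"
      using LIMSEQ_D[of _ "d\<^sup>2" "e\<^sup>2 / 4"] e by auto
    have "dist (p m) (p n) < e" if "m \<ge> M" "n \<ge> M" for m n
    proof -
      have "(norm (p m - p n))\<^sup>2 < e\<^sup>2"
        using bound[of m n] M[OF that(1)] M[OF that(2)] by linarith
      then show ?thesis
        using e by (simp add: dist_norm power2_less_imp_less)
    qed
    then show "\<exists>M. \<forall>m\<ge>M. \<forall>n\<ge>M. dist (p m) (p n) < e"
      by blast
  qed
  then obtain q where q: "p \<longlonglongrightarrow> q"
    using Cauchy_convergent convergent_def by blast
  have qV: "q \<in> V"
    using V(2) p(1) q closed_sequential_limits by blast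
  have "(\<lambda>n. norm (x - p n)) \<longlonglongrightarrow> norm (x - q)"
    by (intro tendsto_intros q)
  then have dq: "norm (x - q) = d"
    using lim LIMSEQ_unique by blast
  have "Re (cinner v (x - q)) = 0" if v: "v \<in> V" for v
  proof (rule ccontr)
    assume ne0: "Re (cinner v (x - q)) \<noteq> 0"
    define r where "r = Re (cinner v (x - q))"
    \<comment> \<open>Up to the added \<open>1\<close>, which makes the denominator positive
      outright, this coefficient minimises the distance from \<open>x\<close> to
      \<open>q + t *\<^sub>R v\<close>; the distance still drops below \<open>d\<close>.\<close>
    define t where "t = r / ((norm v)\<^sup>2 + 1)"
    have pos: "(norm v)\<^sup>2 + 1 > 0"
      by (smt (verit) zero_le_power2)
    have "q + t *\<^sub>R v \<in> V"
      using V(1) qV v by (intro subspace_scale subspace_add)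
    from d_le[OF this] have "d\<^sup>2 \<le> (norm ((x - q) - t *\<^sub>R v))\<^sup>2"
      using d0 by (intro power_mono) (auto simp: algebra_simps)
    also have "\<dots> = d\<^sup>2 - 2 * t * r + t\<^sup>2 * (norm v)\<^sup>2"
      unfolding norm_diff_sq dq r_def by (simp add: cinner_simps power_mult_distrib Re_cinner_commute)
    also have "\<dots> = d\<^sup>2 - t * r * (2 - (norm v)\<^sup>2 / ((norm v)\<^sup>2 + 1))"
    proof -
      have "t\<^sup>2 * (norm v)\<^sup>2 = t * r * ((norm v)\<^sup>2 / ((norm v)\<^sup>2 + 1))"
        by (simp add: t_def power2_eq_square)
      then show ?thesis
        by (simp add: algebra_simps)
    qed
    finally have "t * r * (2 - (norm v)\<^sup>2 / ((norm v)\<^sup>2 + 1)) \<le> 0"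
      by simp
    moreover have "t * r > 0"
      using ne0 pos unfolding t_def r_def[symmetric] by (simp add: power2_eq_square[symmetric])
    moreover have "2 - (norm v)\<^sup>2 / ((norm v)\<^sup>2 + 1) > 0"
      using pos by (simp add: field_simps)
    ultimately show False
      by (smt (verit) mult_pos_pos)
  qed
  then show ?thesis
    using that qV by blast
qed

definition csubspace :: "'a :: chilbert_space set \<Rightarrow> bool" where
  "csubspace V \<longleftrightarrow> 0 \<in> V \<and> (\<forall>x\<in>V. \<forall>y\<in>V. x + y \<in> V) \<and> (\<forall>c. \<forall>x\<in>V. c *\<^sub>C x \<in> V)"

lemma csubspaceD:
  assumes "csubspace V"
  shows "0 \<in> V" "x \<in> V \<Longrightarrow> y \<in> V \<Longrightarrow> x + y \<in> V" "x \<in> V \<Longrightarrow> c *\<^sub>C x \<in> V"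
    "x \<in> V \<Longrightarrow> y \<in> V \<Longrightarrow> x - y \<in> V"
proof -
  show add: "x \<in> V \<Longrightarrow> y \<in> V \<Longrightarrow> x + y \<in> V" for x y
    using assms by (auto simp: csubspace_def)
  show scale: "x \<in> V \<Longrightarrow> c *\<^sub>C x \<in> V" for x c
    using assms by (auto simp: csubspace_def)
  show "x \<in> V \<Longrightarrow> y \<in> V \<Longrightarrow> x - y \<in> V"
    using add[of x "(- 1) *\<^sub>C y"] scale[of y "- 1"] by (simp add: scaleC_minus_left)
qed (use assms in \<open>auto simp: csubspace_def\<close>)

lemma csubspace_imp_subspace: "csubspace V \<Longrightarrow> subspace V"
  unfolding subspace_def by (auto simp: csubspaceD scaleR_scaleC)

text \<open>Orthogonality in the real part, used at \<open>v\<close> and at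
  \<open>\<i> *\<^sub>C v\<close>, makes both the real and the imaginary part vanish.\<close>

lemma nearest_point_complex:
  fixes V :: "'a :: chilbert_space set"
  assumes V: "csubspace V" "closed V"
  obtains p where "p \<in> V" "\<And>v. v \<in> V \<Longrightarrow> cinner v (x - p) = 0"
proof -
  obtain p where p: "p \<in> V" "\<And>v. v \<in> V \<Longrightarrow> Re (cinner v (x - p)) = 0"
    using nearest_point[OF csubspace_imp_subspace[OF V(1)] V(2)] by blast
  have "cinner v (x - p) = 0" if "v \<in> V" for v
    using p(2)[OF that] p(2)[OF csubspaceD(3)[OF V(1) that, of \<i>]]
    by (simp add: cinner_simps complex_eq_iff)
  then show ?thesis
    using that p(1) by blast
qed

section \<open>Bounded operators, Riesz representation and adjoints\<close>

lemma bounded_opsI: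
  assumes "\<And>x y. T (x + y) = T x + T y" "\<And>c x. T (c *\<^sub>C x) = c *\<^sub>C T x"
    "\<And>x. norm (T x) \<le> K * norm x"
  shows "T \<in> bounded_ops"
  unfolding bounded_ops_def using assms
  by (auto intro!: bounded_linear_intro[where K = K] simp: scaleR_scaleC mult.commute)

lemma bounded_opsD:
  assumes "T \<in> bounded_ops"
  shows "bounded_linear T" "T (x + y) = T x + T y" "T (c *\<^sub>C x) = c *\<^sub>C T x"
    "T (x - y) = T x - T y" "T 0 = 0" "T (- x) = - T x" "T (r *\<^sub>R x) = r *\<^sub>R T x"
  using assms unfolding bounded_ops_def
  by (auto simp: linear_simps)

lemma bounded_ops_bound:
  assumes "T \<in> bounded_ops"
  obtains K where "0 \<le> K" "\<And>x. norm (T x) \<le> K * norm x"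
  using bounded_linear.nonneg_bounded[OF bounded_opsD(1)[OF assms]] by (metis mult.commute)

lemma bounded_ops_id [simp]: "id \<in> bounded_ops" "(\<lambda>v. v) \<in> bounded_ops"
  by (auto intro: bounded_opsI[where K = 1])

lemma bounded_ops_zero [simp]: "(\<lambda>v. 0) \<in> bounded_ops"
  by (auto intro: bounded_opsI[where K = 0])

lemma bounded_ops_add:
  assumes "S \<in> bounded_ops" "T \<in> bounded_ops"
  shows "(\<lambda>v. S v + T v) \<in> bounded_ops"
  using assms unfolding bounded_ops_def by (auto intro: bounded_linear_add simp: scaleC_add_right)

lemma bounded_ops_comp:
  assumes "S \<in> bounded_ops" "T \<in> bounded_ops"
  shows "S \<circ> T \<in> bounded_ops"
  using assms unfolding bounded_ops_def
  by (auto intro: bounded_linear_compose simp: comp_def)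

lemma bounded_ops_scaleC:
  assumes T: "T \<in> bounded_ops"
  shows "(\<lambda>v. c *\<^sub>C T v) \<in> bounded_ops"
proof -
  obtain K where K: "\<And>x. norm (T x) \<le> K * norm x"
    using bounded_ops_bound[OF T] by blast
  show ?thesis
  proof (rule bounded_opsI[where K = "cmod c * K"])
    show "norm (c *\<^sub>C T x) \<le> cmod c * K * norm x" for x
      using mult_left_mono[OF K, of "cmod c" x] by (simp add: norm_scaleC mult.assoc)
  qed (simp_all add: bounded_opsD[OF T] scaleC_add_right scaleC_scaleC mult.commute)
qed

lemma bounded_ops_diff:
  assumes "S \<in> bounded_ops" "T \<in> bounded_ops"
  shows "(\<lambda>v. S v - T v) \<in> bounded_ops"
  using bounded_ops_add[OF assms(1) bounded_ops_scaleC[OF assms(2), of "- 1"]]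
  by (simp add: scaleC_minus_left)

lemma riesz:
  fixes f :: "'a :: chilbert_space \<Rightarrow> complex"
  assumes f: "bounded_linear f" and hom: "\<And>c v. f (c *\<^sub>C v) = c * f v"
  shows "\<exists>z. \<forall>v. f v = cinner v z"
proof -
  define V where "V = {v. f v = 0}"
  have V: "csubspace V" "closed V"
    using f hom by (auto simp: V_def csubspace_def linear_simps
        intro!: closed_Collect_eq linear_continuous_on)
  show ?thesis
  proof (cases "V = UNIV")
    case True
    then show ?thesis
      by (intro exI[of _ 0]) (auto simp: V_def)
  next
    case False
    then obtain x where x: "f x \<noteq> 0"
      by (auto simp: V_def)
    obtain p where p: "p \<in> V" "\<And>v. v \<in> V \<Longrightarrow> cinner v (x - p) = 0"
      using nearest_point_complex[OF V] by blast
    define u where "u = x - p"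
    have fu: "f u \<noteq> 0"
      using x p(1) f by (simp add: u_def V_def linear_simps)
    then have u0: "u \<noteq> 0"
      using f by (auto simp: linear_simps)
    define z where "z = (cnj (f u) / of_real ((norm u)\<^sup>2)) *\<^sub>C u"
    have "f v = cinner v z" for v
    proof -
      have "v - (f v / f u) *\<^sub>C u \<in> V"
        using f fu hom by (simp add: V_def linear_simps)
      then have "cinner (v - (f v / f u) *\<^sub>C u) u = 0"
        using p(2) u_def by blast
      then have "cinner v u = (f v / f u) * of_real ((norm u)\<^sup>2)"
        by (simp add: cinner_simps cinner_self)
      then show ?thesis
        using fu u0 by (simp add: z_def cinner_simps)
    qed
    then show ?thesis
      by blast
  qed
qed

lemma adj_unique:
  assumes "\<And>v w. cinner (T v) w = cinner v (S w)"
  shows "adj T = (S :: 'a :: chilbert_space \<Rightarrow> 'a)"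
  unfolding adj_def
proof (rule the_equality)
  fix R assume "\<forall>v w. cinner (T v) w = cinner v (R w)"
  then have "cinner v (R w) = cinner v (S w)" for v w
    using assms by metis
  then show "R = S"
    by (intro ext) (rule cinner_ext)
qed (use assms in blast)

text \<open>\<open>adj\<close> is a definite description, so everything rests on existence: Riesz
  representation of \<open>v \<mapsto> cinner (T v) w\<close> supplies the value at
  \<open>w\<close>. The bound comes from
  \<open>(norm (S x))^2 = Re (cinner (T (S x)) x)\<close>.\<close>

lemma adj_bounded_ops_and_cinner:
  fixes T :: "'a :: chilbert_space \<Rightarrow> 'a"
  assumes T: "T \<in> bounded_ops"
  shows "adj T \<in> bounded_ops \<and> (\<forall>v w. cinner (T v) w = cinner v (adj T w))"
proof -
  have "\<exists>z. \<forall>v. cinner (T v) w = cinner v z" for w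
    by (rule riesz)
      (auto intro: bounded_linear_compose[OF bounded_linear_cinner_left bounded_opsD(1)[OF T]]
        simp: bounded_opsD[OF T] cinner_simps)
  then obtain S where S: "\<And>v w. cinner (T v) w = cinner v (S w)"
    by metis
  obtain K where K: "0 \<le> K" "\<And>x. norm (T x) \<le> K * norm x"
    using bounded_ops_bound[OF T] by blast
  have "S \<in> bounded_ops"
  proof (rule bounded_opsI)
    show "S (x + y) = S x + S y" for x y
      by (rule cinner_ext) (simp add: cinner_simps flip: S)
    show "S (c *\<^sub>C x) = c *\<^sub>C S x" for c x
      by (rule cinner_ext) (simp add: cinner_simps flip: S)
    show "norm (S x) \<le> K * norm x" for x
    proof (cases "S x = 0")
      case False
      have "(norm (S x))\<^sup>2 = Re (cinner (T (S x)) x)"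
        by (simp add: S Re_cinner_self)
      also have "\<dots> \<le> norm (T (S x)) * norm x"
        by (rule Re_cinner_le)
      also have "\<dots> \<le> K * norm (S x) * norm x"
        by (intro mult_right_mono K) auto
      finally have "norm (S x) * norm (S x) \<le> norm (S x) * (K * norm x)"
        by (simp add: power2_eq_square mult_ac)
      then show ?thesis
        using False by (simp add: mult_le_cancel_left)
    qed (use K in simp)
  qed
  moreover have "adj T = S"
    using S by (rule adj_unique)
  ultimately show ?thesis
    using S by simp
qed

lemmas adj_bounded_ops = adj_bounded_ops_and_cinner[THEN conjunct1]

lemma cinner_adj_right: "T \<in> bounded_ops \<Longrightarrow> cinner v (adj T w) = cinner (T v) w"
  using adj_bounded_ops_and_cinner by metis

lemma cinner_adj_left: "T \<in> bounded_ops \<Longrightarrow> cinner (adj T v) w = cinner v (T w)"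
  using cinner_adj_right[of T w v] cinner_commute by metis

lemma adj_adj: "T \<in> bounded_ops \<Longrightarrow> adj (adj T) = T"
  by (rule adj_unique) (simp add: cinner_adj_left)

lemma adj_comp: "S \<in> bounded_ops \<Longrightarrow> T \<in> bounded_ops \<Longrightarrow> adj (S \<circ> T) = adj T \<circ> adj S"
  by (rule adj_unique) (simp add: cinner_adj_right)

lemma adj_add:
  "S \<in> bounded_ops \<Longrightarrow> T \<in> bounded_ops \<Longrightarrow> adj (\<lambda>v. S v + T v) = (\<lambda>v. adj S v + adj T v)"
  by (rule adj_unique) (simp add: cinner_adj_right cinner_simps)

lemma adj_diff:
  "S \<in> bounded_ops \<Longrightarrow> T \<in> bounded_ops \<Longrightarrow> adj (\<lambda>v. S v - T v) = (\<lambda>v. adj S v - adj T v)"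
  by (rule adj_unique) (simp add: cinner_adj_right cinner_simps)

lemma adj_scaleC: "T \<in> bounded_ops \<Longrightarrow> adj (\<lambda>v. c *\<^sub>C T v) = (\<lambda>v. cnj c *\<^sub>C adj T v)"
  by (rule adj_unique) (simp add: cinner_adj_right cinner_simps)

lemma adj_id [simp]: "adj id = id" "adj (\<lambda>v. v) = (\<lambda>v. v)"
  by (auto intro: adj_unique)

text \<open>The bound for \<open>B\<close> gives injectivity and, through Cauchy sequences, a closed
  range; the bound for \<open>adj B\<close> shows that only \<open>0\<close> is orthogonal to the
  range.\<close>

lemma invertible_of_bounded_below:
  fixes B :: "'a :: chilbert_space \<Rightarrow> 'a"
  assumes B: "B \<in> bounded_ops"
    and below: "\<And>v. norm v \<le> C * norm (B v)" "\<And>v. norm v \<le> C * norm (adj B v)"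
  obtains R where "R \<in> bounded_ops" "R \<circ> B = id" "B \<circ> R = id" "\<And>v. norm (R v) \<le> C * norm v"
proof -
  have inj: "x = y" if "B x = B y" for x y
    using below(1)[of "x - y"] that by (simp add: bounded_opsD[OF B])
  have sub: "csubspace (range B)"
    unfolding csubspace_def
  proof (safe)
    show "0 \<in> range B"
      using rangeI[of B 0] by (simp only: bounded_opsD(5)[OF B])
    show "B x + B y \<in> range B" for x y
      using rangeI[of B "x + y"] by (simp only: bounded_opsD(2)[OF B])
    show "c *\<^sub>C B x \<in> range B" for c x
      using rangeI[of B "c *\<^sub>C x"] by (simp only: bounded_opsD(3)[OF B])
  qed
  have "closed (range B)"
  proof (unfold closed_sequential_limits, intro allI impI, elim conjE)
    fix f l assume f: "\<forall>n. f n \<in> range B" and l: "f \<longlonglongrightarrow> l"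
    obtain g where g: "\<And>n. f n = B (g n)"
      using f unfolding image_iff by metis
    have C: "norm v \<le> \<bar>C\<bar> * norm (B v)" for v
      using below(1)[of v] by (smt (verit) mult_right_mono norm_ge_zero)
    have "Cauchy g"
    proof (rule metric_CauchyI)
      fix e :: real assume e: "0 < e"
      then have "0 < e / (\<bar>C\<bar> + 1)"
        by simp
      then obtain M where M: "\<And>m n. m \<ge> M \<Longrightarrow> n \<ge> M \<Longrightarrow> dist (f m) (f n) < e / (\<bar>C\<bar> + 1)"
        using metric_CauchyD[OF LIMSEQ_imp_Cauchy[OF l]] by blast
      have "dist (g m) (g n) < e" if "m \<ge> M" "n \<ge> M" for m n
      proof -
        have "dist (g m) (g n) \<le> \<bar>C\<bar> * dist (f m) (f n)"
          using C[of "g m - g n"] by (simp add: dist_norm g bounded_opsD[OF B])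
        also have "\<dots> \<le> (\<bar>C\<bar> + 1) * dist (f m) (f n)"
          by (simp add: mult_right_mono)
        also have "\<dots> < e"
          using M[OF that] by (simp add: field_simps)
        finally show ?thesis .
      qed
      then show "\<exists>M. \<forall>m\<ge>M. \<forall>n\<ge>M. dist (g m) (g n) < e"
        by blast
    qed
    then obtain h where "g \<longlonglongrightarrow> h"
      using Cauchy_convergent convergent_def by blast
    then have "f \<longlonglongrightarrow> B h"
      unfolding g by (rule bounded_linear.tendsto[OF bounded_opsD(1)[OF B]])
    then show "l \<in> range B"
      using l LIMSEQ_unique by blast
  qed
  have surj: "\<exists>x. B x = y" for y
  proof -
    obtain p where p: "p \<in> range B" "\<And>v. v \<in> range B \<Longrightarrow> cinner v (y - p) = 0"
      using nearest_point_complex[OF sub \<open>closed (range B)\<close>] by blast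
    have "adj B (y - p) = 0"
      by (rule cinner_ext) (simp add: cinner_adj_right[OF B] p(2))
    then have "y - p = 0"
      using below(2)[of "y - p"] by simp
    then show ?thesis
      using p(1) by auto
  qed
  define R where "R = inv B"
  have BR: "B (R x) = x" for x
    unfolding R_def using surj by (metis f_inv_into_f rangeI)
  have RB: "R (B x) = x" for x
    using inj BR by blast
  have "R \<in> bounded_ops"
    by (rule bounded_opsI[where K = C])
      (metis BR RB bounded_opsD(2)[OF B], metis BR RB bounded_opsD(3)[OF B], metis BR below(1))
  then show ?thesis
    using that BR RB below(1) by (metis (no_types, lifting) comp_apply ext id_apply)
qed

text \<open>The last clause is the point: if \<open>A\<close> and \<open>adj A\<close> leave
  \<open>V\<close> invariant, then \<open>A (p x)\<close> satisfies the characterisation of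
  \<open>p (A x)\<close>. This puts projections into a commutant, for the density theorem, and into
  a von Neumann algebra, for the largest annihilator.\<close>

lemma orthogonal_projection:
  fixes V :: "'a :: chilbert_space set"
  assumes V: "csubspace V" "closed V"
  obtains p where "p \<in> bounded_ops" "adj p = p" "\<And>x. p x \<in> V" "\<And>x. x \<in> V \<Longrightarrow> p x = x"
    "\<And>A x. A \<in> bounded_ops \<Longrightarrow> A ` V \<subseteq> V \<Longrightarrow> adj A ` V \<subseteq> V \<Longrightarrow> p (A x) = A (p x)"
proof -
  have "\<exists>p. p \<in> V \<and> (\<forall>v\<in>V. cinner v (x - p) = 0)" for x
    using nearest_point_complex[OF V] by metis
  then obtain p where p: "\<And>x. p x \<in> V" "\<And>x v. v \<in> V \<Longrightarrow> cinner v (x - p x) = 0"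
    by metis
  have uniq: "p x = y" if "y \<in> V" "\<And>v. v \<in> V \<Longrightarrow> cinner v (x - y) = 0" for x y
  proof -
    have "p x - y \<in> V"
      by (rule csubspaceD(4)[OF V(1) p(1) that(1)])
    then have "cinner (p x - y) (x - y) = 0" "cinner (p x - y) (x - p x) = 0"
      by (auto intro: p that)
    then have "cinner (p x - y) (p x - y) = 0"
      by (simp add: cinner_simps)
    then show ?thesis
      by (simp add: cinner_self)
  qed
  have sym: "cinner (p x) y = cinner x (p y)" for x y
  proof -
    have 1: "cinner (p x) (y - p y) = 0"
      using p by blast
    have "cinner (p y) (x - p x) = 0"
      using p by blast
    then have 2: "cinner (x - p x) (p y) = 0"
      by (metis cinner_commute complex_cnj_zero)
    show ?thesis
      using 1 2 by (simp add: cinner_simps)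
  qed
  have id_on: "p x = x" if "x \<in> V" for x
    by (rule uniq) (use that in auto)
  have "p \<in> bounded_ops"
  proof (rule bounded_opsI[where K = 1])
    show "p (x + y) = p x + p y" for x y
      by (rule uniq) (simp_all add: p csubspaceD[OF V(1)] add_diff_add cinner_add_right)
    show "p (c *\<^sub>C x) = c *\<^sub>C p x" for c x
      by (rule uniq)
        (simp_all add: p csubspaceD[OF V(1)] cinner_scaleC_right flip: scaleC_diff_right)
    show "norm (p x) \<le> 1 * norm x" for x
    proof -
      have "(norm (p x))\<^sup>2 = Re (cinner (p x) x)"
        using sym[of "p x" x] id_on[of "p x"] p(1) by (simp add: Re_cinner_self)
      also have "\<dots> \<le> norm (p x) * norm x"
        by (rule Re_cinner_le)
      finally show ?thesis
        by (cases "p x = 0") (auto simp: power2_eq_square mult_le_cancel_left)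
    qed
  qed
  moreover have "adj p = p"
    using sym by (rule adj_unique)
  moreover have "p (A x) = A (p x)"
    if A: "A \<in> bounded_ops" "A ` V \<subseteq> V" "adj A ` V \<subseteq> V" for A x
  proof (rule uniq)
    show "A (p x) \<in> V"
      using A(2) p(1) by auto
    show "cinner v (A x - A (p x)) = 0" if "v \<in> V" for v
    proof -
      have "cinner (adj A v) (x - p x) = 0"
        using p(2) A(3) that by auto
      then show ?thesis
        by (simp add: cinner_adj_left[OF A(1)] bounded_opsD[OF A(1)])
    qed
  qed
  ultimately show ?thesis
    using that p(1) id_on by blast
qed

subsection \<open>Commutants, matrix entries and the density theorem\<close>

lemma commutant_antimono: "A \<subseteq> B \<Longrightarrow> commutant B \<subseteq> commutant A"
  unfolding commutant_def by blast

lemma commutant_bounded: "commutant A \<subseteq> bounded_ops"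
  unfolding commutant_def by blast

lemma bicommutant_superset: "A \<subseteq> bounded_ops \<Longrightarrow> A \<subseteq> commutant (commutant A)"
  unfolding commutant_def by auto

lemma triple_commutant:
  assumes "A \<subseteq> bounded_ops"
  shows "commutant (commutant (commutant A)) = commutant A"
  using commutant_antimono[OF bicommutant_superset[OF assms]]
    bicommutant_superset[OF commutant_bounded[of A]] by blast

lemma commutantI:
  "T \<in> bounded_ops \<Longrightarrow> (\<And>S x. S \<in> A \<Longrightarrow> T (S x) = S (T x)) \<Longrightarrow> T \<in> commutant A"
  unfolding commutant_def by (auto simp: fun_eq_iff)

lemma commutantD:
  assumes "T \<in> commutant A"
  shows "T \<in> bounded_ops" "S \<in> A \<Longrightarrow> T (S x) = S (T x)"
  using assms unfolding commutant_def by (auto simp: fun_eq_iff)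

lemma commutant_adj:
  assumes A: "A \<subseteq> bounded_ops" "\<And>S. S \<in> A \<Longrightarrow> adj S \<in> A" and T: "T \<in> commutant A"
  shows "adj T \<in> commutant A"
proof (rule commutantI)
  have Tb: "T \<in> bounded_ops"
    using T commutantD by blast
  show "adj T \<in> bounded_ops"
    using Tb by (rule adj_bounded_ops)
  show "adj T (S x) = S (adj T x)" if S: "S \<in> A" for S x
  proof (rule cinner_ext)
    have Sb: "S \<in> bounded_ops"
      using A(1) S by blast
    show "cinner w (adj T (S x)) = cinner w (S (adj T x))" for w
      using commutantD(2)[OF T A(2)[OF S], of w]
      by (metis Sb Tb cinner_adj_left cinner_adj_right)
  qed
qed

text \<open>No closedness is asked for, so that the density theorem covers both the finite sums of
  the algebraic crossed product and an algebra whose closedness is still to be proved.\<close>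

definition unital_star_algebra :: "('h :: chilbert_space \<Rightarrow> 'h) set \<Rightarrow> bool" where
  "unital_star_algebra A \<longleftrightarrow> A \<subseteq> bounded_ops \<and> id \<in> A \<and>
    (\<forall>S\<in>A. \<forall>T\<in>A. (\<lambda>v. S v + T v) \<in> A) \<and> (\<forall>c. \<forall>T\<in>A. (\<lambda>v. c *\<^sub>C T v) \<in> A) \<and>
    (\<forall>S\<in>A. \<forall>T\<in>A. S \<circ> T \<in> A) \<and> (\<forall>T\<in>A. adj T \<in> A)"

lemma unital_star_algebraD:
  assumes "unital_star_algebra A"
  shows "T \<in> A \<Longrightarrow> T \<in> bounded_ops" "id \<in> A"
    "S \<in> A \<Longrightarrow> T \<in> A \<Longrightarrow> (\<lambda>v. S v + T v) \<in> A" "T \<in> A \<Longrightarrow> (\<lambda>v. c *\<^sub>C T v) \<in> A"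
    "S \<in> A \<Longrightarrow> T \<in> A \<Longrightarrow> S \<circ> T \<in> A" "T \<in> A \<Longrightarrow> adj T \<in> A"
    "S \<in> A \<Longrightarrow> T \<in> A \<Longrightarrow> (\<lambda>v. S v - T v) \<in> A"
proof -
  show add: "S \<in> A \<Longrightarrow> T \<in> A \<Longrightarrow> (\<lambda>v. S v + T v) \<in> A" for S T
    using assms unfolding unital_star_algebra_def by blast
  show scale: "T \<in> A \<Longrightarrow> (\<lambda>v. c *\<^sub>C T v) \<in> A" for T c
    using assms unfolding unital_star_algebra_def by blast
  show "S \<in> A \<Longrightarrow> T \<in> A \<Longrightarrow> (\<lambda>v. S v - T v) \<in> A"
    using add[of S "\<lambda>v. (- 1) *\<^sub>C T v"] scale[of T "- 1"] by (simp add: scaleC_minus_left)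
qed (use assms in \<open>auto simp: unital_star_algebra_def\<close>)

text \<open>Reduces claims about a bicommutant to selfadjoint operators, for which the resolvent at
  \<open>-i\<close> is available.\<close>

lemma cartesian_decomposition:
  assumes A: "unital_star_algebra A" and T: "T \<in> A"
  obtains B C where "B \<in> A" "adj B = B" "C \<in> A" "adj C = C" "T = (\<lambda>v. B v + \<i> *\<^sub>C C v)"
proof -
  note D = unital_star_algebraD[OF A]
  define B where "B = (\<lambda>v. (1/2) *\<^sub>C (T v + adj T v))"
  define C where "C = (\<lambda>v. (- \<i> / 2) *\<^sub>C (T v - adj T v))"
  note T' = D(6)[OF T] D(1)[OF T] D(1)[OF D(6)[OF T]]
  have add: "(\<lambda>v. T v + adj T v) \<in> A" and diff: "(\<lambda>v. T v - adj T v) \<in> A"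
    by (rule D(3)[OF T T'(1)], rule D(7)[OF T T'(1)])
  show ?thesis
  proof (rule that)
    show "B \<in> A" "C \<in> A"
      unfolding B_def C_def by (rule D(4), rule add diff)+
    show "adj B = B"
      unfolding B_def adj_scaleC[OF D(1)[OF add]] adj_add[OF T'(2,3)] adj_adj[OF T'(2)]
      by (simp add: add.commute)
    show "adj C = C"
      unfolding C_def adj_scaleC[OF D(1)[OF diff]] adj_diff[OF T'(2,3)] adj_adj[OF T'(2)]
      by (simp add: scaleC_diff_right scaleC_minus_left)
    show "T = (\<lambda>v. B v + \<i> *\<^sub>C C v)"
    proof
      fix v
      have "B v + \<i> *\<^sub>C C v = (1/2) *\<^sub>C (T v + adj T v) + (1/2) *\<^sub>C (T v - adj T v)"
        by (simp add: B_def C_def scaleC_scaleC)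
      also have "\<dots> = (1/2 + 1/2) *\<^sub>C T v"
        unfolding scaleC_add_left scaleC_add_right scaleC_diff_right by simp
      finally show "T v = B v + \<i> *\<^sub>C C v"
        by simp
    qed
  qed
qed

lemma commutant_unital_star_algebra:
  assumes A: "A \<subseteq> bounded_ops" "\<And>S. S \<in> A \<Longrightarrow> adj S \<in> A"
  shows "unital_star_algebra (commutant A)"
  unfolding unital_star_algebra_def
proof (intro conjI ballI allI)
  have lin: "S (x + y) = S x + S y" "S (c *\<^sub>C x) = c *\<^sub>C S x" if "S \<in> A" for S x y c
    using that A(1) bounded_opsD(2,3) by blast+
  show "id \<in> commutant A"
    by (rule commutantI) auto
  show "(\<lambda>v. S v + T v) \<in> commutant A" if "S \<in> commutant A" "T \<in> commutant A" for S T
    using that by (intro commutantI) (auto simp: lin commutantD intro: bounded_ops_add)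
  show "(\<lambda>v. c *\<^sub>C T v) \<in> commutant A" if "T \<in> commutant A" for T c
    using that by (intro commutantI) (auto simp: lin commutantD intro: bounded_ops_scaleC)
  show "S \<circ> T \<in> commutant A" if "S \<in> commutant A" "T \<in> commutant A" for S T
    using that by (intro commutantI) (auto simp: commutantD intro: bounded_ops_comp)
qed (use commutant_bounded commutant_adj[OF A] in blast)+

lemma bicommutant_von_neumann_algebra:
  assumes A: "A \<subseteq> bounded_ops" "\<And>S. S \<in> A \<Longrightarrow> adj S \<in> A"
  shows "von_neumann_algebra (commutant (commutant A))"
  unfolding von_neumann_algebra_def
  using triple_commutant[OF commutant_bounded] commutant_bounded
    commutant_adj[OF commutant_bounded commutant_adj[OF A]] by blast

lemma von_neumann_algebraD:
  assumes "von_neumann_algebra A"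
  shows "A \<subseteq> bounded_ops" "T \<in> A \<Longrightarrow> adj T \<in> A" "commutant (commutant A) = A"
  using assms unfolding von_neumann_algebra_def by blast+

lemma von_neumann_algebra_unital_star_algebra:
  assumes "von_neumann_algebra A"
  shows "unital_star_algebra A"
  using commutant_unital_star_algebra[OF commutant_bounded, of A]
    commutant_adj[OF von_neumann_algebraD(1)[OF assms] von_neumann_algebraD(2)[OF assms]]
  by (simp add: von_neumann_algebraD(3)[OF assms])

lemmas von_neumann_algebra_closed = unital_star_algebraD[OF von_neumann_algebra_unital_star_algebra]

lemma von_neumann_algebra_memI:
  assumes "von_neumann_algebra A" "T \<in> bounded_ops"
    "\<And>S x. S \<in> commutant A \<Longrightarrow> T (S x) = S (T x)"
  shows "T \<in> A"
  using commutantI[of T "commutant A"] assms von_neumann_algebraD(3) by blast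

lemma von_neumann_algebra_inverse:
  assumes A: "von_neumann_algebra A" "T \<in> A" and R: "R \<in> bounded_ops" "R \<circ> T = id" "T \<circ> R = id"
  shows "R \<in> A"
proof (rule von_neumann_algebra_memI[OF A(1) R(1)])
  fix S x assume S: "S \<in> commutant A"
  have "R (T y) = y" "T (R y) = y" for y
    using R(2,3) by (auto simp: fun_eq_iff)
  then show "R (S x) = S (R x)"
    using commutantD(2)[OF S A(2), of "R x"] by metis
qed

section \<open>Square-summable functions, matrix entries and diagonal operators\<close>

lemmas ell2_rep_simps [simp] = plus_ell2.rep_eq minus_ell2.rep_eq uminus_ell2.rep_eq zero_ell2.rep_eq
  scaleC_ell2.rep_eq scaleR_ell2.rep_eq

lemma ell2_eqI: "(\<And>g. Rep_ell2 a g = Rep_ell2 b g) \<Longrightarrow> a = b"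
  by (metis Rep_ell2_inject ext)

lemma Rep_single: "Rep_ell2 (single_ell2 g v) k = (if k = g then v else 0)"
  by (simp add: single_ell2.rep_eq)

lemma single_add: "single_ell2 g (v + w) = single_ell2 g v + single_ell2 g w"
  by (rule ell2_eqI) (simp add: Rep_single)

lemma single_scaleC: "single_ell2 g (c *\<^sub>C v) = c *\<^sub>C single_ell2 g (v :: 'h :: chilbert_space)"
  by (rule ell2_eqI) (simp add: Rep_single)

lemma single_zero [simp]: "single_ell2 g 0 = 0"
  by (rule ell2_eqI) (simp add: Rep_single)

lemma cinner_single_right:
  "cinner \<xi> (single_ell2 g v) = cinner (Rep_ell2 \<xi> g) (v :: 'h :: chilbert_space)"
proof -
  have "cinner \<xi> (single_ell2 g v) = (\<Sum>\<^sub>\<infinity>k. cinner (Rep_ell2 \<xi> k) (if k = g then v else 0))"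
    unfolding cinner_ell2_def by (simp add: Rep_single)
  also have "\<dots> = (\<Sum>\<^sub>\<infinity>k\<in>{g}. cinner (Rep_ell2 \<xi> k) (if k = g then v else 0))"
    by (rule infsum_cong_neutral) auto
  finally show ?thesis
    by simp
qed

lemma cinner_single_left:
  "cinner (single_ell2 g v) \<xi> = cinner (v :: 'h :: chilbert_space) (Rep_ell2 \<xi> g)"
  using cinner_single_right[of \<xi> g v] cinner_commute by metis

lemma norm_single: "norm (single_ell2 g (v :: 'h :: chilbert_space)) = norm v"
proof -
  have "(norm (single_ell2 g v))\<^sup>2 = (norm v)\<^sup>2"
    unfolding Re_cinner_self[symmetric] by (simp add: cinner_single_left Rep_single)
  then show ?thesis
    by simp
qed

definition entry :: "(('g, 'h :: chilbert_space) ell2 \<Rightarrow> ('g, 'h) ell2) \<Rightarrow> 'g \<Rightarrow> 'g \<Rightarrow> 'h \<Rightarrow> 'h" where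
  "entry S g h v = Rep_ell2 (S (single_ell2 h v)) g"

lemma entry_bounded_ops:
  assumes S: "S \<in> bounded_ops"
  shows "entry S g h \<in> bounded_ops"
proof -
  obtain K where K: "\<And>x. norm (S x) \<le> K * norm x"
    using bounded_ops_bound[OF S] by blast
  show ?thesis
  proof (rule bounded_opsI[where K = K])
    show "norm (entry S g h x) \<le> K * norm x" for x
      using norm_component_le_norm_ell2[of "S (single_ell2 h x)" g] K[of "single_ell2 h x"]
      by (simp add: entry_def norm_single)
  qed (simp_all add: entry_def single_add single_scaleC bounded_opsD[OF S])
qed

text \<open>Tested against a fixed \<open>u\<close>, the row expansion is the inner product of
  \<open>\<xi>\<close> with \<open>adj S (single_ell2 g u)\<close>. The weak form avoids any
  question of convergence of operator series.\<close>

lemma cinner_component: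
  assumes S: "S \<in> bounded_ops"
  shows "cinner (Rep_ell2 (S \<xi>) g) u = (\<Sum>\<^sub>\<infinity>k. cinner (entry S g k (Rep_ell2 \<xi> k)) u)"
proof -
  have "cinner (Rep_ell2 (S \<xi>) g) u = cinner \<xi> (adj S (single_ell2 g u))"
    by (simp add: cinner_adj_right[OF S] cinner_single_right)
  also have "\<dots> = (\<Sum>\<^sub>\<infinity>k. cinner (Rep_ell2 \<xi> k) (Rep_ell2 (adj S (single_ell2 g u)) k))"
    by (rule cinner_ell2_def)
  also have "\<dots> = (\<Sum>\<^sub>\<infinity>k. cinner (entry S g k (Rep_ell2 \<xi> k)) u)"
    unfolding cinner_single_left[symmetric] cinner_adj_right[OF S] cinner_single_right entry_def ..
  finally show ?thesis .
qed

lemma bounded_ops_entry_eqI: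
  assumes S: "S \<in> bounded_ops" and T: "T \<in> bounded_ops" and eq: "\<And>g h v. entry S g h v = entry T g h v"
  shows "S = T"
proof (rule ext, rule ell2_eqI)
  fix \<xi> g
  have "cinner (Rep_ell2 (S \<xi>) g) u = cinner (Rep_ell2 (T \<xi>) g) u" for u
    unfolding cinner_component[OF S] cinner_component[OF T] eq ..
  then have "cinner u (Rep_ell2 (S \<xi>) g) = cinner u (Rep_ell2 (T \<xi>) g)" for u
    using cinner_commute by metis
  then show "Rep_ell2 (S \<xi>) g = Rep_ell2 (T \<xi>) g"
    by (rule cinner_ext)
qed

lemma entry_adj:
  assumes S: "S \<in> bounded_ops"
  shows "entry (adj S) g h = adj (entry S h g)"
  by (rule sym, rule adj_unique)
    (simp add: entry_def cinner_adj_left[OF S] flip: cinner_single_right cinner_single_left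
      cinner_adj_right[OF S])

text \<open>Common form of \<open>alg_embed\<close>, with \<open>F g = \<sigma> (- g) T\<close>, and
  of the amplifications, with constant \<open>F\<close>. The value under \<open>Abs_ell2\<close> is
  meaningful under \<open>uniformly_bounded\<close>.\<close>

definition diag_op :: "('g \<Rightarrow> 'h \<Rightarrow> 'h) \<Rightarrow> ('g, 'h :: chilbert_space) ell2 \<Rightarrow> ('g, 'h) ell2" where
  "diag_op F \<xi> = Abs_ell2 (\<lambda>g. F g (Rep_ell2 \<xi> g))"

locale uniformly_bounded =
  fixes F :: "'g \<Rightarrow> 'h :: chilbert_space \<Rightarrow> 'h" and K :: real
  assumes F_bounded: "F g \<in> bounded_ops" and F_le: "norm (F g v) \<le> K * norm v"
begin

lemma L2_set_F: "L2_set (\<lambda>g. norm (F g (Rep_ell2 \<xi> g))) I \<le> \<bar>K\<bar> * L2_set (\<lambda>g. norm (Rep_ell2 \<xi> g)) I"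
proof -
  have "norm (F g v) \<le> \<bar>K\<bar> * norm v" for g v
    using F_le[of g v] by (smt (verit) mult_right_mono norm_ge_zero)
  then show ?thesis
    by (subst L2_set_right_distrib) (auto intro: L2_set_mono)
qed

lemma Rep_diag_op: "Rep_ell2 (diag_op F \<xi>) g = F g (Rep_ell2 \<xi> g)"
proof -
  have "(\<lambda>g. (norm (F g (Rep_ell2 \<xi> g)))\<^sup>2) summable_on UNIV"
    unfolding square_summable_iff
    using order_trans[OF L2_set_F mult_left_mono[OF L2_set_le_norm_ell2]] by (meson abs_ge_zero)
  then show ?thesis
    by (simp add: diag_op_def Abs_ell2_inverse)
qed

lemma diag_op_bounded_ops: "diag_op F \<in> bounded_ops"
proof (rule bounded_opsI[where K = "\<bar>K\<bar>"])
  show "norm (diag_op F \<xi>) \<le> \<bar>K\<bar> * norm \<xi>" for \<xi>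
    by (rule norm_ell2_leI)
      (auto simp: Rep_diag_op intro: order_trans[OF L2_set_F mult_left_mono[OF L2_set_le_norm_ell2]])
qed (auto intro!: ell2_eqI simp: Rep_diag_op bounded_opsD[OF F_bounded])

lemma diag_op_single: "diag_op F (single_ell2 h v) = single_ell2 h (F h v)"
  by (rule ell2_eqI) (simp add: Rep_diag_op Rep_single bounded_opsD[OF F_bounded])

lemma entry_diag_op: "entry (diag_op F) g h v = (if g = h then F g v else 0)"
  by (simp add: entry_def diag_op_single Rep_single)

lemma adj_diag_op:
  assumes "uniformly_bounded (\<lambda>g. adj (F g)) K'"
  shows "adj (diag_op F) = diag_op (\<lambda>g. adj (F g))"
proof -
  interpret adj: uniformly_bounded "\<lambda>g. adj (F g)" K'
    by fact
  show ?thesis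
    by (rule adj_unique)
      (simp add: cinner_ell2_def Rep_diag_op adj.Rep_diag_op cinner_adj_right[OF F_bounded])
qed

lemma diag_op_commute_iff:
  assumes S: "S \<in> bounded_ops"
  shows "diag_op F \<circ> S = S \<circ> diag_op F \<longleftrightarrow> (\<forall>g h v. F g (entry S g h v) = entry S g h (F h v))"
proof -
  have 1: "entry (diag_op F \<circ> S) g h v = F g (entry S g h v)" for g h v
    by (simp add: entry_def Rep_diag_op)
  have 2: "entry (S \<circ> diag_op F) g h v = entry S g h (F h v)" for g h v
    by (simp add: entry_def diag_op_single)
  have "diag_op F \<circ> S \<in> bounded_ops" "S \<circ> diag_op F \<in> bounded_ops"
    using S diag_op_bounded_ops bounded_ops_comp by blast+
  then have "diag_op F \<circ> S = S \<circ> diag_op F" if "\<forall>g h v. F g (entry S g h v) = entry S g h (F h v)"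
    using that by (intro bounded_ops_entry_eqI) (simp_all only: 1 2)
  then show ?thesis
    by (metis 1 2)
qed

end

section \<open>Amplifications\<close>

abbreviation amplification :: "('h :: chilbert_space \<Rightarrow> 'h) \<Rightarrow> ('i, 'h) ell2 \<Rightarrow> ('i, 'h) ell2" where
  "amplification T \<equiv> diag_op (\<lambda>_. T)"

lemma uniformly_bounded_const:
  assumes "T \<in> bounded_ops"
  obtains K where "uniformly_bounded (\<lambda>_ :: 'i. T) K"
proof -
  obtain K where "\<And>x. norm (T x) \<le> K * norm x"
    using bounded_ops_bound[OF assms] by blast
  then have "uniformly_bounded (\<lambda>_ :: 'i. T) K"
    using assms by unfold_locales
  then show ?thesis
    using that by blast
qed

lemma
  fixes T :: "'h :: chilbert_space \<Rightarrow> 'h" and \<xi> :: "('i, 'h) ell2"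
  assumes T: "T \<in> bounded_ops"
  shows Rep_amplification: "Rep_ell2 (amplification T \<xi>) i = T (Rep_ell2 \<xi> i)"
    and amplification_bounded_ops: "(amplification T :: ('i, 'h) ell2 \<Rightarrow> _) \<in> bounded_ops"
    and amplification_single:
      "amplification T (single_ell2 i v :: ('i, 'h) ell2) = single_ell2 i (T v)"
    and adj_amplification: "adj (amplification T :: ('i, 'h) ell2 \<Rightarrow> _) = amplification (adj T)"
    and amplification_commute_iff: "(S :: ('i, 'h) ell2 \<Rightarrow> _) \<in> bounded_ops \<Longrightarrow>
      amplification T \<circ> S = S \<circ> amplification T \<longleftrightarrow> (\<forall>g h v. T (entry S g h v) = entry S g h (T v))"
proof -
  obtain K where K: "uniformly_bounded (\<lambda>_ :: 'i. T) K"
    using uniformly_bounded_const[OF T] by blast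
  interpret uniformly_bounded "\<lambda>_ :: 'i. T" K
    by fact
  obtain K' where K': "uniformly_bounded (\<lambda>_ :: 'i. adj T) K'"
    using uniformly_bounded_const[OF adj_bounded_ops[OF T]] by blast
  show "Rep_ell2 (amplification T \<xi>) i = T (Rep_ell2 \<xi> i)"
    "(amplification T :: ('i, 'h) ell2 \<Rightarrow> _) \<in> bounded_ops"
    "amplification T (single_ell2 i v :: ('i, 'h) ell2) = single_ell2 i (T v)"
    "adj (amplification T :: ('i, 'h) ell2 \<Rightarrow> _) = amplification (adj T)"
    by (rule Rep_diag_op diag_op_bounded_ops diag_op_single adj_diag_op[OF K'])+
  show "amplification T \<circ> S = S \<circ> amplification T \<longleftrightarrow> (\<forall>g h v. T (entry S g h v) = entry S g h (T v))"
    if "S \<in> bounded_ops" for S :: "('i, 'h) ell2 \<Rightarrow> _"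
    using diag_op_commute_iff[OF that] .
qed

text \<open>An operator that commutes with all amplifications of \<open>A\<close> has its matrix
  entries in \<open>commutant A\<close>; \<open>T\<close> commutes with these entries, so its
  amplification commutes with the operator.\<close>

lemma amplification_bicommutant:
  assumes A: "A \<subseteq> bounded_ops" and T: "T \<in> commutant (commutant A)"
  shows "amplification T \<in> commutant (commutant (amplification ` A))"
proof (rule commutantI)
  have Tb: "T \<in> bounded_ops"
    using T commutantD by blast
  then show "amplification T \<in> bounded_ops"
    by (rule amplification_bounded_ops)
  fix S x assume S: "S \<in> commutant (amplification ` A)"
  have Sb: "S \<in> bounded_ops"
    using S commutantD by blast
  have "entry S g h \<in> commutant A" for g h
  proof (rule commutantI)
    show "entry S g h \<in> bounded_ops"
      using Sb by (rule entry_bounded_ops)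
    fix R x assume R: "R \<in> A"
    have "amplification R \<circ> S = S \<circ> amplification R"
      using S R unfolding commutant_def by (metis (mono_tags, lifting) image_eqI mem_Collect_eq)
    then show "entry S g h (R x) = R (entry S g h x)"
      using amplification_commute_iff[of R S] R A Sb by auto
  qed
  then have "T (entry S g h v) = entry S g h (T v)" for g h v
    using commutantD(2)[OF T] by blast
  then have "amplification T \<circ> S = S \<circ> amplification T"
    using amplification_commute_iff[OF Tb Sb] by blast
  then show "amplification T (S x) = S (amplification T x)"
    by (metis comp_apply)
qed

lemma amplification_unital_star_algebra:
  assumes A: "unital_star_algebra A"
  shows "unital_star_algebra (amplification ` A :: (('i, 'h :: chilbert_space) ell2 \<Rightarrow> _) set)"
  unfolding unital_star_algebra_def
proof (safe; (elim imageE)?)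
  note D = unital_star_algebraD[OF A]
  show "amplification S \<in> bounded_ops" if "S \<in> A" for S
    using that D(1) by (intro amplification_bounded_ops) auto
  have "amplification id = (id :: ('i, 'h) ell2 \<Rightarrow> _)"
    by (rule ext, rule ell2_eqI) (simp add: Rep_amplification)
  then show "(id :: ('i, 'h) ell2 \<Rightarrow> _) \<in> amplification ` A"
    using D(2) by (metis imageI)
  show "(\<lambda>v. amplification S v + amplification T v) \<in> amplification ` A" if "S \<in> A" "T \<in> A" for S T
  proof (rule image_eqI)
    show "(\<lambda>v. amplification S v + amplification T v) = amplification (\<lambda>v. S v + T v)"
      using D(1) that D(3)[OF that] by (auto intro!: ext ell2_eqI simp: Rep_amplification)
  qed (rule D(3)[OF that])
  show "(\<lambda>v. c *\<^sub>C amplification T v) \<in> amplification ` A" if "T \<in> A" for c T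
  proof (rule image_eqI)
    show "(\<lambda>v. c *\<^sub>C amplification T v) = amplification (\<lambda>v. c *\<^sub>C T v)"
      using D(1) that D(4)[OF that] by (auto intro!: ext ell2_eqI simp: Rep_amplification)
  qed (rule D(4)[OF that])
  show "amplification S \<circ> amplification T \<in> amplification ` A" if "S \<in> A" "T \<in> A" for S T
  proof (rule image_eqI)
    show "amplification S \<circ> amplification T = amplification (S \<circ> T)"
      using D(1) that D(5)[OF that] by (auto intro!: ext ell2_eqI simp: Rep_amplification)
  qed (rule D(5)[OF that])
  show "adj (amplification T) \<in> amplification ` A" if "T \<in> A" for T
    using that D(1,6) by (simp add: adj_amplification)
qed

section \<open>Strong approximation of elements of the bicommutant\<close>

lemma csubspace_closure:
  assumes "csubspace V"
  shows "csubspace (closure V)"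
  unfolding csubspace_def
proof (intro conjI ballI allI)
  show "0 \<in> closure V"
    using csubspaceD(1)[OF assms] closure_subset by blast
  show "x + y \<in> closure V" if xy: "x \<in> closure V" "y \<in> closure V" for x y
  proof -
    obtain a b where "\<And>n. a n \<in> V" "a \<longlonglongrightarrow> x" "\<And>n. b n \<in> V" "b \<longlonglongrightarrow> y"
      using xy unfolding closure_sequential by blast
    then have "(\<lambda>n. a n + b n) \<longlonglongrightarrow> x + y" "a n + b n \<in> V" for n
      using csubspaceD(2)[OF assms] tendsto_add by blast+
    then show ?thesis
      unfolding closure_sequential by metis
  qed
  show "c *\<^sub>C x \<in> closure V" if x: "x \<in> closure V" for c x
  proof -
    obtain a where a: "\<And>n. a n \<in> V" "a \<longlonglongrightarrow> x"
      using x unfolding closure_sequential by blast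
    have "(\<lambda>n. c *\<^sub>C a n) \<longlonglongrightarrow> c *\<^sub>C x"
      by (rule bounded_linear.tendsto[OF bounded_opsD(1)[OF bounded_ops_scaleC[OF bounded_ops_id(2)]] a(2)])
    then show ?thesis
      unfolding closure_sequential using csubspaceD(3)[OF assms a(1)] by metis
  qed
qed

lemma subspace_closure:
  fixes V :: "'a :: real_normed_vector set"
  assumes "subspace V"
  shows "subspace (closure V)"
  unfolding subspace_def
proof (intro conjI ballI allI)
  show "0 \<in> closure V"
    using subspace_0[OF assms] closure_subset by blast
  show "x + y \<in> closure V" if xy: "x \<in> closure V" "y \<in> closure V" for x y
  proof -
    obtain a b where "\<And>n. a n \<in> V" "a \<longlonglongrightarrow> x" "\<And>n. b n \<in> V" "b \<longlonglongrightarrow> y"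
      using xy unfolding closure_sequential by blast
    then have "(\<lambda>n. a n + b n) \<longlonglongrightarrow> x + y" "a n + b n \<in> V" for n
      using subspace_add[OF assms] tendsto_add by blast+
    then show ?thesis
      unfolding closure_sequential by metis
  qed
  show "r *\<^sub>R x \<in> closure V" if x: "x \<in> closure V" for r x
  proof -
    obtain a where a: "\<And>n. a n \<in> V" "a \<longlonglongrightarrow> x"
      using x unfolding closure_sequential by blast
    have "(\<lambda>n. r *\<^sub>R a n) \<longlonglongrightarrow> r *\<^sub>R x"
      by (intro tendsto_intros a)
    then show ?thesis
      unfolding closure_sequential using subspace_scale[OF assms a(1)] by metis
  qed
qed

text \<open>Von Neumann's argument: the projection \<open>p\<close> onto the closure of the orbit of
  \<open>\<xi>\<close> under \<open>A\<close> lies in the commutant, so \<open>T\<close> commutes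
  with it, and \<open>p\<close> fixes \<open>\<xi>\<close> because
  \<open>id \<in> A\<close>.\<close>

lemma bicommutant_in_closure:
  assumes A: "unital_star_algebra A" and T: "T \<in> commutant (commutant A)"
  shows "T \<xi> \<in> closure ((\<lambda>S. S \<xi>) ` A)"
proof -
  note D = unital_star_algebraD[OF A]
  define W where "W = (\<lambda>S. S \<xi>) ` A"
  have scal: "S \<in> A \<Longrightarrow> (\<lambda>v. c *\<^sub>C S v) \<in> A" and add: "S \<in> A \<Longrightarrow> R \<in> A \<Longrightarrow> (\<lambda>v. S v + R v) \<in> A"
    for S R c
    using D by blast+
  have "csubspace W"
    unfolding csubspace_def W_def
  proof (safe)
    show "0 \<in> (\<lambda>S. S \<xi>) ` A"
      using imageI[OF scal[OF D(2), of 0], of "\<lambda>S. S \<xi>"] by simp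
    show "S \<xi> + R \<xi> \<in> (\<lambda>S. S \<xi>) ` A" if "S \<in> A" "R \<in> A" for S R
      using imageI[OF add[OF that], of "\<lambda>S. S \<xi>"] by simp
    show "c *\<^sub>C S \<xi> \<in> (\<lambda>S. S \<xi>) ` A" if "S \<in> A" for S c
      using imageI[OF scal[OF that], of "\<lambda>S. S \<xi>" c] by simp
  qed
  then have V: "csubspace (closure W)" "closed (closure W)"
    by (simp_all add: csubspace_closure)
  have inv: "S ` closure W \<subseteq> closure W" if S: "S \<in> A" for S
  proof (rule image_closure_subset)
    show "continuous_on (closure W) S"
      using bounded_opsD(1)[OF D(1)[OF S]] by (rule linear_continuous_on)
    show "S ` W \<subseteq> closure W"
      using D(5)[OF S] closure_subset[of W] unfolding W_def by force
  qed simp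
  obtain p where p: "p \<in> bounded_ops" "\<And>x. p x \<in> closure W" "\<And>x. x \<in> closure W \<Longrightarrow> p x = x"
    "\<And>S x. S \<in> bounded_ops \<Longrightarrow> S ` closure W \<subseteq> closure W \<Longrightarrow> adj S ` closure W \<subseteq> closure W \<Longrightarrow>
      p (S x) = S (p x)"
    using orthogonal_projection[OF V] by metis
  have "p \<in> commutant A"
    by (rule commutantI) (use p inv D in auto)
  then have "T (p \<xi>) = p (T \<xi>)"
    by (rule commutantD(2)[OF T])
  moreover have "\<xi> \<in> closure W"
    using imageI[OF D(2), of "\<lambda>S. S \<xi>"] closure_subset[of W] unfolding W_def id_apply by blast
  ultimately show ?thesis
    using p(2,3) unfolding W_def by metis
qed

text \<open>The values \<open>S \<xi>\<close> with \<open>S\<close> selfadjoint form only a real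
  subspace, so the argument by an invariant projection breaks down. Instead the residue
  \<open>\<zeta>\<close> of \<open>T \<xi>\<close> defines a functional that vanishes on the
  selfadjoint part, hence on \<open>A\<close>, hence at \<open>T\<close>; evaluated at
  \<open>T\<close> it gives \<open>\<zeta> = 0\<close>.\<close>

lemma bicommutant_in_selfadjoint_closure:
  fixes A :: "('h :: chilbert_space \<Rightarrow> 'h) set"
  assumes A: "unital_star_algebra A" and T: "T \<in> commutant (commutant A)" "adj T = T"
  shows "T \<xi> \<in> closure ((\<lambda>S. S \<xi>) ` {S \<in> A. adj S = S})"
proof -
  note D = unital_star_algebraD[OF A]
  have Tb: "T \<in> bounded_ops"
    using T(1) commutantD by blast
  define W where "W = (\<lambda>S. S \<xi>) ` {S \<in> A. adj S = S}"
  have scal: "(\<lambda>v. c *\<^sub>C S v) \<in> A" "adj (\<lambda>v. c *\<^sub>C S v) = (\<lambda>v. cnj c *\<^sub>C adj S v)" if "S \<in> A" for S c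
    using that D by (auto simp: adj_scaleC)
  have "subspace W"
    unfolding subspace_def
  proof (intro conjI ballI allI)
    have z: "(\<lambda>v. 0 *\<^sub>C id v) \<in> {S \<in> A. adj S = S}"
      using scal[OF D(2), of 0] by simp
    show "0 \<in> W"
      unfolding W_def using imageI[OF z, of "\<lambda>S. S \<xi>"] by simp
    show "x + y \<in> W" if xy: "x \<in> W" "y \<in> W" for x y
    proof -
      obtain S R where *: "S \<in> A" "adj S = S" "x = S \<xi>" "R \<in> A" "adj R = R" "y = R \<xi>"
        using xy unfolding W_def by blast
      have "(\<lambda>v. S v + R v) \<in> {S \<in> A. adj S = S}"
        using * D by (simp add: adj_add)
      then show ?thesis
        unfolding W_def using * imageI[of "\<lambda>v. S v + R v" _ "\<lambda>S. S \<xi>"] by simp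
    qed
    show "r *\<^sub>R x \<in> W" if x: "x \<in> W" for r x
    proof -
      obtain S where *: "S \<in> A" "adj S = S" "x = S \<xi>"
        using x unfolding W_def by blast
      have "(\<lambda>v. complex_of_real r *\<^sub>C S v) \<in> {S \<in> A. adj S = S}"
        using * D by (simp add: adj_scaleC)
      then show ?thesis
        unfolding W_def using * imageI[of "\<lambda>v. complex_of_real r *\<^sub>C S v" _ "\<lambda>S. S \<xi>"]
        by (simp add: scaleR_scaleC)
    qed
  qed
  then have V: "subspace (closure W)" "closed (closure W)"
    by (simp_all add: subspace_closure)
  obtain p where p: "p \<in> closure W" "\<And>v. v \<in> closure W \<Longrightarrow> Re (cinner v (T \<xi> - p)) = 0"
    using nearest_point[OF V, of "T \<xi>"] by metis
  define \<zeta> where "\<zeta> = T \<xi> - p"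
  \<comment> \<open>On two copies of the space, indexed by \<open>bool\<close>, the sum of two inner
    products becomes a single one, \<open>cinner (amplification S \<Xi>) Z\<close>. This is
    continuous in the first argument, so the plain density theorem carries its vanishing from
    \<open>A\<close> to \<open>T\<close>.\<close>
  define \<Xi> where "\<Xi> = single_ell2 False \<xi> + single_ell2 True \<zeta>"
  define Z where "Z = single_ell2 False \<zeta> + single_ell2 True \<xi>"
  \<comment> \<open>The functional \<open>S \<mapsto> \<langle>S \<xi>, \<zeta>\<rangle> + \<langle>S \<zeta>, \<xi>\<rangle>\<close> is complex linear, and its values at
    selfadjoint operators are \<open>2 Re \<langle>S \<xi>, \<zeta>\<rangle>\<close>.\<close>
  have val: "cinner (amplification S \<Xi>) Z = cinner (S \<xi>) \<zeta> + cinner (S \<zeta>) \<xi>" if "S \<in> bounded_ops" for S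
    unfolding \<Xi>_def Z_def bounded_opsD(2)[OF amplification_bounded_ops[OF that]]
    by (simp add: amplification_single[OF that] cinner_simps cinner_single_left Rep_single)
  have sa: "cinner (S \<xi>) \<zeta> + cinner (S \<zeta>) \<xi> = of_real (2 * Re (cinner (S \<xi>) \<zeta>))"
    if "S \<in> bounded_ops" "adj S = S" for S
  proof -
    have "cinner (S \<zeta>) \<xi> = cnj (cinner (S \<xi>) \<zeta>)"
      using cinner_adj_left[OF that(1), of \<zeta> \<xi>] that(2) cinner_commute[of \<zeta> "S \<xi>"] by simp
    then show ?thesis
      by (simp add: complex_eq_iff)
  qed
  have sa0: "cinner (S \<xi>) \<zeta> + cinner (S \<zeta>) \<xi> = 0" if "S \<in> A" "adj S = S" for S
  proof -
    have "S \<xi> \<in> closure W"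
      using that closure_subset[of W] unfolding W_def by blast
    then have "Re (cinner (S \<xi>) \<zeta>) = 0"
      unfolding \<zeta>_def by (rule p(2))
    then show ?thesis
      using sa[OF D(1)[OF that(1)] that(2)] by simp
  qed
  have zero: "cinner (S \<xi>) \<zeta> + cinner (S \<zeta>) \<xi> = 0" if S: "S \<in> A" for S
  proof -
    obtain B C where BC: "B \<in> A" "adj B = B" "C \<in> A" "adj C = C" "S = (\<lambda>v. B v + \<i> *\<^sub>C C v)"
      using cartesian_decomposition[OF A S] by metis
    have "cinner (S \<xi>) \<zeta> + cinner (S \<zeta>) \<xi> =
        (cinner (B \<xi>) \<zeta> + cinner (B \<zeta>) \<xi>) + \<i> * (cinner (C \<xi>) \<zeta> + cinner (C \<zeta>) \<xi>)"
      unfolding BC(5) by (simp add: cinner_simps algebra_simps)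
    then show ?thesis
      unfolding sa0[OF BC(1,2)] sa0[OF BC(3,4)] by simp
  qed
  have "amplification T \<Xi> \<in> closure ((\<lambda>S. S \<Xi>) ` amplification ` A)"
    using D(1) by (intro bicommutant_in_closure amplification_unital_star_algebra A
        amplification_bicommutant T(1)) auto
  also have "\<dots> \<subseteq> {x. cinner x Z = 0}"
  proof (rule closure_minimal)
    show "closed {x. cinner x Z = 0}"
      by (intro closed_Collect_eq linear_continuous_on bounded_linear_cinner_left continuous_on_const)
    show "(\<lambda>S. S \<Xi>) ` amplification ` A \<subseteq> {x. cinner x Z = 0}"
      using val D(1) zero by auto
  qed
  finally have "cinner (T \<xi>) \<zeta> + cinner (T \<zeta>) \<xi> = 0"
    using val[OF Tb] by simp
  then have "Re (cinner (T \<xi>) \<zeta>) = 0"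
    using sa[OF Tb T(2)] by simp
  moreover have "Re (cinner p \<zeta>) = 0"
    unfolding \<zeta>_def by (rule p(2)[OF p(1)])
  ultimately have "Re (cinner \<zeta> \<zeta>) = 0"
    by (simp add: \<zeta>_def cinner_diff_left)
  then have "T \<xi> = p"
    by (simp add: Re_cinner_self \<zeta>_def)
  then show ?thesis
    using p(1) W_def by simp
qed

lemma selfadjoint_approximation:
  fixes A :: "('h :: chilbert_space \<Rightarrow> 'h) set"
  assumes A: "unital_star_algebra A" and T: "T \<in> commutant (commutant A)" "adj T = T"
    and I: "finite I" and e: "0 < e"
  obtains S where "S \<in> A" "adj S = S" "\<And>u. u \<in> I \<Longrightarrow> norm (S u - T u) < e"
proof -
  note D = unital_star_algebraD[OF A]
  have Tb: "T \<in> bounded_ops"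
    using T(1) commutantD by blast
  \<comment> \<open>The index type is \<open>'h\<close> itself, with \<open>u\<close> placed at
    index \<open>u\<close>: one vector of the amplified space records all of \<open>I\<close>
    without an enumeration.\<close>
  define \<xi> :: "('h, 'h) ell2" where "\<xi> = Abs_ell2 (\<lambda>u. if u \<in> I then u else 0)"
  have "(\<lambda>u. (norm (if u \<in> I then u else 0))\<^sup>2) summable_on UNIV"
    by (subst summable_on_cong_neutral[where T = I]) (auto simp: I)
  then have \<xi>: "Rep_ell2 \<xi> u = u" if "u \<in> I" for u
    using that by (simp add: \<xi>_def Abs_ell2_inverse)
  have "amplification T \<xi> \<in> closure ((\<lambda>S. S \<xi>) ` {S \<in> amplification ` A. adj S = S})"
    using D(1) T(2) Tb by (intro bicommutant_in_selfadjoint_closure amplification_unital_star_algebra A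
        amplification_bicommutant T(1)) (auto simp: adj_amplification)
  then obtain S where S: "S \<in> A" "adj (amplification S :: ('h, 'h) ell2 \<Rightarrow> _) = amplification S"
    and d: "dist (amplification S \<xi>) (amplification T \<xi>) < e"
    unfolding closure_approachable using e by blast
  note Sb = D(1)[OF S(1)]
  \<comment> \<open>Selfadjointness was obtained for the amplification; it is read off at the
    component \<open>v\<close> of \<open>single_ell2 v v\<close>.\<close>
  have "adj S v = S v" for v
  proof -
    have "amplification (adj S) (single_ell2 v v :: ('h, 'h) ell2) = amplification S (single_ell2 v v)"
      using S(2) by (simp add: adj_amplification[OF Sb])
    then have "Rep_ell2 (single_ell2 v (adj S v) :: ('h, 'h) ell2) v = Rep_ell2 (single_ell2 v (S v) :: ('h, 'h) ell2) v"
      by (simp add: amplification_single Sb adj_bounded_ops)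
    then show ?thesis
      by (simp add: Rep_single)
  qed
  moreover have "norm (S u - T u) < e" if "u \<in> I" for u
    using norm_component_le_norm_ell2[of "amplification S \<xi> - amplification T \<xi>" u] d \<xi>[OF that]
    by (simp add: Rep_amplification Sb Tb dist_norm)
  ultimately show ?thesis
    using that S(1) by blast
qed

subsection \<open>Resolvents and monotone limits\<close>

lemma zero_quadratic_form_imp_zero:
  fixes D :: "'h :: chilbert_space \<Rightarrow> 'h"
  assumes D: "D \<in> bounded_ops" and zero: "\<And>v. cinner (D v) v = 0"
  shows "D v = 0"
proof (rule cinner_ext)
  fix w
  have 1: "cinner (D v) w + cinner (D w) v = 0"
    using zero[of "v + w"] zero[of v] zero[of w]
    by (simp add: bounded_opsD[OF D] cinner_simps add.commute)
  have "cinner (D v) (\<i> *\<^sub>C w) + cinner (D (\<i> *\<^sub>C w)) v = 0"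
    using zero[of "v + \<i> *\<^sub>C w"] zero[of v] zero[of "\<i> *\<^sub>C w"]
    by (simp add: bounded_opsD[OF D] cinner_add_left cinner_add_right add.commute)
  then have "\<i> * (cinner (D w) v - cinner (D v) w) = 0"
    by (simp add: bounded_opsD[OF D] cinner_simps algebra_simps)
  then have "cinner (D w) v - cinner (D v) w = 0"
    by simp
  with 1 have "cinner (D v) w = 0"
    by algebra
  then show "cinner w (D v) = cinner w 0"
    using cinner_commute[of w "D v"] by simp
qed

lemma selfadjoint_cinner_real:
  assumes "T \<in> bounded_ops" "adj T = T"
  shows "cinner (T v) v \<in> \<real>"
proof -
  have "cnj (cinner (T v) v) = cinner (T v) v"
    using cinner_adj_left[OF assms(1), of v v] assms(2) cinner_commute[of v "T v"] by simp
  then show ?thesis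
    by (metis Reals_cnj_iff)
qed

lemma selfadjoint_cinner:
  assumes "T \<in> bounded_ops" "adj T = T"
  shows "cinner (T v) w = cinner v (T w)"
  using cinner_adj_left[OF assms(1), of v w] assms(2) by simp

lemma positive_opD:
  assumes "positive_op T"
  shows "T \<in> bounded_ops" "adj T = T" "0 \<le> Re (cinner (T v) v)"
proof -
  show T: "T \<in> bounded_ops" "0 \<le> Re (cinner (T v) v)" for v
    using assms unfolding positive_op_def by auto
  define D where "D = (\<lambda>v. adj T v - T v)"
  have "D \<in> bounded_ops"
    unfolding D_def using T(1) adj_bounded_ops bounded_ops_diff by blast
  moreover have "cinner (D v) v = 0" for v
  proof -
    have "cnj (cinner (T v) v) = cinner (T v) v"
      using assms unfolding positive_op_def by (metis Reals_cnj_iff)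
    then show ?thesis
      by (simp add: D_def cinner_diff_left cinner_adj_left[OF T(1)] flip: cinner_commute[of v "T v"])
  qed
  ultimately have "D v = 0" for v
    by (rule zero_quadratic_form_imp_zero)
  then show "adj T = T"
    by (auto simp: D_def)
qed

lemma positive_opI:
  "T \<in> bounded_ops \<Longrightarrow> adj T = T \<Longrightarrow> (\<And>v. 0 \<le> Re (cinner (T v) v)) \<Longrightarrow> positive_op T"
  unfolding positive_op_def using selfadjoint_cinner_real by blast

lemma positive_op_id [simp]: "positive_op id"
  by (rule positive_opI) (auto simp: Re_cinner_self)

lemma positive_op_add: "positive_op S \<Longrightarrow> positive_op T \<Longrightarrow> positive_op (\<lambda>v. S v + T v)"
  by (rule positive_opI) (auto simp: bounded_ops_add adj_add positive_opD cinner_simps)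

lemma positive_op_diffI:
  assumes "S \<in> bounded_ops" "adj S = S" "T \<in> bounded_ops" "adj T = T"
    and "\<And>v. Re (cinner (S v) v) \<le> Re (cinner (T v) v)"
  shows "positive_op (\<lambda>v. T v - S v)"
  by (rule positive_opI) (use assms in \<open>auto simp: bounded_ops_diff adj_diff cinner_simps\<close>)

lemma positive_op_adj_comp: "T \<in> bounded_ops \<Longrightarrow> positive_op (adj T \<circ> T)"
  by (rule positive_opI)
    (auto simp: bounded_ops_comp adj_bounded_ops adj_comp adj_adj cinner_adj_left Re_cinner_self)

text \<open>This is \<open>s^2 \<le> s\<close> for \<open>0 \<le> s \<le> 1\<close>, obtained
  without square roots: evaluate the form of \<open>s\<close> at \<open>v - s v\<close> and bound
  its value at \<open>s v\<close> by \<open>(norm (s v))^2\<close>.\<close>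

lemma positive_contraction_norm:
  assumes s: "positive_op s" and le: "\<And>v. Re (cinner (s v) v) \<le> (norm v)\<^sup>2"
  shows "(norm (s v))\<^sup>2 \<le> Re (cinner (s v) v)"
proof -
  note D = positive_opD[OF s] bounded_opsD[OF positive_opD(1)[OF s]]
  have "0 \<le> Re (cinner (s (v - s v)) (v - s v))"
    by (rule D)
  also have "\<dots> = Re (cinner (s v) v) - 2 * (norm (s v))\<^sup>2 + Re (cinner (s (s v)) (s v))"
    by (simp add: D(7) cinner_simps Re_cinner_self selfadjoint_cinner[OF D(1,2), of "s v" v])
  finally show ?thesis
    using le[of "s v"] by simp
qed

lemma inverse_of_bounded_below:
  fixes B :: "'a :: chilbert_space \<Rightarrow> 'a"
  assumes B: "B \<in> bounded_ops"
    and below: "\<And>v. norm v \<le> C * norm (B v)" "\<And>v. norm v \<le> C * norm (adj B v)"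
  shows "inv B \<in> bounded_ops" "inv B (B v) = v" "B (inv B v) = v" "norm (inv B v) \<le> C * norm v"
proof -
  obtain R where R: "R \<in> bounded_ops" "R \<circ> B = id" "B \<circ> R = id" "\<And>v. norm (R v) \<le> C * norm v"
    using invertible_of_bounded_below[OF assms] by metis
  have eq: "inv B = R"
    by (rule inv_unique_comp[OF R(3,2)])
  show "inv B \<in> bounded_ops" "inv B (B v) = v" "B (inv B v) = v" "norm (inv B v) \<le> C * norm v"
    unfolding eq using R(1,4) fun_cong[OF R(2), of v] fun_cong[OF R(3), of v] by simp_all
qed

section \<open>Resolvents of positive operators\<close>

definition pos_res :: "('h :: chilbert_space \<Rightarrow> 'h) \<Rightarrow> 'h \<Rightarrow> 'h" where
  "pos_res s = inv (\<lambda>v. v + s v)"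

lemma
  fixes s :: "'h :: chilbert_space \<Rightarrow> 'h"
  assumes s: "positive_op s"
  shows pos_res_bounded_ops: "pos_res s \<in> bounded_ops"
    and pos_res_left: "pos_res s (v + s v) = v"
    and pos_res_right: "pos_res s v + s (pos_res s v) = v"
proof -
  note D = positive_opD[OF s] bounded_opsD[OF positive_opD(1)[OF s]]
  define B where "B = (\<lambda>v. v + s v)"
  have B: "B \<in> bounded_ops"
    unfolding B_def by (intro bounded_ops_add bounded_ops_id D)
  have adjB: "adj B = B"
    unfolding B_def by (simp add: adj_add D)
  have below: "norm v \<le> 1 * norm (B v)" for v
  proof -
    have "norm v * norm v \<le> Re (cinner (B v) v)"
      using D(3)[of v] by (simp add: B_def cinner_simps Re_cinner_self power2_eq_square)
    also have "\<dots> \<le> norm (B v) * norm v"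
      by (rule Re_cinner_le)
    finally show ?thesis
      by (cases "v = 0") auto
  qed
  note inv = inverse_of_bounded_below[OF B below, unfolded adjB, OF below]
  show "pos_res s \<in> bounded_ops" "pos_res s (v + s v) = v" "pos_res s v + s (pos_res s v) = v"
    using inv(1) inv(2,3)[of v] by (simp_all add: pos_res_def B_def)
qed

lemma pos_res_adj:
  assumes s: "positive_op s"
  shows "adj (pos_res s) = pos_res s"
proof (rule adj_unique)
  fix v w
  note D = positive_opD[OF s]
  define u r where "u = pos_res s w" and "r = pos_res s v"
  have w: "w = u + s u" and v: "v = r + s r"
    unfolding u_def r_def using pos_res_right[OF s] by simp_all
  have "cinner r (u + s u) = cinner (r + s r) u"
    by (simp add: cinner_simps selfadjoint_cinner[OF D(1,2)])
  then show "cinner (pos_res s v) w = cinner v (pos_res s w)"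
    unfolding r_def[symmetric] u_def[symmetric] w[symmetric] v[symmetric] .
qed

text \<open>The resolvent has the variational description
  \<open>\<langle>(1 + s)\<inverse> v, v\<rangle> = sup\<^sub>y (2 Re \<langle>v, y\<rangle> - \<langle>(1 + s) y, y\<rangle>)\<close>, which makes its monotonicity evident.\<close>

lemma pos_res_variational:
  assumes s: "positive_op s"
  shows "2 * Re (cinner v y) - (norm y)\<^sup>2 - Re (cinner (s y) y) \<le> Re (cinner (pos_res s v) v)"
proof -
  note D = positive_opD[OF s] bounded_opsD[OF positive_opD(1)[OF s]]
  define r where "r = pos_res s v"
  have v: "v = r + s r"
    unfolding r_def using pos_res_right[OF s] by simp
  have "0 \<le> (norm (r - y))\<^sup>2 + Re (cinner (s (r - y)) (r - y))"
    using D(3) by simp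
  also have "\<dots> = Re (cinner r v) - 2 * Re (cinner v y) + (norm y)\<^sup>2 + Re (cinner (s y) y)"
    unfolding v
    by (simp add: norm_diff_sq D(7) cinner_simps Re_cinner_self selfadjoint_cinner[OF D(1,2), of y r]
        Re_cinner_commute[of y "s r"] Re_cinner_commute[of r "s r"])
  finally show ?thesis
    by (simp add: r_def)
qed

lemma pos_res_quadratic_form:
  assumes s: "positive_op s"
  shows "Re (cinner (pos_res s v) v) =
    2 * Re (cinner v (pos_res s v)) - (norm (pos_res s v))\<^sup>2 - Re (cinner (s (pos_res s v)) (pos_res s v))"
proof -
  define r where "r = pos_res s v"
  have v: "v = r + s r"
    unfolding r_def using pos_res_right[OF s] by simp
  have "Re (cinner r v) = 2 * Re (cinner v r) - (norm r)\<^sup>2 - Re (cinner (s r) r)"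
    unfolding v by (simp add: cinner_simps Re_cinner_self Re_cinner_commute[of r "s r"])
  then show ?thesis
    unfolding r_def .
qed

lemma pos_res_antimono:
  assumes s: "positive_op s" and t: "positive_op t"
    and le: "\<And>v. Re (cinner (s v) v) \<le> Re (cinner (t v) v)"
  shows "Re (cinner (pos_res t v) v) \<le> Re (cinner (pos_res s v) v)"
  using pos_res_variational[OF s, of v "pos_res t v"] pos_res_quadratic_form[OF t, of v]
    le[of "pos_res t v"] by simp

text \<open>The choice \<open>y = v\<close> in the variational formula. Read as
  \<open>1 - (1 + s)^-1 \<le> s\<close>, it bounds a truncated sum by the sum itself.\<close>

lemma pos_res_ge: "positive_op s \<Longrightarrow> (norm v)\<^sup>2 - Re (cinner (s v) v) \<le> Re (cinner (pos_res s v) v)"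
  using pos_res_variational[of s v v] by (simp add: Re_cinner_self)

lemma pos_res_positive:
  assumes s: "positive_op s"
  shows "positive_op (pos_res s)"
proof (rule positive_opI[OF pos_res_bounded_ops[OF s] pos_res_adj[OF s]])
  show "0 \<le> Re (cinner (pos_res s v) v)" for v
    using pos_res_variational[OF s, of v 0] by (simp add: bounded_opsD[OF positive_opD(1)[OF s]])
qed

lemma pos_res_le_norm:
  assumes s: "positive_op s"
  shows "Re (cinner (pos_res s v) v) \<le> (norm v)\<^sup>2"
proof -
  have "positive_op (\<lambda>v :: 'a. 0)"
    by (simp add: positive_op_def)
  moreover have "pos_res (\<lambda>v :: 'a. 0) = id"
    unfolding pos_res_def by (simp flip: id_def)
  ultimately show ?thesis
    using pos_res_antimono[of "\<lambda>v. 0" s v] positive_opD(3)[OF s] s by (simp add: Re_cinner_self)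
qed

text \<open>The operator form of \<open>t / (1 + t) \<ge> t / 2\<close> on \<open>[0, 1]\<close>;
  the \<open>2\<close> bounds \<open>1 + t\<close>. With \<open>v = r + s r\<close> the claim
  becomes \<open>\<langle>s (s r), s r\<rangle> \<le> \<langle>s r, r\<rangle>\<close>, and
  \<open>(norm (s r))^2\<close> lies between the two sides.\<close>

lemma pos_res_contraction_le:
  assumes s: "positive_op s" and le: "\<And>v. Re (cinner (s v) v) \<le> (norm v)\<^sup>2"
  shows "Re (cinner (pos_res s v) v) \<le> (norm v)\<^sup>2 - Re (cinner (s v) v) / 2"
proof -
  note D = positive_opD[OF s] bounded_opsD[OF positive_opD(1)[OF s]]
  define r where "r = pos_res s v"
  have v: "v = r + s r"
    unfolding r_def using pos_res_right[OF s] by simp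
  have 1: "(norm v)\<^sup>2 = (norm r)\<^sup>2 + 2 * Re (cinner (s r) r) + (norm (s r))\<^sup>2"
    unfolding v norm_add_sq by (simp add: Re_cinner_commute[of r])
  have 2: "Re (cinner r v) = (norm r)\<^sup>2 + Re (cinner (s r) r)"
    unfolding v by (simp add: cinner_simps Re_cinner_self Re_cinner_commute[of r "s r"])
  have 3: "Re (cinner (s v) v) = Re (cinner (s r) r) + 2 * (norm (s r))\<^sup>2 + Re (cinner (s (s r)) (s r))"
    unfolding v by (simp add: D(5) cinner_simps Re_cinner_self selfadjoint_cinner[OF D(1,2), of "s r" r])
  have "Re (cinner r v) \<le> (norm v)\<^sup>2 - Re (cinner (s v) v) / 2"
    using le[of "s r"] positive_contraction_norm[OF s le, of r] 1 2 3 by argo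
  then show ?thesis
    unfolding r_def .
qed

lemma von_neumann_algebra_pos_res:
  assumes A: "von_neumann_algebra A" "s \<in> A" and s: "positive_op s"
  shows "pos_res s \<in> A"
proof (rule von_neumann_algebra_inverse[OF A(1)])
  show "(\<lambda>v. id v + s v) \<in> A"
    using von_neumann_algebra_closed(2,3)[OF A(1)] A(2) by blast
qed (use pos_res_bounded_ops[OF s] pos_res_left[OF s] pos_res_right[OF s] in \<open>auto simp: fun_eq_iff\<close>)

section \<open>Resolvents of selfadjoint operators at the point \<open>-i\<close>\<close>

definition cayley_res :: "('h :: chilbert_space \<Rightarrow> 'h) \<Rightarrow> 'h \<Rightarrow> 'h" where
  "cayley_res a = inv (\<lambda>v. a v + \<i> *\<^sub>C v)"

text \<open>Since \<open>cinner (a v) v\<close> is real, the cross term in the squared norm of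
  \<open>a v \<plusminus> i v\<close> vanishes. Hence \<open>a + i\<close> and its adjoint
  \<open>a - i\<close> are bounded below by \<open>1\<close>, whatever the norm of
  \<open>a\<close>.\<close>

lemma
  fixes a :: "'h :: chilbert_space \<Rightarrow> 'h"
  assumes a: "a \<in> bounded_ops" "adj a = a"
  shows cayley_res_bounded_ops: "cayley_res a \<in> bounded_ops"
    and cayley_res_left: "cayley_res a (a v + \<i> *\<^sub>C v) = v"
    and cayley_res_right: "a (cayley_res a v) + \<i> *\<^sub>C cayley_res a v = v"
    and norm_cayley_res_le: "norm (cayley_res a v) \<le> norm v"
proof -
  define B where "B = (\<lambda>v. a v + \<i> *\<^sub>C v)"
  have B: "B \<in> bounded_ops"
    unfolding B_def by (intro bounded_ops_add bounded_ops_scaleC bounded_ops_id a)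
  have adjB: "adj B = (\<lambda>v. a v + (- \<i>) *\<^sub>C v)"
    unfolding B_def using a by (simp add: adj_add adj_scaleC bounded_ops_scaleC)
  have im: "Im (cinner (a v) v) = 0" for v
    using selfadjoint_cinner_real[OF a] complex_is_Real_iff by blast
  have "norm v \<le> norm (a v + c *\<^sub>C v)" if "c = \<i> \<or> c = - \<i>" for v c
  proof (rule power2_le_imp_le)
    have "Re (cinner (a v) (c *\<^sub>C v)) = 0"
      using im[of v] that by (auto simp: cinner_simps)
    moreover have "cmod c = 1"
      using that by auto
    ultimately show "(norm v)\<^sup>2 \<le> (norm (a v + c *\<^sub>C v))\<^sup>2"
      unfolding norm_add_sq by (simp add: norm_scaleC)
  qed simp
  then have below: "norm v \<le> 1 * norm (B v)" "norm v \<le> 1 * norm (adj B v)" for v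
    unfolding adjB by (simp_all add: B_def)
  note inv = inverse_of_bounded_below[OF B below]
  show "cayley_res a \<in> bounded_ops" "cayley_res a (a v + \<i> *\<^sub>C v) = v"
    "a (cayley_res a v) + \<i> *\<^sub>C cayley_res a v = v" "norm (cayley_res a v) \<le> norm v"
    using inv(1) inv(2-4)[of v] by (simp_all add: cayley_res_def B_def)
qed

text \<open>The resolvent identity together with contractivity of \<open>cayley_res a\<close>. The
  only vector tested is \<open>cayley_res b w\<close>: for a fixed limit \<open>b\<close> the test
  vectors can be chosen before the approximant \<open>a\<close>.\<close>

lemma norm_cayley_res_diff_le:
  assumes a: "a \<in> bounded_ops" "adj a = a" and b: "b \<in> bounded_ops" "adj b = b"
  shows "norm (cayley_res a w - cayley_res b w) \<le> norm (a (cayley_res b w) - b (cayley_res b w))"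
proof -
  define u where "u = cayley_res b w"
  have w: "w = (b u - a u) + (a u + \<i> *\<^sub>C u)"
    using cayley_res_right[OF b, of w] by (simp add: u_def)
  have "cayley_res a w = cayley_res a (b u - a u) + u"
    using bounded_opsD(2)[OF cayley_res_bounded_ops[OF a], of "b u - a u" "a u + \<i> *\<^sub>C u"]
      cayley_res_left[OF a, of u] w by simp
  then show ?thesis
    using norm_cayley_res_le[OF a, of "b u - a u"] by (simp add: u_def norm_minus_commute)
qed

lemma von_neumann_algebra_cayley_res_iff:
  assumes A: "von_neumann_algebra A" and a: "a \<in> bounded_ops" "adj a = a"
  shows "cayley_res a \<in> A \<longleftrightarrow> a \<in> A"
proof -
  note D = von_neumann_algebra_closed[OF A]
  have i: "(\<lambda>v. \<i> *\<^sub>C id v) \<in> A"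
    using D(2,4) by blast
  have eq: "cayley_res a \<circ> (\<lambda>v. a v + \<i> *\<^sub>C id v) = id" "(\<lambda>v. a v + \<i> *\<^sub>C id v) \<circ> cayley_res a = id"
    using cayley_res_left[OF a] cayley_res_right[OF a] by (auto simp: fun_eq_iff)
  have Bb: "(\<lambda>v. a v + \<i> *\<^sub>C id v) \<in> bounded_ops"
    by (intro bounded_ops_add a bounded_ops_scaleC bounded_ops_id)
  show ?thesis
  proof
    assume "cayley_res a \<in> A"
    from von_neumann_algebra_inverse[OF A this Bb eq(2,1)]
    have "(\<lambda>v. (a v + \<i> *\<^sub>C id v) - \<i> *\<^sub>C id v) \<in> A"
      using i D(7) by blast
    then show "a \<in> A"
      by simp
  next
    assume "a \<in> A"
    then have "(\<lambda>v. a v + \<i> *\<^sub>C id v) \<in> A"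
      using i D(3) by blast
    from von_neumann_algebra_inverse[OF A this cayley_res_bounded_ops[OF a] eq]
    show "cayley_res a \<in> A" .
  qed
qed

text \<open>Differences \<open>u n - u m\<close> with \<open>m \<le> n\<close> are positive
  contractions, so \<open>(norm (u n v - u m v))^2\<close> is at most the difference of the forms,
  which converge. The resulting strong limit still commutes with \<open>commutant A\<close>.\<close>

lemma von_neumann_algebra_incseq_limit:
  fixes u :: "nat \<Rightarrow> 'h :: chilbert_space \<Rightarrow> 'h"
  assumes A: "von_neumann_algebra A" and u: "\<And>n. u n \<in> A" "\<And>n. positive_op (u n)"
    and mono: "\<And>n v. Re (cinner (u n v) v) \<le> Re (cinner (u (Suc n) v) v)"
    and le: "\<And>n v. Re (cinner (u n v) v) \<le> (norm v)\<^sup>2"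
  obtains L where "L \<in> A" "positive_op L" "\<And>v. (\<lambda>n. Re (cinner (u n v) v)) \<longlonglongrightarrow> Re (cinner (L v) v)"
    "\<And>n v. Re (cinner (u n v) v) \<le> Re (cinner (L v) v)" "\<And>v. Re (cinner (L v) v) \<le> (norm v)\<^sup>2"
proof -
  note D = positive_opD[OF u(2)] bounded_opsD[OF positive_opD(1)[OF u(2)]]
  have mono': "Re (cinner (u m v) v) \<le> Re (cinner (u n v) v)" if "m \<le> n" for m n v
    using lift_Suc_mono_le[of "\<lambda>n. Re (cinner (u n v) v)"] mono that by blast
  have diff: "(norm (u n v - u m v))\<^sup>2 \<le> Re (cinner (u n v) v) - Re (cinner (u m v) v)" if "m \<le> n" for m n v
  proof -
    have "positive_op (\<lambda>v. u n v - u m v)"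
      using mono'[OF that] D by (intro positive_op_diffI) auto
    moreover have "Re (cinner (u n v - u m v) v) \<le> (norm v)\<^sup>2" for v
      using le[of n v] D(3)[of m v] by (simp add: cinner_simps)
    ultimately show ?thesis
      using positive_contraction_norm[of "\<lambda>v. u n v - u m v" v] by (simp add: cinner_simps)
  qed
  have "\<exists>l. (\<lambda>n. u n v) \<longlonglongrightarrow> l" for v
  proof -
    have "incseq (\<lambda>n. Re (cinner (u n v) v))"
      using mono by (intro incseq_SucI)
    then obtain l where "(\<lambda>n. Re (cinner (u n v) v)) \<longlonglongrightarrow> l"
      using le incseq_convergent by metis
    then have cau: "Cauchy (\<lambda>n. Re (cinner (u n v) v))"
      by (rule LIMSEQ_imp_Cauchy)
    have "Cauchy (\<lambda>n. u n v)"
    proof (rule metric_CauchyI)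
      fix e :: real assume e: "0 < e"
      then have "0 < e\<^sup>2"
        by simp
      then obtain M where M: "\<And>m n. m \<ge> M \<Longrightarrow> n \<ge> M \<Longrightarrow>
          dist (Re (cinner (u m v) v)) (Re (cinner (u n v) v)) < e\<^sup>2"
        using metric_CauchyD[OF cau] by blast
      have lt: "dist (u m v) (u n v) < e" if "m \<ge> M" "n \<ge> m" for m n
      proof -
        have "(norm (u n v - u m v))\<^sup>2 < e\<^sup>2"
          using diff[OF that(2), of v] M[of n m] that by (simp add: dist_real_def)
        then show ?thesis
          using e by (simp add: dist_norm norm_minus_commute power2_less_imp_less)
      qed
      then have "dist (u m v) (u n v) < e" if "m \<ge> M" "n \<ge> M" for m n
        using that by (metis dist_commute nle_le)
      then show "\<exists>M. \<forall>m\<ge>M. \<forall>n\<ge>M. dist (u m v) (u n v) < e"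
        by blast
    qed
    then show ?thesis
      using Cauchy_convergent convergent_def by blast
  qed
  then obtain L where L: "\<And>v. (\<lambda>n. u n v) \<longlonglongrightarrow> L v"
    by metis
  have lim_eq: "L v = w" if "(\<lambda>n. u n v) \<longlonglongrightarrow> w" for v w
    using L that LIMSEQ_unique by blast
  have form: "(\<lambda>n. Re (cinner (u n v) w)) \<longlonglongrightarrow> Re (cinner (L v) w)" for v w
    by (intro tendsto_intros tendsto_cinner_left L)
  have Lb: "L \<in> bounded_ops"
  proof (rule bounded_opsI[where K = 1])
    show "L (x + y) = L x + L y" for x y
      by (rule lim_eq) (simp add: D tendsto_add L)
    show "L (c *\<^sub>C x) = c *\<^sub>C L x" for c x
      by (rule lim_eq) (auto simp: D intro!: L
          bounded_linear.tendsto[OF bounded_opsD(1)[OF bounded_ops_scaleC[OF bounded_ops_id(2)]]])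
    show "norm (L x) \<le> 1 * norm x" for x
    proof (rule LIMSEQ_le_const2)
      show "(\<lambda>n. norm (u n x)) \<longlonglongrightarrow> norm (L x)"
        by (intro tendsto_intros L)
      have "norm (u n x) \<le> norm x" for n
        using positive_contraction_norm[OF u(2) le, of n x] le[of n x]
        by (meson norm_ge_zero order_trans power2_le_imp_le)
      then show "\<exists>N. \<forall>n\<ge>N. norm (u n x) \<le> 1 * norm x"
        by simp
    qed
  qed
  have adjL: "adj L = L"
  proof (rule adj_unique)
    fix v w
    have "(\<lambda>n. cinner (u n v) w) \<longlonglongrightarrow> cinner (L v) w"
      by (intro tendsto_cinner_left L)
    moreover have "(\<lambda>n. cinner (u n v) w) \<longlonglongrightarrow> cinner v (L w)"
      unfolding selfadjoint_cinner[OF D(1,2)] by (intro tendsto_cinner_right L)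
    ultimately show "cinner (L v) w = cinner v (L w)"
      using LIMSEQ_unique by blast
  qed
  have ge: "Re (cinner (u n v) v) \<le> Re (cinner (L v) v)" for n v
    using incseq_le[OF incseq_SucI[of "\<lambda>n. Re (cinner (u n v) v)", OF mono] form] .
  have "L \<in> A"
  proof (rule von_neumann_algebra_memI[OF A Lb])
    fix S x assume S: "S \<in> commutant A"
    have "(\<lambda>n. S (u n x)) \<longlonglongrightarrow> S (L x)"
      by (rule bounded_linear.tendsto[OF bounded_opsD(1)[OF commutantD(1)[OF S]] L])
    then show "L (S x) = S (L x)"
      using commutantD(2)[OF S u(1)] by (intro lim_eq) simp
  qed
  moreover have "positive_op L"
    using Lb adjL order_trans[OF D(3) ge] by (intro positive_opI)
  moreover have "Re (cinner (L v) v) \<le> (norm v)\<^sup>2" for v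
    by (rule LIMSEQ_le_const2[OF form]) (use le in auto)
  ultimately show ?thesis
    using that form ge by blast
qed

text \<open>\<open>f\<close> is the projection onto the vectors orthogonal to all \<open>T w\<close>
  with \<open>T\<close> in the commutant. This subspace is invariant under the commutant, which puts
  \<open>f\<close> into \<open>A\<close>. An element \<open>k\<close> of \<open>A\<close> that kills
  \<open>W\<close> also kills every \<open>T w\<close>; if it is positive it maps into
  \<open>V\<close>, so that \<open>k = f k f \<le> f\<close> for a contraction
  \<open>k\<close>.\<close>

lemma largest_annihilator:
  fixes A :: "('h :: chilbert_space \<Rightarrow> 'h) set"
  assumes A: "von_neumann_algebra A"
  obtains f where "f \<in> A" "positive_op f" "\<And>v. Re (cinner (f v) v) \<le> (norm v)\<^sup>2"
    "\<And>w. w \<in> W \<Longrightarrow> f w = 0"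
    "\<And>k v. k \<in> A \<Longrightarrow> positive_op k \<Longrightarrow> (\<And>v. Re (cinner (k v) v) \<le> (norm v)\<^sup>2) \<Longrightarrow>
      (\<And>w. w \<in> W \<Longrightarrow> k w = 0) \<Longrightarrow> Re (cinner (k v) v) \<le> Re (cinner (f v) v)"
proof -
  define V where "V = (\<Inter>w\<in>W. \<Inter>T\<in>commutant A. {u. cinner u (T w) = 0})"
  have V_iff: "u \<in> V \<longleftrightarrow> (\<forall>w\<in>W. \<forall>T\<in>commutant A. cinner u (T w) = 0)" for u
    by (auto simp: V_def)
  have cl: "closed V"
    unfolding V_def
    by (intro closed_INT ballI closed_Collect_eq linear_continuous_on bounded_linear_cinner_left
        continuous_on_const)
  have cs: "csubspace V"
    by (auto simp: csubspace_def V_iff cinner_simps)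
  obtain f where f: "f \<in> bounded_ops" "adj f = f" "\<And>x. f x \<in> V" "\<And>x. x \<in> V \<Longrightarrow> f x = x"
    "\<And>S x. S \<in> bounded_ops \<Longrightarrow> S ` V \<subseteq> V \<Longrightarrow> adj S ` V \<subseteq> V \<Longrightarrow> f (S x) = S (f x)"
    by (rule orthogonal_projection[OF cs cl]) (rule that)
  note cu = unital_star_algebraD[OF commutant_unital_star_algebra[of A]]
  have cD: "adj S \<in> commutant A" "S \<circ> T \<in> commutant A"
    if "S \<in> commutant A" "T \<in> commutant A" for S T
    using cu(5,6) that von_neumann_algebraD(1,2)[OF A] by blast+
  have form: "Re (cinner (f v) v) = (norm (f v))\<^sup>2" for v
    using selfadjoint_cinner[OF f(1,2), of "f v" v] f(4)[OF f(3)] by (simp add: Re_cinner_self)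
  have inv: "S ` V \<subseteq> V" if S: "S \<in> commutant A" for S
  proof
    fix x assume "x \<in> S ` V"
    then obtain u where u: "x = S u" "u \<in> V"
      by blast
    have "cinner (S u) (T w) = 0" if "w \<in> W" "T \<in> commutant A" for w T
    proof -
      have "cinner (S u) (T w) = cinner u ((adj S \<circ> T) w)"
        using commutantD(1)[OF S] by (simp add: cinner_adj_right)
      then show ?thesis
        using u(2) that cD S unfolding V_iff by metis
    qed
    then show "x \<in> V"
      by (simp add: V_iff u(1))
  qed
  have fA: "f \<in> A"
    using f(5) inv cD(1) commutantD(1) by (intro von_neumann_algebra_memI[OF A f(1)]) blast
  show ?thesis
  proof (rule that)
    show "positive_op f"
      using f form by (intro positive_opI) auto
    show "Re (cinner (f v) v) \<le> (norm v)\<^sup>2" for v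
    proof -
      have "norm (f v) * norm (f v) \<le> norm (f v) * norm v"
        using form[of v] Re_cinner_le[of "f v" v] by (simp add: power2_eq_square)
      then have "norm (f v) \<le> norm v"
        by (cases "f v = 0") auto
      then show ?thesis
        unfolding form by (simp add: power_mono)
    qed
    show "f w = 0" if w: "w \<in> W" for w
    proof -
      have "id \<in> commutant A"
        by (rule commutantI) auto
      then have "cinner (f w) w = 0"
        using f(3)[of w] w V_iff by (metis id_apply)
      then show ?thesis
        using form[of w] by simp
    qed
    show "Re (cinner (k v) v) \<le> Re (cinner (f v) v)"
      if k: "k \<in> A" "positive_op k" "\<And>v. Re (cinner (k v) v) \<le> (norm v)\<^sup>2" "\<And>w. w \<in> W \<Longrightarrow> k w = 0" for k v
    proof -
      note kD = positive_opD[OF k(2)]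
      have "k u \<in> V" for u
      proof (unfold V_iff, intro ballI)
        fix w T assume w: "w \<in> W" and T: "T \<in> commutant A"
        have "cinner (k u) (T w) = cinner u (T (k w))"
          using commutantD(2)[OF T k(1), of w] selfadjoint_cinner[OF kD(1,2)] by metis
        then show "cinner (k u) (T w) = 0"
          using k(4)[OF w] commutantD(1)[OF T] by (simp add: bounded_opsD)
      qed
      then have fk: "f (k u) = k u" for u
        using f(4) by blast
      have kf: "k (f u) = k u" for u
      proof (rule cinner_ext)
        show "cinner w (k (f u)) = cinner w (k u)" for w
          using selfadjoint_cinner[OF kD(1,2)] selfadjoint_cinner[OF f(1,2)] fk by metis
      qed
      have "cinner (k v) v = cinner (k (f v)) (f v)"
        using fk kf selfadjoint_cinner[OF f(1,2)] by metis
      then show ?thesis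
        using k(3)[of "f v"] form by simp
    qed
  qed (rule fA)
qed

section \<open>Algebras with a faithful normal trace\<close>

locale traced_algebra =
  fixes P :: "('h :: chilbert_space \<Rightarrow> 'h) set" and \<tau> :: "('h \<Rightarrow> 'h) \<Rightarrow> complex"
  assumes P: "von_neumann_algebra P" and trace: "trace_on P \<tau>"
    and faithful: "faithful_on P \<tau>" and normal: "normal_on P \<tau>"
begin

lemmas P_closed = von_neumann_algebra_closed[OF P]

lemma \<tau>_add: "S \<in> P \<Longrightarrow> T \<in> P \<Longrightarrow> \<tau> (\<lambda>v. S v + T v) = \<tau> S + \<tau> T"
  and \<tau>_scaleC: "T \<in> P \<Longrightarrow> \<tau> (\<lambda>v. c *\<^sub>C T v) = c * \<tau> T"
  and \<tau>_positive: "T \<in> P \<Longrightarrow> positive_op T \<Longrightarrow> \<tau> T \<in> \<real> \<and> 0 \<le> Re (\<tau> T)"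
  and \<tau>_comp_commute: "S \<in> P \<Longrightarrow> T \<in> P \<Longrightarrow> \<tau> (S \<circ> T) = \<tau> (T \<circ> S)"
  using trace unfolding trace_on_def by blast+

lemma \<tau>_diff: "S \<in> P \<Longrightarrow> T \<in> P \<Longrightarrow> \<tau> (\<lambda>v. S v - T v) = \<tau> S - \<tau> T"
  using \<tau>_add[of S "\<lambda>v. (- 1) *\<^sub>C T v"] \<tau>_scaleC[of T "- 1"] P_closed(4)[of T "- 1"]
  by (simp add: scaleC_minus_left)

lemma \<tau>_zero [simp]: "\<tau> (\<lambda>v. 0) = 0"
  using \<tau>_scaleC[OF P_closed(2), of 0] by simp

lemma \<tau>_mono:
  assumes S: "S \<in> P" "adj S = S" and T: "T \<in> P" "adj T = T"
    and le: "\<And>v. Re (cinner (S v) v) \<le> Re (cinner (T v) v)"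
  shows "Re (\<tau> S) \<le> Re (\<tau> T)"
proof -
  have "positive_op (\<lambda>v. T v - S v)"
    using S T le P_closed(1) by (intro positive_op_diffI) auto
  then have "0 \<le> Re (\<tau> (\<lambda>v. T v - S v))"
    using \<tau>_positive P_closed(7) S T by blast
  then show ?thesis
    using \<tau>_diff S T by simp
qed

text \<open>\<open>trace_on\<close> asserts reality at positive operators; adding \<open>K\<close>
  times the identity makes \<open>T\<close> positive.\<close>

lemma \<tau>_selfadjoint_real:
  assumes T: "T \<in> P" "adj T = T"
  shows "\<tau> T \<in> \<real>"
proof -
  have Tb: "T \<in> bounded_ops"
    using T(1) P_closed(1) by blast
  obtain K where K: "0 \<le> K" "\<And>v. norm (T v) \<le> K * norm v"
    using bounded_ops_bound[OF Tb] by blast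
  have Kid: "(\<lambda>v. complex_of_real K *\<^sub>C id v) \<in> P" "\<tau> (\<lambda>v. complex_of_real K *\<^sub>C id v) \<in> \<real>"
    by (rule P_closed(4)[OF P_closed(2)])
      (unfold \<tau>_scaleC[OF P_closed(2)], use \<tau>_positive[OF P_closed(2)] in simp)
  have neg_le: "- Re (cinner (T v) v) \<le> K * (norm v)\<^sup>2" for v
  proof -
    have "- Re (cinner (T v) v) \<le> norm (T v) * norm v"
      using Re_cinner_le[of "- T v" v] by (simp add: cinner_simps)
    also have "\<dots> \<le> K * norm v * norm v"
      using K(2) by (simp add: mult_right_mono)
    finally show ?thesis
      by (simp add: power2_eq_square mult.assoc)
  qed
  have ge: "0 \<le> Re (cinner (complex_of_real K *\<^sub>C v + T v) v)" for v
    using neg_le[of v] by (simp add: cinner_add_left cinner_scaleC_left Re_cinner_self)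
  have "positive_op (\<lambda>v. complex_of_real K *\<^sub>C id v + T v)"
    using ge Tb T(2) by (intro positive_opI)
      (auto intro!: bounded_ops_add bounded_ops_scaleC simp: adj_add adj_scaleC bounded_ops_scaleC)
  then have "\<tau> (\<lambda>v. complex_of_real K *\<^sub>C id v + T v) \<in> \<real>"
    using \<tau>_positive P_closed(3)[OF Kid(1) T(1)] by blast
  then show ?thesis
    using \<tau>_add[OF Kid(1) T(1)] Kid(2) by (metis Reals_diff add_diff_cancel_left')
qed

lemma \<tau>_adj:
  assumes T: "T \<in> P"
  shows "\<tau> (adj T) = cnj (\<tau> T)"
proof -
  have Tb: "T \<in> bounded_ops"
    using T P_closed(1) by blast
  note T' = P_closed(6)[OF T]
  have 1: "\<tau> (\<lambda>v. T v + adj T v) \<in> \<real>"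
    using P_closed(3)[OF T T'] Tb
    by (intro \<tau>_selfadjoint_real) (auto simp: adj_add adj_adj adj_bounded_ops add.commute)
  have 2: "\<tau> (\<lambda>v. \<i> *\<^sub>C (T v - adj T v)) \<in> \<real>"
    using P_closed(4)[OF P_closed(7)[OF T T']] Tb
    by (intro \<tau>_selfadjoint_real)
      (auto simp: adj_scaleC adj_diff adj_adj adj_bounded_ops bounded_ops_diff scaleC_minus_left
        simp flip: scaleC_minus_right)
  show ?thesis
    using 1 2 by (simp add: \<tau>_add T T' \<tau>_scaleC P_closed(7) \<tau>_diff complex_is_Real_iff complex_eq_iff)
qed

text \<open>Translates \<open>normal_on\<close> from \<open>op_le\<close> to quadratic forms.
  Leastness has to be tested only against selfadjoint \<open>b\<close>, because an operator above a
  positive one is positive, and \<open>D\<close> is nonempty.\<close>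

lemma \<tau>_sup:
  assumes D: "D \<subseteq> P" "D \<noteq> {}" "\<And>T. T \<in> D \<Longrightarrow> positive_op T"
    and directed: "\<And>S T. S \<in> D \<Longrightarrow> T \<in> D \<Longrightarrow> \<exists>R\<in>D. \<forall>v. Re (cinner (S v) v) \<le> Re (cinner (R v) v) \<and>
      Re (cinner (T v) v) \<le> Re (cinner (R v) v)"
    and s: "s \<in> P" "positive_op s"
    and upper: "\<And>T v. T \<in> D \<Longrightarrow> Re (cinner (T v) v) \<le> Re (cinner (s v) v)"
    and least: "\<And>b v. b \<in> P \<Longrightarrow> adj b = b \<Longrightarrow>
      (\<And>T v. T \<in> D \<Longrightarrow> Re (cinner (T v) v) \<le> Re (cinner (b v) v)) \<Longrightarrow>
      Re (cinner (s v) v) \<le> Re (cinner (b v) v)"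
  shows "Re (\<tau> s) = (SUP T\<in>D. Re (\<tau> T))"
proof -
  have le_iff: "op_le S T \<longleftrightarrow> T \<in> bounded_ops \<and> adj T = T \<and>
      (\<forall>v. Re (cinner (S v) v) \<le> Re (cinner (T v) v))" if S: "positive_op S" and Tb: "T \<in> bounded_ops" for S T
  proof
    assume "op_le S T"
    then have pos: "positive_op (\<lambda>v. T v - S v)"
      by (simp add: op_le_def)
    then have "positive_op (\<lambda>v. (T v - S v) + S v)"
      using S by (rule positive_op_add)
    then have "positive_op T"
      by simp
    then show "T \<in> bounded_ops \<and> adj T = T \<and> (\<forall>v. Re (cinner (S v) v) \<le> Re (cinner (T v) v))"
      using positive_opD[OF pos] positive_opD(2) Tb by (simp add: cinner_simps)
  next
    assume "T \<in> bounded_ops \<and> adj T = T \<and> (\<forall>v. Re (cinner (S v) v) \<le> Re (cinner (T v) v))"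
    then show "op_le S T"
      unfolding op_le_def using positive_opD[OF S] by (intro positive_op_diffI) auto
  qed
  have Pb: "T \<in> P \<Longrightarrow> T \<in> bounded_ops" for T
    using P_closed(1) by blast
  have sb: "s \<in> bounded_ops" "adj s = s"
    using positive_opD[OF s(2)] by auto
  obtain T0 where T0: "T0 \<in> D"
    using D(2) by blast
  have "\<forall>T\<in>D. positive_op T"
    using D(3) by blast
  moreover have "\<exists>R\<in>D. op_le S R \<and> op_le T R" if ST: "S \<in> D" "T \<in> D" for S T
  proof -
    obtain R where R: "R \<in> D" "\<forall>v. Re (cinner (S v) v) \<le> Re (cinner (R v) v) \<and>
      Re (cinner (T v) v) \<le> Re (cinner (R v) v)"
      using directed[OF ST] by blast
    then show ?thesis
      using le_iff[OF D(3)[OF ST(1)]] le_iff[OF D(3)[OF ST(2)]] positive_opD(1,2)[OF D(3)[OF R(1)]] by blast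
  qed
  moreover have "op_le T s" if "T \<in> D" for T
    using le_iff[OF D(3)[OF that] sb(1)] sb upper[OF that] by blast
  moreover have "op_le s b" if b: "b \<in> P" "\<forall>T\<in>D. op_le T b" for b
  proof -
    have b': "adj b = b" "\<And>T v. T \<in> D \<Longrightarrow> Re (cinner (T v) v) \<le> Re (cinner (b v) v)"
      using b(2) le_iff[OF D(3) Pb[OF b(1)]] T0 by blast+
    then have "Re (cinner (s v) v) \<le> Re (cinner (b v) v)" for v
      using least[OF b(1)] by blast
    then show ?thesis
      using le_iff[OF s(2) Pb[OF b(1)]] b' Pb[OF b(1)] by blast
  qed
  ultimately have "D \<subseteq> P \<and> D \<noteq> {} \<and> (\<forall>T\<in>D. positive_op T) \<and>
        (\<forall>S\<in>D. \<forall>T\<in>D. \<exists>R\<in>D. op_le S R \<and> op_le T R) \<and>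
        s \<in> P \<and> (\<forall>T\<in>D. op_le T s) \<and> (\<forall>b\<in>P. (\<forall>T\<in>D. op_le T b) \<longrightarrow> op_le s b)"
    using D(1,2) s(1) by blast
  then show ?thesis
    using normal unfolding normal_on_def by blast
qed

end

subsection \<open>Strong continuity of normal traces\<close>

context traced_algebra
begin

lemma
  assumes f: "f \<in> P" "positive_op f" "\<And>v. Re (cinner (f v) v) \<le> (norm v)\<^sup>2"
  shows one_minus_in_P: "(\<lambda>v. v - f v) \<in> P"
    and positive_op_one_minus: "positive_op (\<lambda>v. v - f v)"
    and \<tau>_one_minus: "\<tau> (\<lambda>v. v - f v) = \<tau> id - \<tau> f"
proof -
  show "(\<lambda>v. v - f v) \<in> P" "\<tau> (\<lambda>v. v - f v) = \<tau> id - \<tau> f"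
    using P_closed(7)[OF P_closed(2) f(1)] \<tau>_diff[OF P_closed(2) f(1)] by simp_all
  have "positive_op (\<lambda>v. id v - f v)"
    by (rule positive_op_diffI)
      (use f(3) positive_opD[OF f(2)] in \<open>simp_all add: Re_cinner_self\<close>)
  then show "positive_op (\<lambda>v. v - f v)"
    by simp
qed

text \<open>Convergence of the forms makes \<open>L\<close> the least upper bound of the directed
  family \<open>range u\<close>.\<close>

lemma \<tau>_incseq_limit_le:
  assumes u: "\<And>n. u n \<in> P" "\<And>n. positive_op (u n)"
    and mono: "\<And>n v. Re (cinner (u n v) v) \<le> Re (cinner (u (Suc n) v) v)"
    and L: "L \<in> P" "positive_op L" "\<And>v. (\<lambda>n. Re (cinner (u n v) v)) \<longlonglongrightarrow> Re (cinner (L v) v)"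
    and c: "\<And>n. Re (\<tau> (u n)) \<le> c"
  shows "Re (\<tau> L) \<le> c"
proof -
  have mono': "Re (cinner (u m v) v) \<le> Re (cinner (u n v) v)" if "m \<le> n" for m n v
    using lift_Suc_mono_le[of "\<lambda>n. Re (cinner (u n v) v)"] mono that by blast
  have "Re (\<tau> L) = (SUP T\<in>range u. Re (\<tau> T))"
  proof (rule \<tau>_sup)
    show "\<exists>R\<in>range u. \<forall>v. Re (cinner (S v) v) \<le> Re (cinner (R v) v) \<and>
        Re (cinner (T v) v) \<le> Re (cinner (R v) v)" if ST: "S \<in> range u" "T \<in> range u" for S T
    proof -
      obtain m n where "S = u m" "T = u n"
        using ST by blast
      then show ?thesis
        using mono'[of m "max m n"] mono'[of n "max m n"] by (intro bexI[of _ "u (max m n)"]) auto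
    qed
    show "Re (cinner (T v) v) \<le> Re (cinner (L v) v)" if "T \<in> range u" for T v
      using that incseq_le[OF incseq_SucI[of "\<lambda>n. Re (cinner (u n v) v)", OF mono] L(3)] by auto
    show "Re (cinner (L v) v) \<le> Re (cinner (b v) v)"
      if "\<And>T v. T \<in> range u \<Longrightarrow> Re (cinner (T v) v) \<le> Re (cinner (b v) v)" for b v
      by (rule LIMSEQ_le_const2[OF L(3)]) (use that in auto)
  qed (use u L in auto)
  also have "\<dots> \<le> c"
    by (rule cSUP_least) (use c in auto)
  finally show ?thesis .
qed

text \<open>The maximal annihilators \<open>F W\<close> decrease as the finite set \<open>W\<close>
  grows, and \<open>F {v} v = 0\<close>. So every upper bound of the \<open>1 - F W\<close> has form
  at least \<open>(norm v)^2\<close> at each \<open>v\<close>: their supremum is the identity, and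
  normality makes the trace of some \<open>F W\<close> small.\<close>

lemma annihilator_of_small_trace:
  assumes e: "0 < e"
  obtains W f where "finite W" "f \<in> P" "positive_op f" "Re (\<tau> f) < e"
    "\<And>k v. k \<in> P \<Longrightarrow> positive_op k \<Longrightarrow> (\<And>v. Re (cinner (k v) v) \<le> (norm v)\<^sup>2) \<Longrightarrow>
      (\<And>w. w \<in> W \<Longrightarrow> k w = 0) \<Longrightarrow> Re (cinner (k v) v) \<le> Re (cinner (f v) v)"
proof -
  have "\<exists>f. f \<in> P \<and> positive_op f \<and> (\<forall>v. Re (cinner (f v) v) \<le> (norm v)\<^sup>2) \<and> (\<forall>w\<in>W. f w = 0) \<and>
    (\<forall>k v. k \<in> P \<longrightarrow> positive_op k \<longrightarrow> (\<forall>v. Re (cinner (k v) v) \<le> (norm v)\<^sup>2) \<longrightarrow>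
      (\<forall>w\<in>W. k w = 0) \<longrightarrow> Re (cinner (k v) v) \<le> Re (cinner (f v) v))" for W
    by (rule largest_annihilator[OF P, of W]) blast
  then obtain F where F: "\<And>W. F W \<in> P" "\<And>W. positive_op (F W)"
      "\<And>W v. Re (cinner (F W v) v) \<le> (norm v)\<^sup>2" "\<And>W w. w \<in> W \<Longrightarrow> F W w = 0"
    and max: "\<And>W k v. k \<in> P \<Longrightarrow> positive_op k \<Longrightarrow> \<forall>v. Re (cinner (k v) v) \<le> (norm v)\<^sup>2 \<Longrightarrow>
      \<forall>w\<in>W. k w = 0 \<Longrightarrow> Re (cinner (k v) v) \<le> Re (cinner (F W v) v)"
    by metis
  define G where "G W = (\<lambda>v. v - F W v)" for W
  have G: "G W \<in> P" "\<tau> (G W) = \<tau> id - \<tau> (F W)" "positive_op (G W)" for W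
    unfolding G_def by (rule one_minus_in_P[OF F(1-3)] \<tau>_one_minus[OF F(1-3)]
        positive_op_one_minus[OF F(1-3)])+
  have G_form: "Re (cinner (G W v) v) = (norm v)\<^sup>2 - Re (cinner (F W v) v)" for W v
    by (simp add: G_def cinner_simps Re_cinner_self)
  have anti: "Re (cinner (F W' v) v) \<le> Re (cinner (F W v) v)" if "W \<subseteq> W'" for W W' v
    using max[of "F W'" W v] F that by blast
  define D where "D = G ` {W. finite W}"
  have "Re (\<tau> id) = (SUP T\<in>D. Re (\<tau> T))"
  proof (rule \<tau>_sup)
    show "\<exists>R\<in>D. \<forall>v. Re (cinner (S v) v) \<le> Re (cinner (R v) v) \<and>
        Re (cinner (T v) v) \<le> Re (cinner (R v) v)" if ST: "S \<in> D" "T \<in> D" for S T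
    proof -
      obtain W1 W2 where "S = G W1" "finite W1" "T = G W2" "finite W2"
        using ST unfolding D_def by blast
      then show ?thesis
        using anti[of W1 "W1 \<union> W2"] anti[of W2 "W1 \<union> W2"] unfolding D_def
        by (intro bexI[of _ "G (W1 \<union> W2)"]) (auto simp: G_form)
    qed
    show "Re (cinner (id v) v) \<le> Re (cinner (b v) v)"
      if "\<And>T v. T \<in> D \<Longrightarrow> Re (cinner (T v) v) \<le> Re (cinner (b v) v)" for b v
      using that[of "G {v}" v] F(4)[of v "{v}"] by (simp add: D_def G_form Re_cinner_self)
  qed (use G P_closed(2) positive_opD(3)[OF F(2)] in \<open>auto simp: D_def G_form Re_cinner_self\<close>)
  then have "Re (\<tau> id) - e < (SUP T\<in>D. Re (\<tau> T))"
    using e by simp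
  moreover have "D \<noteq> {}"
    by (auto simp: D_def)
  moreover have "bdd_above ((\<lambda>T. Re (\<tau> T)) ` D)"
    using \<tau>_positive[OF F(1) F(2)] by (intro bdd_aboveI[of _ "Re (\<tau> id)"]) (auto simp: D_def G)
  ultimately obtain T where "T \<in> D" "Re (\<tau> id) - e < Re (\<tau> T)"
    using less_cSUP_iff[of D "\<lambda>T. Re (\<tau> T)" "Re (\<tau> id) - e"] by blast
  then obtain W where W: "finite W" "Re (\<tau> (F W)) < e"
    by (auto simp: D_def G)
  show ?thesis
    by (rule that[OF W(1) F(1,2) W(2)], rule max) auto
qed

text \<open>A normal trace is strongly continuous at \<open>0\<close> on the positive part of the unit ball. Otherwise
  there are \<open>x n\<close> of trace at least \<open>e\<close> converging rapidly to \<open>0\<close> on the vectors \<open>w \<in> W\<close>. The sums of the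
  \<open>x n\<close> may diverge, but the operators \<open>u N M = 1 - (1 + x N + \<dots> + x (N + M))\<inverse>\<close> are bounded by \<open>1\<close>
  and increasing in \<open>M\<close>. Their suprema decrease with \<open>N\<close> to an operator of large trace that vanishes
  on \<open>W\<close>.\<close>

lemma trace_small_of_small_on_vectors:
  assumes e: "0 < e"
  obtains W d where "finite W" "0 < d"
    "\<And>x. x \<in> P \<Longrightarrow> positive_op x \<Longrightarrow> (\<And>v. Re (cinner (x v) v) \<le> (norm v)\<^sup>2) \<Longrightarrow>
      (\<And>w. w \<in> W \<Longrightarrow> Re (cinner (x w) w) \<le> d) \<Longrightarrow> Re (\<tau> x) \<le> e"
proof -
  \<comment> \<open>The contradiction will be
    \<open>e / 2 \<le> Re (\<tau> k) \<le> Re (\<tau> f) < e / 2\<close>; the other half of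
    \<open>e\<close> is lost in the truncation by resolvents.\<close>
  obtain W f where W: "finite W" and f: "f \<in> P" "positive_op f" "Re (\<tau> f) < e / 2"
    and max: "\<And>k v. k \<in> P \<Longrightarrow> positive_op k \<Longrightarrow> (\<And>v. Re (cinner (k v) v) \<le> (norm v)\<^sup>2) \<Longrightarrow>
      (\<And>w. w \<in> W \<Longrightarrow> k w = 0) \<Longrightarrow> Re (cinner (k v) v) \<le> Re (cinner (f v) v)"
    using annihilator_of_small_trace[of "e / 2"] e by (metis half_gt_zero)
  have "\<exists>d>0. \<forall>x. x \<in> P \<and> positive_op x \<and> (\<forall>v. Re (cinner (x v) v) \<le> (norm v)\<^sup>2) \<and>
      (\<forall>w\<in>W. Re (cinner (x w) w) \<le> d) \<longrightarrow> Re (\<tau> x) \<le> e"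
  proof (rule ccontr)
    assume neg: "\<not> ?thesis"
    have "\<exists>x. x \<in> P \<and> positive_op x \<and> (\<forall>v. Re (cinner (x v) v) \<le> (norm v)\<^sup>2) \<and>
      (\<forall>w\<in>W. Re (cinner (x w) w) \<le> (1/2) ^ n) \<and> e < Re (\<tau> x)" for n :: nat
    proof -
      have "0 < (1/2 :: real) ^ n"
        by simp
      then show ?thesis
        using neg by (meson not_le)
    qed
    then obtain x where x: "\<And>n. x n \<in> P" "\<And>n. positive_op (x n)"
        "\<And>n v. Re (cinner (x n v) v) \<le> (norm v)\<^sup>2" "\<And>n. e < Re (\<tau> (x n))"
      and xW: "\<And>n w. w \<in> W \<Longrightarrow> Re (cinner (x n w) w) \<le> (1/2) ^ n"
      by metis
    \<comment> \<open>A window starting at \<open>N\<close>. It grows with \<open>M\<close>, and the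
      window of length \<open>M\<close> at \<open>Suc N\<close> is part of the window of length
      \<open>Suc M\<close> at \<open>N\<close>; this is why the suprema \<open>c N\<close> decrease
      in \<open>N\<close>.\<close>
    define s where "s N M = (\<lambda>v. \<Sum>n\<in>{N..N + M}. x n v)" for N M :: nat
    have s0: "s N 0 = x N" for N
      by (simp add: s_def)
    have sSuc: "s N (Suc M) = (\<lambda>v. s N M v + x (N + Suc M) v)" for N M
      by (simp add: s_def)
    have sSuc': "s N (Suc M) = (\<lambda>v. x N v + s (Suc N) M v)" for N M
    proof -
      have "{N..N + Suc M} = insert N {Suc N..Suc N + M}"
        by auto
      then show ?thesis
        by (simp add: s_def)
    qed
    have s: "s N M \<in> P \<and> positive_op (s N M)" for N M
      by (induction M) (use x in \<open>auto simp: s0 sSuc intro: P_closed(3) positive_op_add\<close>)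
    define r where "r N M = pos_res (s N M)" for N M
    have r: "r N M \<in> P" "positive_op (r N M)" "Re (cinner (r N M v) v) \<le> (norm v)\<^sup>2" for N M v
      unfolding r_def using s von_neumann_algebra_pos_res[OF P] pos_res_positive pos_res_le_norm
      by blast+
    define u where "u N M = (\<lambda>v. v - r N M v)" for N M
    have u_form: "Re (cinner (u N M v) v) = (norm v)\<^sup>2 - Re (cinner (r N M v) v)" for N M v
      by (simp add: u_def cinner_simps Re_cinner_self)
    have u: "u N M \<in> P" "positive_op (u N M)" for N M
      unfolding u_def by (rule one_minus_in_P[OF r] positive_op_one_minus[OF r])+
    have u_le: "Re (cinner (u N M v) v) \<le> (norm v)\<^sup>2" for N M v
      using positive_opD(3)[OF r(2)] by (simp add: u_form)
    have u_mono: "Re (cinner (u N M v) v) \<le> Re (cinner (u N' M' v) v)"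
      if "\<And>v. Re (cinner (s N M v) v) \<le> Re (cinner (s N' M' v) v)" for N M N' M' v
      using pos_res_antimono[of "s N M" "s N' M'" v] s that by (simp add: u_form r_def)
    have u_Suc: "Re (cinner (u N M v) v) \<le> Re (cinner (u N (Suc M) v) v)" for N M v
      by (rule u_mono) (use positive_opD(3)[OF x(2)] in \<open>simp add: sSuc cinner_add_left\<close>)
    have u_Suc': "Re (cinner (u (Suc N) M v) v) \<le> Re (cinner (u N (Suc M) v) v)" for N M v
      by (rule u_mono) (use positive_opD(3)[OF x(2)] in \<open>simp add: sSuc' cinner_add_left\<close>)
    have "\<exists>L. L \<in> P \<and> positive_op L \<and> (\<forall>v. (\<lambda>M. Re (cinner (u N M v) v)) \<longlonglongrightarrow> Re (cinner (L v) v)) \<and>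
      (\<forall>M v. Re (cinner (u N M v) v) \<le> Re (cinner (L v) v)) \<and> (\<forall>v. Re (cinner (L v) v) \<le> (norm v)\<^sup>2)" for N
      by (rule von_neumann_algebra_incseq_limit[of P "u N"]) (use P u u_le u_Suc in blast)+
    then obtain c where c: "\<And>N. c N \<in> P" "\<And>N. positive_op (c N)"
        "\<And>N v. (\<lambda>M. Re (cinner (u N M v) v)) \<longlonglongrightarrow> Re (cinner (c N v) v)"
        "\<And>N M v. Re (cinner (u N M v) v) \<le> Re (cinner (c N v) v)"
        "\<And>N v. Re (cinner (c N v) v) \<le> (norm v)\<^sup>2"
      by metis
    have c_Suc: "Re (cinner (c (Suc N) v) v) \<le> Re (cinner (c N v) v)" for N v
      by (rule LIMSEQ_le_const2[OF c(3)]) (use order_trans[OF u_Suc' c(4)] in blast)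
    \<comment> \<open>The geometric sum of \<open>(1/2)^n\<close> from \<open>n = N\<close> on;
      \<open>s N M\<close> dominates \<open>u N M\<close>, so the bound survives the truncation and
      passes to the supremum.\<close>
    have c_W: "Re (cinner (c N w) w) \<le> 2 * (1/2) ^ N" if w: "w \<in> W" for N w
    proof (rule LIMSEQ_le_const2[OF c(3)])
      have "Re (cinner (u N M w) w) \<le> 2 * (1/2) ^ N" for M
      proof -
        have "Re (cinner (u N M w) w) \<le> Re (cinner (s N M w) w)"
          using pos_res_ge[of "s N M" w] s by (simp add: u_form r_def)
        also have "\<dots> \<le> (1/2) ^ N * (2 - (1/2) ^ M)"
        proof (induction M)
          case 0
          show ?case
            using xW[OF w, of N] by (simp add: s0)
        next
          case (Suc M)
          then show ?case
            using xW[OF w, of "N + Suc M"] by (simp add: sSuc cinner_add_left power_add algebra_simps)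
        qed
        also have "\<dots> \<le> (1/2) ^ N * 2"
          by (intro mult_left_mono) auto
        finally show ?thesis
          by simp
      qed
      then show "\<exists>K. \<forall>M\<ge>K. Re (cinner (u N M w) w) \<le> 2 * (1/2) ^ N"
        by blast
    qed
    \<comment> \<open>The first term of the window already suffices: \<open>1 - (1 + x N)^-1\<close>
      dominates half of \<open>x N\<close>.\<close>
    have tr_c: "e / 2 < Re (\<tau> (c N))" for N
    proof -
      have half: "(\<lambda>v. complex_of_real (1/2) *\<^sub>C x N v) \<in> P"
        using P_closed(4) x(1) by blast
      have "e / 2 < Re (\<tau> (\<lambda>v. complex_of_real (1/2) *\<^sub>C x N v))"
        using x(4)[of N] by (simp add: \<tau>_scaleC[OF x(1)])
      also have "\<dots> \<le> Re (\<tau> (u N 0))"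
      proof (rule \<tau>_mono[OF half _ u(1) positive_opD(2)[OF u(2)]])
        show "adj (\<lambda>v. complex_of_real (1/2) *\<^sub>C x N v) = (\<lambda>v. complex_of_real (1/2) *\<^sub>C x N v)"
          using positive_opD[OF x(2), of N] by (simp add: adj_scaleC)
        show "Re (cinner (complex_of_real (1/2) *\<^sub>C x N v) v) \<le> Re (cinner (u N 0 v) v)" for v
          using pos_res_contraction_le[OF x(2) x(3), of N v]
          by (simp add: u_form r_def s0 cinner_simps)
      qed
      also have "\<dots> \<le> Re (\<tau> (c N))"
        by (intro \<tau>_mono u c positive_opD)
      finally show ?thesis .
    qed
    \<comment> \<open>Normality concerns increasing families, so the decreasing \<open>c N\<close>
      are replaced by their complements; \<open>k\<close> below is the infimum of the
      \<open>c N\<close>.\<close>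
    define d where "d N = (\<lambda>v. v - c N v)" for N
    have d_form: "Re (cinner (d N v) v) = (norm v)\<^sup>2 - Re (cinner (c N v) v)" for N v
      by (simp add: d_def cinner_simps Re_cinner_self)
    have d: "d N \<in> P" "positive_op (d N)" "\<tau> (d N) = \<tau> id - \<tau> (c N)" for N
      unfolding d_def by (rule one_minus_in_P[OF c(1,2,5)] positive_op_one_minus[OF c(1,2,5)]
          \<tau>_one_minus[OF c(1,2,5)])+
    have d_Suc: "Re (cinner (d N v) v) \<le> Re (cinner (d (Suc N) v) v)" for N v
      using c_Suc by (simp add: d_form)
    have d_le: "Re (cinner (d N v) v) \<le> (norm v)\<^sup>2" for N v
      using positive_opD(3)[OF c(2)] by (simp add: d_form)
    obtain L where L: "L \<in> P" "positive_op L" "\<And>v. (\<lambda>N. Re (cinner (d N v) v)) \<longlonglongrightarrow> Re (cinner (L v) v)"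
        "\<And>N v. Re (cinner (d N v) v) \<le> Re (cinner (L v) v)" "\<And>v. Re (cinner (L v) v) \<le> (norm v)\<^sup>2"
      by (rule von_neumann_algebra_incseq_limit[where u = d, OF P d(1,2) d_Suc d_le]) (rule that)
    have "Re (\<tau> (d N)) \<le> Re (\<tau> id) - e / 2" for N
      using tr_c[of N] by (simp add: d)
    then have tr_L: "Re (\<tau> L) \<le> Re (\<tau> id) - e / 2"
      by (rule \<tau>_incseq_limit_le[OF d(1,2) d_Suc L(1-3)])
    define k where "k = (\<lambda>v. v - L v)"
    have k_form: "Re (cinner (k v) v) = (norm v)\<^sup>2 - Re (cinner (L v) v)" for v
      by (simp add: k_def cinner_simps Re_cinner_self)
    have k: "k \<in> P" "positive_op k" "\<tau> k = \<tau> id - \<tau> L"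
      unfolding k_def by (rule one_minus_in_P[OF L(1,2,5)] positive_op_one_minus[OF L(1,2,5)]
          \<tau>_one_minus[OF L(1,2,5)])+
    have k_le: "Re (cinner (k v) v) \<le> (norm v)\<^sup>2" for v
      using positive_opD(3)[OF L(2)] by (simp add: k_form)
    have "k w = 0" if w: "w \<in> W" for w
    proof -
      have lim: "(\<lambda>N. 2 * (1/2 :: real) ^ N) \<longlonglongrightarrow> 2 * 0"
        by (intro tendsto_intros LIMSEQ_power_zero) auto
      have "Re (cinner (k w) w) \<le> 2 * (1/2) ^ N" for N
        using L(4)[of N w] c_W[OF w, of N] by (simp add: k_form d_form)
      then have "\<exists>K. \<forall>N\<ge>K. Re (cinner (k w) w) \<le> 2 * (1/2) ^ N"
        by blast
      with lim have "Re (cinner (k w) w) \<le> 2 * 0"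
        by (rule LIMSEQ_le_const)
      then have "(norm (k w))\<^sup>2 \<le> 0"
        using positive_contraction_norm[OF k(2) k_le, of w] by linarith
      then show ?thesis
        by simp
    qed
    then have "Re (cinner (k v) v) \<le> Re (cinner (f v) v)" for v
      using max k(1,2) k_le by blast
    then have "Re (\<tau> k) \<le> Re (\<tau> f)"
      by (intro \<tau>_mono k f positive_opD)
    then show False
      using tr_L f(3) k(3) by simp
  qed
  then obtain d where d: "0 < d" "\<And>x. x \<in> P \<and> positive_op x \<and> (\<forall>v. Re (cinner (x v) v) \<le> (norm v)\<^sup>2) \<and>
      (\<forall>w\<in>W. Re (cinner (x w) w) \<le> d) \<Longrightarrow> Re (\<tau> x) \<le> e"
    by auto
  show ?thesis
    by (rule that[OF W d(1)], rule d(2)) simp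
qed

section \<open>The squared norm of the trace\<close>

definition sqnorm2 :: "('h \<Rightarrow> 'h) \<Rightarrow> real" where
  "sqnorm2 b = Re (\<tau> (adj b \<circ> b))"

lemma adj_comp_in_P: "b \<in> P \<Longrightarrow> c \<in> P \<Longrightarrow> adj b \<circ> c \<in> P"
  using P_closed(5,6) by blast

lemma sqnorm2_nonneg: "b \<in> P \<Longrightarrow> 0 \<le> sqnorm2 b"
  unfolding sqnorm2_def using \<tau>_positive[OF adj_comp_in_P positive_op_adj_comp] P_closed(1) by blast

lemma sqnorm2_eq_0:
  assumes b: "b \<in> P" "sqnorm2 b = 0"
  shows "b = (\<lambda>v. 0)"
proof -
  have "\<tau> (adj b \<circ> b) \<in> \<real>"
    using \<tau>_positive[OF adj_comp_in_P positive_op_adj_comp] P_closed(1) b(1) by blast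
  then have "\<tau> (adj b \<circ> b) = 0"
    using b(2) unfolding sqnorm2_def by (simp add: complex_is_Real_iff complex_eq_iff)
  then show ?thesis
    using faithful b(1) unfolding faithful_on_def by blast
qed

lemma sqnorm2_add:
  assumes b: "b \<in> P" and c: "c \<in> P"
  shows "sqnorm2 (\<lambda>v. b v + c v) = sqnorm2 b + 2 * Re (\<tau> (adj b \<circ> c)) + sqnorm2 c"
proof -
  have bd: "b \<in> bounded_ops" "c \<in> bounded_ops" "adj b \<in> bounded_ops" "adj c \<in> bounded_ops"
    using b c P_closed(1,6) by blast+
  have "adj (\<lambda>v. b v + c v) \<circ> (\<lambda>v. b v + c v) =
      (\<lambda>v. ((adj b \<circ> b) v + (adj b \<circ> c) v) + ((adj c \<circ> b) v + (adj c \<circ> c) v))"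
    using bd by (auto simp: adj_add bounded_opsD)
  moreover have "adj c \<circ> b = adj (adj b \<circ> c)"
    using bd by (simp add: adj_comp adj_adj)
  ultimately show ?thesis
    unfolding sqnorm2_def using b c
    by (simp add: \<tau>_add \<tau>_adj adj_comp_in_P P_closed(3,6) del: comp_apply)
qed

lemma sqnorm2_uminus: "b \<in> P \<Longrightarrow> sqnorm2 (\<lambda>v. - b v) = sqnorm2 b"
proof -
  assume "b \<in> P"
  then have b: "b \<in> bounded_ops" "adj b \<in> bounded_ops"
    using P_closed(1,6) by blast+
  have "adj (\<lambda>v. - b v) = (\<lambda>v. - adj b v)"
    using adj_scaleC[OF b(1), of "- 1"] by (simp add: scaleC_minus_left)
  then have "adj (\<lambda>v. - b v) \<circ> (\<lambda>v. - b v) = adj b \<circ> b"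
    using b by (auto simp: bounded_opsD)
  then show ?thesis
    by (simp add: sqnorm2_def)
qed

lemma uminus_in_P: "b \<in> P \<Longrightarrow> (\<lambda>v. - b v) \<in> P"
  using P_closed(4)[of b "- 1"] by (simp add: scaleC_minus_left)

text \<open>Nonnegativity of \<open>sqnorm2\<close> at \<open>b - c\<close> bounds the cross term.
  Keeping squares makes this a substitute for the triangle inequality that needs no
  Cauchy-Schwarz.\<close>

lemma sqnorm2_add_le:
  assumes b: "b \<in> P" and c: "c \<in> P"
  shows "sqnorm2 (\<lambda>v. b v + c v) \<le> 2 * sqnorm2 b + 2 * sqnorm2 c"
proof -
  have bd: "adj b \<in> bounded_ops" "c \<in> bounded_ops"
    using b c P_closed(1,6) by blast+
  have "0 \<le> sqnorm2 (\<lambda>v. b v + - c v)"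
    by (intro sqnorm2_nonneg P_closed(3) b uminus_in_P c)
  also have "\<dots> = sqnorm2 b + 2 * Re (\<tau> (adj b \<circ> (\<lambda>v. - c v))) + sqnorm2 c"
    by (simp only: sqnorm2_add[OF b uminus_in_P[OF c]] sqnorm2_uminus[OF c])
  also have "adj b \<circ> (\<lambda>v. - c v) = (\<lambda>v. (- 1) *\<^sub>C (adj b \<circ> c) v)"
    using bd by (auto simp: bounded_opsD scaleC_minus_left)
  finally show ?thesis
    using sqnorm2_add[OF b c] \<tau>_scaleC[OF adj_comp_in_P[OF b c], of "- 1"] by simp
qed

text \<open>The bound \<open>2\<close> is the one for a difference of two contractions. Then
  \<open>adj b \<circ> b\<close> is at most \<open>4\<close>, so a quarter of it is a positive
  contraction, to which the trace estimate applies with \<open>e / 4\<close>.\<close>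

lemma sqnorm2_small_of_small_on_vectors:
  assumes e: "0 < e"
  obtains W d where "finite W" "0 < d"
    "\<And>b. b \<in> P \<Longrightarrow> (\<And>v. norm (b v) \<le> 2 * norm v) \<Longrightarrow> (\<And>w. w \<in> W \<Longrightarrow> norm (b w) \<le> d) \<Longrightarrow>
      sqnorm2 b \<le> e"
proof -
  have "0 < e / 4"
    using e by simp
  then obtain W d where W: "finite W" and d: "0 < d"
    and small: "\<And>x. x \<in> P \<Longrightarrow> positive_op x \<Longrightarrow> (\<And>v. Re (cinner (x v) v) \<le> (norm v)\<^sup>2) \<Longrightarrow>
      (\<And>w. w \<in> W \<Longrightarrow> Re (cinner (x w) w) \<le> d) \<Longrightarrow> Re (\<tau> x) \<le> e / 4"
    using trace_small_of_small_on_vectors by metis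
  have "sqnorm2 b \<le> e"
    if b: "b \<in> P" "\<And>v. norm (b v) \<le> 2 * norm v" "\<And>w. w \<in> W \<Longrightarrow> norm (b w) \<le> sqrt d" for b
  proof -
    have bd: "b \<in> bounded_ops" "adj b \<circ> b \<in> bounded_ops"
      using b(1) P_closed(1) adj_comp_in_P by blast+
    define x where "x = (\<lambda>v. complex_of_real (1/4) *\<^sub>C (adj b \<circ> b) v)"
    have form: "Re (cinner (x v) v) = (norm (b v))\<^sup>2 / 4" for v
      by (simp add: x_def cinner_scaleC_left cinner_adj_left[OF bd(1)] Re_cinner_self)
    have "x \<in> P"
      unfolding x_def by (intro P_closed(4) adj_comp_in_P b)
    moreover have "positive_op x"
    proof (rule positive_opI)
      show "x \<in> bounded_ops"
        unfolding x_def by (intro bounded_ops_scaleC bd)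
      show "adj x = x"
        unfolding x_def using adj_scaleC[OF bd(2), of "1/4"] positive_opD(2)[OF positive_op_adj_comp[OF bd(1)]]
        by simp
    qed (simp add: form)
    moreover have "Re (cinner (x v) v) \<le> (norm v)\<^sup>2" for v
      using power_mono[OF b(2), of v 2] by (simp add: form power_mult_distrib)
    moreover have "Re (cinner (x w) w) \<le> d" if "w \<in> W" for w
      using power_mono[OF b(3)[OF that], of 2] d by (simp add: form)
    ultimately have "Re (\<tau> x) \<le> e / 4"
      by (rule small)
    moreover have "\<tau> x = complex_of_real (1/4) * \<tau> (adj b \<circ> b)"
      unfolding x_def by (rule \<tau>_scaleC[OF adj_comp_in_P[OF b(1) b(1)]])
    ultimately show ?thesis
      by (simp add: sqnorm2_def)
  qed
  moreover have "0 < sqrt d"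
    using d by simp
  ultimately show ?thesis
    using that[OF W] by blast
qed

text \<open>The resolvents \<open>(a + i)\<inverse>\<close> are bounded even when the approximants \<open>a\<close> are not, and converge
  strongly when the \<open>a\<close> do.\<close>

lemma sqnorm2_cayley_res_diff_small:
  assumes e: "0 < e"
  obtains W d where "finite W" "0 < d"
    "\<And>a b. a \<in> P \<Longrightarrow> adj a = a \<Longrightarrow> b \<in> P \<Longrightarrow> adj b = b \<Longrightarrow>
      \<forall>w\<in>W. norm (a (cayley_res b w) - b (cayley_res b w)) \<le> d \<Longrightarrow>
      sqnorm2 (\<lambda>v. cayley_res a v - cayley_res b v) \<le> e"
proof -
  obtain W d where W: "finite W" and d: "0 < d"
    and small: "\<And>b. b \<in> P \<Longrightarrow> (\<And>v. norm (b v) \<le> 2 * norm v) \<Longrightarrow> (\<And>w. w \<in> W \<Longrightarrow> norm (b w) \<le> d) \<Longrightarrow>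
      sqnorm2 b \<le> e"
    using sqnorm2_small_of_small_on_vectors[OF e] by metis
  have le_e: "sqnorm2 (\<lambda>v. cayley_res a v - cayley_res b v) \<le> e"
    if ab: "a \<in> P" "adj a = a" "b \<in> P" "adj b = b"
      and le: "\<forall>w\<in>W. norm (a (cayley_res b w) - b (cayley_res b w)) \<le> d" for a b
  proof (rule small)
    note bd = P_closed(1)[OF ab(1)] P_closed(1)[OF ab(3)]
    show "(\<lambda>v. cayley_res a v - cayley_res b v) \<in> P"
      using ab bd von_neumann_algebra_cayley_res_iff[OF P] by (intro P_closed(7)) auto
    show "norm (cayley_res a v - cayley_res b v) \<le> 2 * norm v" for v
      using norm_triangle_ineq4[of "cayley_res a v" "cayley_res b v"]
        norm_cayley_res_le[OF bd(1) ab(2), of v] norm_cayley_res_le[OF bd(2) ab(4), of v] by simp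
    show "norm (cayley_res a w - cayley_res b w) \<le> d" if "w \<in> W" for w
      using norm_cayley_res_diff_le[OF bd(1) ab(2) bd(2) ab(4), of w] le that by fastforce
  qed
  show ?thesis
    by (rule that[OF W d le_e])
qed

end

subsection \<open>Crossed products\<close>

lemma cayley_res_inj:
  assumes a: "a \<in> bounded_ops" "adj a = a" and b: "b \<in> bounded_ops" "adj b = b"
    and eq: "cayley_res a = cayley_res b"
  shows "a = b"
proof
  fix v
  have "cayley_res b (a v + \<i> *\<^sub>C v) = v"
    using cayley_res_left[OF a, of v] eq by simp
  then show "a v = b v"
    using cayley_res_right[OF b, of "a v + \<i> *\<^sub>C v"] by simp
qed

section \<open>Translations\<close>

lemma summable_on_translation:
  fixes f :: "'g :: group_add \<Rightarrow> real"
  shows "(\<lambda>g. f (h + g)) summable_on UNIV \<longleftrightarrow> f summable_on UNIV"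
  by (rule summable_on_reindex_bij_betw) (rule bij_betw_byWitness[where f' = "\<lambda>g. - h + g"], auto simp: add.assoc[symmetric])

lemma Rep_translation: "Rep_ell2 (translation h \<xi>) g = Rep_ell2 \<xi> (- h + g)"
proof -
  have "(\<lambda>g. (norm (Rep_ell2 \<xi> (- h + g)))\<^sup>2) summable_on UNIV"
    unfolding summable_on_translation[of "\<lambda>g. (norm (Rep_ell2 \<xi> g))\<^sup>2"]
    using Rep_ell2[of \<xi>] by simp
  then show ?thesis
    by (simp add: translation_def Abs_ell2_inverse)
qed

lemma cinner_translation: "cinner (translation h \<xi>) \<eta> = cinner \<xi> (translation (- h) \<eta>)"
proof -
  have "cinner (translation h \<xi>) \<eta> = (\<Sum>\<^sub>\<infinity>g. cinner (Rep_ell2 \<xi> (- h + g)) (Rep_ell2 \<eta> (h + (- h + g))))"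
    unfolding cinner_ell2_def by (simp add: Rep_translation add.assoc[symmetric])
  also have "\<dots> = (\<Sum>\<^sub>\<infinity>g. cinner (Rep_ell2 \<xi> g) (Rep_ell2 \<eta> (h + g)))"
    by (rule infsum_reindex_bij_betw[where f = "\<lambda>g. cinner (Rep_ell2 \<xi> g) (Rep_ell2 \<eta> (h + g))"])
      (rule bij_betw_byWitness[where f' = "\<lambda>g. h + g"], auto simp: add.assoc[symmetric])
  finally show ?thesis
    unfolding cinner_ell2_def by (simp add: Rep_translation)
qed

lemma translation_translation: "translation g (translation h \<xi>) = translation (g + h) \<xi>"
  by (rule ell2_eqI) (simp only: Rep_translation minus_add add.assoc)

lemma translation_0 [simp]: "translation 0 \<xi> = \<xi>"
  by (rule ell2_eqI) (simp add: Rep_translation)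

lemma translation_bounded_ops: "translation h \<in> bounded_ops"
proof (rule bounded_opsI[where K = 1])
  show "norm (translation h \<xi>) \<le> 1 * norm \<xi>" for \<xi>
  proof -
    have "cinner (translation h \<xi>) (translation h \<xi>) = cinner \<xi> \<xi>"
      by (simp add: cinner_translation translation_translation)
    then show ?thesis
      by (simp add: norm_eq_sqrt_cinner)
  qed
qed (auto intro!: ell2_eqI simp: Rep_translation)

lemma adj_translation: "adj (translation h) = translation (- h)"
  by (rule adj_unique) (rule cinner_translation)

lemma translation_single: "translation h (single_ell2 k v) = single_ell2 (h + k) v"
proof (rule ell2_eqI)
  fix g
  have "- h + g = k \<longleftrightarrow> g = h + k"
    by (metis add.assoc add.left_inverse add.right_inverse add_0)
  then show "Rep_ell2 (translation h (single_ell2 k v)) g = Rep_ell2 (single_ell2 (h + k) v) g"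
    by (simp add: Rep_translation Rep_single)
qed

lemma entry_comp_translation: "entry (X \<circ> translation k) g h = entry X g (k + h)"
  by (rule ext) (simp add: entry_def translation_single)

lemma entry_translation: "entry (translation k) g h v = (if g = k + h then v else 0)"
  by (simp add: entry_def translation_single Rep_single)

definition crossed_gens ::
  "('g :: group_add \<Rightarrow> ('h :: chilbert_space \<Rightarrow> 'h) \<Rightarrow> 'h \<Rightarrow> 'h) \<Rightarrow>
    ('h \<Rightarrow> 'h) set \<Rightarrow> (('g, 'h) ell2 \<Rightarrow> ('g, 'h) ell2) set" where
  "crossed_gens \<sigma> A = alg_embed \<sigma> ` A \<union> range translation"

section \<open>Trace preserving actions and the embedding of the algebra\<close>

locale traced_action = traced_algebra P \<tau>
  for P :: "('h :: chilbert_space \<Rightarrow> 'h) set" and \<tau> :: "('h \<Rightarrow> 'h) \<Rightarrow> complex" +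
  fixes \<sigma> :: "'g :: group_add \<Rightarrow> ('h \<Rightarrow> 'h) \<Rightarrow> ('h \<Rightarrow> 'h)"
  assumes action: "trace_preserving_action \<sigma> P \<tau>"
begin

lemma \<sigma>_in_P: "T \<in> P \<Longrightarrow> \<sigma> g T \<in> P"
  and \<sigma>_add: "S \<in> P \<Longrightarrow> T \<in> P \<Longrightarrow> \<sigma> g (\<lambda>v. S v + T v) = (\<lambda>v. \<sigma> g S v + \<sigma> g T v)"
  and \<sigma>_scaleC: "T \<in> P \<Longrightarrow> \<sigma> g (\<lambda>v. c *\<^sub>C T v) = (\<lambda>v. c *\<^sub>C \<sigma> g T v)"
  and \<sigma>_comp: "S \<in> P \<Longrightarrow> T \<in> P \<Longrightarrow> \<sigma> g (S \<circ> T) = \<sigma> g S \<circ> \<sigma> g T"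
  and \<sigma>_adj: "T \<in> P \<Longrightarrow> \<sigma> g (adj T) = adj (\<sigma> g T)"
  and \<sigma>_0: "T \<in> P \<Longrightarrow> \<sigma> 0 T = T"
  and \<sigma>_plus: "T \<in> P \<Longrightarrow> \<sigma> (g + h) T = \<sigma> g (\<sigma> h T)"
  and \<tau>_\<sigma>: "T \<in> P \<Longrightarrow> \<tau> (\<sigma> g T) = \<tau> T"
  using action unfolding trace_preserving_action_def star_automorphism_def linear_map_on_def
  by (blast dest: bij_betw_apply)+

lemma \<sigma>_diff: "S \<in> P \<Longrightarrow> T \<in> P \<Longrightarrow> \<sigma> g (\<lambda>v. S v - T v) = (\<lambda>v. \<sigma> g S v - \<sigma> g T v)"
  using \<sigma>_add[of S "\<lambda>v. (- 1) *\<^sub>C T v" g] \<sigma>_scaleC[of T g "- 1"] P_closed(4)[of T "- 1"]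
  by (simp add: scaleC_minus_left)

lemma \<sigma>_inverse: "T \<in> P \<Longrightarrow> \<sigma> g (\<sigma> (- g) T) = T"
  using \<sigma>_plus[of T g "- g"] \<sigma>_0[of T] by simp

text \<open>Unitality is not part of \<open>star_automorphism\<close>; it holds because
  \<open>id\<close> is itself a value of \<open>\<sigma> g\<close>, on which
  \<open>\<sigma> g id\<close> acts as a left unit.\<close>

lemma \<sigma>_id: "\<sigma> g id = id"
  using \<sigma>_comp[OF P_closed(2) \<sigma>_in_P[OF P_closed(2)], of g "- g"] \<sigma>_inverse[OF P_closed(2), of g]
  by simp

lemma \<sigma>_zero: "\<sigma> g (\<lambda>v. 0) = (\<lambda>v. 0)"
  using \<sigma>_scaleC[OF P_closed(2), of g 0] by simp

lemma zero_in_P: "(\<lambda>v. 0) \<in> P"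
  using P_closed(4)[OF P_closed(2), of 0] by simp

text \<open>If \<open>\<parallel>\<sigma> g T\<parallel> = k > C \<ge> \<parallel>T\<parallel>\<close>, then \<open>k\<^sup>2 - T\<^sup>* T\<close> is invertible in \<open>P\<close>, but its image under \<open>\<sigma> g\<close>
  is not bounded from below.\<close>

lemma norm_\<sigma>_le:
  assumes T: "T \<in> P" and C: "0 \<le> C" "\<And>v. norm (T v) \<le> C * norm v"
  shows "norm (\<sigma> g T v) \<le> C * norm v"
proof -
  define S where "S = \<sigma> g T"
  have Sb: "S \<in> bounded_ops" and Tb: "T \<in> bounded_ops"
    using T \<sigma>_in_P P_closed(1) S_def by blast+
  note lin = bounded_opsD(1)[OF Sb]
  define k where "k = onorm S"
  have S_le: "norm (S v) \<le> k * norm v" for v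
    unfolding k_def by (rule onorm[OF lin])
  have "k \<le> C"
  proof (rule ccontr)
    assume "\<not> k \<le> C"
    then have k: "C < k" "0 < k"
      using C(1) by auto
    define c where "c = k\<^sup>2"
    have c: "C\<^sup>2 < c" "0 < c"
      using k C(1) by (auto simp: c_def power_strict_mono)
    define B where "B U = (\<lambda>v. complex_of_real c *\<^sub>C id v - (adj U \<circ> U) v)" for U :: "'h \<Rightarrow> 'h"
    have TT: "adj T \<circ> T \<in> P" and cid: "(\<lambda>v. complex_of_real c *\<^sub>C id v) \<in> P"
      by (intro adj_comp_in_P T, intro P_closed(2,4))
    then have BT: "B T \<in> P"
      unfolding B_def by (rule P_closed(7)[rotated])
    have BTb: "B T \<in> bounded_ops"
      using BT P_closed(1) by blast
    have adjB: "adj (B T) = B T"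
    proof -
      have "adj (\<lambda>v. complex_of_real c *\<^sub>C id v) = (\<lambda>v :: 'h. complex_of_real c *\<^sub>C id v)"
        using adj_scaleC[OF bounded_ops_id(1), of "complex_of_real c"] by simp
      then show ?thesis
        unfolding B_def adj_diff[OF P_closed(1)[OF cid] P_closed(1)[OF TT]]
          positive_opD(2)[OF positive_op_adj_comp[OF Tb]] by simp
    qed
    have "norm v \<le> (1 / (c - C\<^sup>2)) * norm (B T v)" for v
    proof -
      have "(norm (T v))\<^sup>2 \<le> C\<^sup>2 * (norm v)\<^sup>2"
        using power_mono[OF C(2), of v 2] by (simp add: power_mult_distrib)
      moreover have "Re (cinner (B T v) v) = c * (norm v)\<^sup>2 - (norm (T v))\<^sup>2"
        by (simp add: B_def cinner_diff_left cinner_scaleC_left cinner_adj_left[OF Tb] Re_cinner_self)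
      ultimately have "(c - C\<^sup>2) * (norm v)\<^sup>2 \<le> norm (B T v) * norm v"
        using Re_cinner_le[of "B T v" v] by (simp add: algebra_simps)
      then have "(c - C\<^sup>2) * norm v \<le> norm (B T v)"
        by (cases "v = 0") (auto simp: power2_eq_square)
      then show ?thesis
        using c by (simp add: field_simps)
    qed
    note inv = inverse_of_bounded_below[OF BTb this, unfolded adjB, OF this]
    have R: "inv (B T) \<in> P"
      by (rule von_neumann_algebra_inverse[OF P BT inv(1)]) (auto simp: fun_eq_iff inv(2,3))
    have "\<sigma> g (B T) = B S"
      unfolding B_def \<sigma>_diff[OF cid TT] \<sigma>_scaleC[OF P_closed(2)] \<sigma>_id
        \<sigma>_comp[OF P_closed(6)[OF T] T] \<sigma>_adj[OF T] S_def ..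
    moreover have "\<sigma> g (inv (B T)) \<circ> \<sigma> g (B T) = id"
      unfolding \<sigma>_comp[OF R BT, symmetric] using inv(2) \<sigma>_id[of g] by (simp add: comp_def id_def)
    ultimately have left: "\<sigma> g (inv (B T)) (B S v) = v" for v
      by (metis comp_apply id_apply)
    obtain K where K: "0 \<le> K" "\<And>v. norm (\<sigma> g (inv (B T)) v) \<le> K * norm v"
      using bounded_ops_bound[OF P_closed(1)[OF \<sigma>_in_P[OF R]]] by metis
    have adjS: "norm (adj S u) \<le> k * norm u" for u
    proof -
      have "(norm (adj S u))\<^sup>2 = Re (cinner (S (adj S u)) u)"
        by (simp add: cinner_adj_right[OF Sb, symmetric] Re_cinner_self)
      also have "\<dots> \<le> k * norm (adj S u) * norm u"
        using Re_cinner_le[of "S (adj S u)" u] mult_right_mono[OF S_le[of "adj S u"], of "norm u"] by simp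
      finally have "norm (adj S u) * norm (adj S u) \<le> norm (adj S u) * (k * norm u)"
        by (simp add: power2_eq_square mult_ac)
      then show ?thesis
        using k by (cases "adj S u = 0") auto
    qed
    define K' where "K' = K\<^sup>2 + 1"
    have K': "0 < K'" "K\<^sup>2 \<le> K'"
      by (auto simp: K'_def add_nonneg_pos)
    \<comment> \<open>Invertibility bounds \<open>norm v\<close> by \<open>norm (B S v)\<close> from
      above, while \<open>(norm (B S v))^2\<close> is at most
      \<open>c * (c * (norm v)^2 - (norm (S v))^2)\<close>. Solving for \<open>norm (S v)\<close>
      gives the constant \<open>c - 1 / (K' * c)\<close>, strictly below \<open>c = k^2\<close>. The
      \<open>1\<close> in \<open>K'\<close> covers \<open>K = 0\<close>, and \<open>max 0\<close>
      makes the square root legitimate.\<close>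
    define q where "q = max 0 (c - 1 / (K' * c))"
    have q: "0 \<le> q" "q < c"
      using c K' by (auto simp: q_def)
    have S_le_q: "norm (S v) \<le> sqrt q * norm v" for v
    proof -
      have "(norm (B S v))\<^sup>2 = c\<^sup>2 * (norm v)\<^sup>2 - 2 * c * (norm (S v))\<^sup>2 + (norm (adj S (S v)))\<^sup>2"
        unfolding B_def norm_diff_sq comp_apply id_apply
        by (simp add: norm_scaleC power_mult_distrib cinner_scaleC_left cinner_adj_right[OF Sb]
            bounded_opsD(3)[OF Sb] Re_cinner_self)
      also have "(norm (adj S (S v)))\<^sup>2 \<le> c * (norm (S v))\<^sup>2"
        using power_mono[OF adjS, of "S v" 2] by (simp add: power_mult_distrib c_def)
      finally have "(norm (B S v))\<^sup>2 \<le> c * (c * (norm v)\<^sup>2 - (norm (S v))\<^sup>2)"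
        by (simp add: algebra_simps power2_eq_square)
      moreover have "(norm v)\<^sup>2 \<le> K' * (norm (B S v))\<^sup>2"
      proof -
        have "(norm v)\<^sup>2 \<le> (K * norm (B S v))\<^sup>2"
          using K(2)[of "B S v"] left[of v] by (intro power_mono) auto
        also have "\<dots> \<le> K' * (norm (B S v))\<^sup>2"
          using K' by (simp add: power_mult_distrib mult_right_mono)
        finally show ?thesis .
      qed
      ultimately have "(norm v)\<^sup>2 \<le> K' * (c * (c * (norm v)\<^sup>2 - (norm (S v))\<^sup>2))"
        using K' by (meson less_imp_le mult_left_mono order_trans)
      then have "(norm (S v))\<^sup>2 \<le> (c - 1 / (K' * c)) * (norm v)\<^sup>2"
        using K' c by (simp add: field_simps)
      also have "\<dots> \<le> q * (norm v)\<^sup>2"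
        by (intro mult_right_mono) (auto simp: q_def)
      also have "\<dots> = (sqrt q * norm v)\<^sup>2"
        using q by (simp add: power_mult_distrib)
      finally show ?thesis
        using q by (meson mult_nonneg_nonneg norm_ge_zero power2_le_imp_le real_sqrt_ge_zero)
    qed
    have "k \<le> sqrt q"
      unfolding k_def using q(1) by (intro onorm_bound S_le_q) simp
    then have "k\<^sup>2 \<le> (sqrt q)\<^sup>2"
      using k by (intro power_mono) auto
    then show False
      using q by (simp add: c_def)
  qed
  then show ?thesis
    using S_le[of v] mult_right_mono[of k C "norm v"] by (simp add: S_def)
qed

lemma uniformly_bounded_\<sigma>:
  assumes T: "T \<in> P"
  obtains K where "uniformly_bounded (\<lambda>g. \<sigma> (- g) T) K"
proof -
  obtain K where K: "0 \<le> K" "\<And>v. norm (T v) \<le> K * norm v"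
    using bounded_ops_bound[OF P_closed(1)[OF T]] by metis
  have "uniformly_bounded (\<lambda>g. \<sigma> (- g) T) K"
    using norm_\<sigma>_le[OF T K] P_closed(1)[OF \<sigma>_in_P[OF T]] by unfold_locales
  then show ?thesis
    by (rule that)
qed

lemma alg_embed_diag_op: "alg_embed \<sigma> T = diag_op (\<lambda>g. \<sigma> (- g) T)"
  by (rule ext) (simp add: alg_embed_def diag_op_def)

lemma
  assumes T: "T \<in> P"
  shows Rep_alg_embed: "Rep_ell2 (alg_embed \<sigma> T \<xi>) g = \<sigma> (- g) T (Rep_ell2 \<xi> g)"
    and alg_embed_bounded_ops: "alg_embed \<sigma> T \<in> bounded_ops"
    and alg_embed_single: "alg_embed \<sigma> T (single_ell2 g v) = single_ell2 g (\<sigma> (- g) T v)"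
    and entry_alg_embed: "entry (alg_embed \<sigma> T) g h v = (if g = h then \<sigma> (- g) T v else 0)"
    and adj_alg_embed: "adj (alg_embed \<sigma> T) = alg_embed \<sigma> (adj T)"
    and alg_embed_commute_iff: "S \<in> bounded_ops \<Longrightarrow> alg_embed \<sigma> T \<circ> S = S \<circ> alg_embed \<sigma> T \<longleftrightarrow>
      (\<forall>g h v. \<sigma> (- g) T (entry S g h v) = entry S g h (\<sigma> (- h) T v))"
proof -
  obtain K where K: "uniformly_bounded (\<lambda>g. \<sigma> (- g) T) K"
    using uniformly_bounded_\<sigma>[OF T] by metis
  obtain K' where "uniformly_bounded (\<lambda>g. \<sigma> (- g) (adj T)) K'"
    using uniformly_bounded_\<sigma>[OF P_closed(6)[OF T]] by metis
  then have K': "uniformly_bounded (\<lambda>g. adj (\<sigma> (- g) T)) K'"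
    by (simp add: \<sigma>_adj[OF T])
  interpret uniformly_bounded "\<lambda>g. \<sigma> (- g) T" K
    by fact
  show "Rep_ell2 (alg_embed \<sigma> T \<xi>) g = \<sigma> (- g) T (Rep_ell2 \<xi> g)" "alg_embed \<sigma> T \<in> bounded_ops"
    "alg_embed \<sigma> T (single_ell2 g v) = single_ell2 g (\<sigma> (- g) T v)"
    "entry (alg_embed \<sigma> T) g h v = (if g = h then \<sigma> (- g) T v else 0)"
    unfolding alg_embed_diag_op by (rule Rep_diag_op diag_op_bounded_ops diag_op_single entry_diag_op)+
  show "adj (alg_embed \<sigma> T) = alg_embed \<sigma> (adj T)"
    unfolding alg_embed_diag_op adj_diag_op[OF K'] \<sigma>_adj[OF T] ..
  show "alg_embed \<sigma> T \<circ> S = S \<circ> alg_embed \<sigma> T \<longleftrightarrow>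
      (\<forall>g h v. \<sigma> (- g) T (entry S g h v) = entry S g h (\<sigma> (- h) T v))" if "S \<in> bounded_ops"
    unfolding alg_embed_diag_op by (rule diag_op_commute_iff[OF that])
qed

lemma entry_alg_embed_0: "T \<in> P \<Longrightarrow> entry (alg_embed \<sigma> T) 0 0 = T"
  by (rule ext) (simp add: entry_alg_embed \<sigma>_0)

lemma alg_embed_comp:
  assumes "S \<in> P" "T \<in> P"
  shows "alg_embed \<sigma> (S \<circ> T) = alg_embed \<sigma> S \<circ> alg_embed \<sigma> T"
  by (rule ext, rule ell2_eqI) (simp add: Rep_alg_embed assms P_closed(5)[OF assms] \<sigma>_comp)

lemma alg_embed_add:
  assumes "S \<in> P" "T \<in> P"
  shows "alg_embed \<sigma> (\<lambda>v. S v + T v) = (\<lambda>\<xi>. alg_embed \<sigma> S \<xi> + alg_embed \<sigma> T \<xi>)"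
  by (rule ext, rule ell2_eqI) (simp add: Rep_alg_embed assms P_closed(3)[OF assms] \<sigma>_add)

lemma alg_embed_scaleC:
  assumes "T \<in> P"
  shows "alg_embed \<sigma> (\<lambda>v. c *\<^sub>C T v) = (\<lambda>\<xi>. c *\<^sub>C alg_embed \<sigma> T \<xi>)"
  by (rule ext, rule ell2_eqI) (simp add: Rep_alg_embed assms P_closed(4)[OF assms] \<sigma>_scaleC)

lemma alg_embed_id: "alg_embed \<sigma> id = id"
  by (rule ext, rule ell2_eqI) (simp add: Rep_alg_embed P_closed(2) \<sigma>_id)

lemma translation_alg_embed:
  assumes "T \<in> P"
  shows "translation h (alg_embed \<sigma> T \<xi>) = alg_embed \<sigma> (\<sigma> h T) (translation h \<xi>)"
proof (rule ell2_eqI)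
  fix g
  have "\<sigma> (- (- h + g)) T = \<sigma> (- g) (\<sigma> h T)"
    by (simp add: minus_add \<sigma>_plus assms)
  then show "Rep_ell2 (translation h (alg_embed \<sigma> T \<xi>)) g =
      Rep_ell2 (alg_embed \<sigma> (\<sigma> h T) (translation h \<xi>)) g"
    by (simp add: Rep_translation Rep_alg_embed assms \<sigma>_in_P)
qed

section \<open>Generators, bicommutant and the algebraic crossed product\<close>

lemma crossed_gens_bounded: "A \<subseteq> P \<Longrightarrow> crossed_gens \<sigma> A \<subseteq> bounded_ops"
  unfolding crossed_gens_def using alg_embed_bounded_ops translation_bounded_ops by blast

lemma crossed_gens_adj:
  assumes "A \<subseteq> P" "\<And>T. T \<in> A \<Longrightarrow> adj T \<in> A" "X \<in> crossed_gens \<sigma> A"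
  shows "adj X \<in> crossed_gens \<sigma> A"
  using assms(3)
proof (unfold crossed_gens_def, elim UnE imageE)
  fix T assume "X = alg_embed \<sigma> T" "T \<in> A"
  then show "adj X \<in> alg_embed \<sigma> ` A \<union> range translation"
    using assms(1,2) adj_alg_embed by blast
qed (use adj_translation in blast)

text \<open>The generators are closed under adjoints, so their bicommutant is one of the algebras in
  the hull, and it lies in each of the others.\<close>

lemma crossed_product_bicommutant:
  assumes A: "A \<subseteq> P" "\<And>T. T \<in> A \<Longrightarrow> adj T \<in> A"
  shows "crossed_product \<sigma> A = commutant (commutant (crossed_gens \<sigma> A))"
proof
  show "crossed_product \<sigma> A \<subseteq> commutant (commutant (crossed_gens \<sigma> A))"
    unfolding crossed_product_def crossed_gens_def[symmetric]
    using bicommutant_superset[OF crossed_gens_bounded[OF A(1)]]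
      bicommutant_von_neumann_algebra[OF crossed_gens_bounded[OF A(1)] crossed_gens_adj[OF A]]
    by (rule hull_minimal)
  show "commutant (commutant (crossed_gens \<sigma> A)) \<subseteq> crossed_product \<sigma> A"
    unfolding crossed_product_def crossed_gens_def[symmetric] hull_def
  proof (rule Inter_greatest)
    fix M assume "M \<in> {t. von_neumann_algebra t \<and> crossed_gens \<sigma> A \<subseteq> t}"
    then show "commutant (commutant (crossed_gens \<sigma> A)) \<subseteq> M"
      using commutant_antimono[OF commutant_antimono] von_neumann_algebraD(3) by blast
  qed
qed

text \<open>Finite sums of coefficients times translations. Scalars need no rule of their own, being
  absorbed into \<open>a\<close>; products stay inside because a translation moves past
  \<open>alg_embed \<sigma> b\<close> at the cost of applying \<open>\<sigma> k\<close> to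
  \<open>b\<close>.\<close>

inductive_set crossed_span :: "(('g, 'h) ell2 \<Rightarrow> ('g, 'h) ell2) set" where
  base: "a \<in> P \<Longrightarrow> alg_embed \<sigma> a \<circ> translation k \<in> crossed_span"
| add: "X \<in> crossed_span \<Longrightarrow> Y \<in> crossed_span \<Longrightarrow> (\<lambda>\<xi>. X \<xi> + Y \<xi>) \<in> crossed_span"

lemma crossed_span_bounded: "X \<in> crossed_span \<Longrightarrow> X \<in> bounded_ops"
proof (induction rule: crossed_span.induct)
  case (base a k)
  then show ?case
    by (intro bounded_ops_comp alg_embed_bounded_ops translation_bounded_ops)
qed (rule bounded_ops_add)

lemma crossed_span_scaleC: "X \<in> crossed_span \<Longrightarrow> (\<lambda>\<xi>. c *\<^sub>C X \<xi>) \<in> crossed_span"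
proof (induction rule: crossed_span.induct)
  case (base a k)
  have "(\<lambda>\<xi>. c *\<^sub>C (alg_embed \<sigma> a \<circ> translation k) \<xi>) = alg_embed \<sigma> (\<lambda>v. c *\<^sub>C a v) \<circ> translation k"
    using base by (auto simp: alg_embed_scaleC)
  then show ?case
    using crossed_span.base[OF P_closed(4)[OF base]] by simp
qed (auto simp: scaleC_add_right intro: crossed_span.add)

lemma crossed_span_adj: "X \<in> crossed_span \<Longrightarrow> adj X \<in> crossed_span"
proof (induction rule: crossed_span.induct)
  case (base a k)
  have "adj (alg_embed \<sigma> a \<circ> translation k) = translation (- k) \<circ> alg_embed \<sigma> (adj a)"
    using base by (simp add: adj_comp alg_embed_bounded_ops translation_bounded_ops adj_translation adj_alg_embed)
  also have "\<dots> = alg_embed \<sigma> (\<sigma> (- k) (adj a)) \<circ> translation (- k)"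
    using translation_alg_embed[OF P_closed(6)[OF base]] by auto
  finally show ?case
    using crossed_span.base[OF \<sigma>_in_P[OF P_closed(6)[OF base]]] by metis
qed (simp add: adj_add crossed_span_bounded crossed_span.add)

lemma crossed_span_comp_base:
  assumes X: "X \<in> crossed_span" and b: "b \<in> P"
  shows "X \<circ> (alg_embed \<sigma> b \<circ> translation l) \<in> crossed_span"
  using X
proof (induction rule: crossed_span.induct)
  case (base a k)
  have "(alg_embed \<sigma> a \<circ> translation k) \<circ> (alg_embed \<sigma> b \<circ> translation l) =
      alg_embed \<sigma> (a \<circ> \<sigma> k b) \<circ> translation (k + l)"
    using base b by (auto simp: alg_embed_comp \<sigma>_in_P translation_alg_embed translation_translation)
  then show ?case
    using crossed_span.base[OF P_closed(5)[OF base \<sigma>_in_P[OF b]]] by metis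
next
  case (add X Y)
  then show ?case
    using crossed_span.add[OF add.IH] by (simp add: comp_def)
qed

lemma crossed_span_comp:
  assumes X: "X \<in> crossed_span" and Y: "Y \<in> crossed_span"
  shows "X \<circ> Y \<in> crossed_span"
  using Y
proof (induction rule: crossed_span.induct)
  case (add Y Z)
  have "X \<circ> (\<lambda>\<xi>. Y \<xi> + Z \<xi>) = (\<lambda>\<xi>. (X \<circ> Y) \<xi> + (X \<circ> Z) \<xi>)"
    using bounded_opsD(2)[OF crossed_span_bounded[OF X]] by auto
  then show ?case
    using crossed_span.add[OF add.IH] by metis
qed (rule crossed_span_comp_base[OF X])

lemma crossed_span_unital_star_algebra: "unital_star_algebra crossed_span"
proof -
  have "alg_embed \<sigma> id \<circ> translation 0 = id"
    by (auto simp: alg_embed_id)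
  then have "id \<in> crossed_span"
    using crossed_span.base[OF P_closed(2), of 0] by simp
  then show ?thesis
    unfolding unital_star_algebra_def
    by (intro conjI subsetI ballI allI crossed_span_scaleC crossed_span_adj crossed_span_comp
        crossed_span.add) (auto intro: crossed_span_bounded)
qed

lemma crossed_gens_subset_span: "crossed_gens \<sigma> P \<subseteq> crossed_span"
proof -
  have "alg_embed \<sigma> T \<in> crossed_span" if "T \<in> P" for T
    using crossed_span.base[OF that, of 0] by (simp add: comp_def)
  moreover have "translation k \<in> crossed_span" for k
    using crossed_span.base[OF P_closed(2), of k] by (simp add: alg_embed_id)
  ultimately show ?thesis
    unfolding crossed_gens_def by blast
qed

text \<open>Only the terms with \<open>k = 0\<close> reach the diagonal, where
  \<open>alg_embed \<sigma> a\<close> has the entries \<open>\<sigma> (- h) a\<close>.\<close>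

lemma crossed_span_diagonal:
  "X \<in> crossed_span \<Longrightarrow> entry X 0 0 \<in> P \<and> entry X g g = \<sigma> (- g) (entry X 0 0)"
proof (induction rule: crossed_span.induct)
  case (base a k)
  have "h = k + h \<longleftrightarrow> k = 0" for h
    by (metis add_0 add_right_cancel)
  then have "entry (alg_embed \<sigma> a \<circ> translation k) h h = (if k = 0 then \<sigma> (- h) a else (\<lambda>v. 0))" for h
    unfolding entry_comp_translation by (auto simp: entry_alg_embed[OF base] fun_eq_iff)
  then show ?case
    using base unfolding comp_def by (auto simp: \<sigma>_0 \<sigma>_zero zero_in_P)
next
  case (add X Y)
  have "entry (\<lambda>\<xi>. X \<xi> + Y \<xi>) h h = (\<lambda>v. entry X h h v + entry Y h h v)" for h
    by (rule ext) (simp add: entry_def)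
  then show ?case
    using add.IH by (simp add: \<sigma>_add P_closed(3))
qed

text \<open>The entries of the generators lie in \<open>A\<close> by invariance, so amplifications
  of elements of \<open>commutant A\<close> commute with the generators and hence with
  \<open>X\<close>; entrywise this says that \<open>entry X g h\<close> lies in the bicommutant of
  \<open>A\<close>.\<close>

lemma entry_in_subalgebra:
  assumes A: "von_neumann_algebra A" "A \<subseteq> P" "invariant_under \<sigma> A"
    and X: "X \<in> commutant (commutant (crossed_gens \<sigma> A))"
  shows "entry X g h \<in> A"
proof (rule von_neumann_algebra_memI[OF A(1)])
  have Xb: "X \<in> bounded_ops"
    using X commutantD(1) by blast
  then show "entry X g h \<in> bounded_ops"
    by (rule entry_bounded_ops)
  fix t v assume t: "t \<in> commutant A"
  note tb = commutantD(1)[OF t]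
  have comm: "amplification t \<circ> Y = Y \<circ> amplification t" if Y: "Y \<in> crossed_gens \<sigma> A" for Y
  proof (subst amplification_commute_iff[OF tb])
    show "Y \<in> bounded_ops"
      using Y crossed_gens_bounded[OF A(2)] by blast
    show "\<forall>g h v. t (entry Y g h v) = entry Y g h (t v)"
      using Y unfolding crossed_gens_def
    proof (elim UnE imageE)
      fix a assume a: "Y = alg_embed \<sigma> a" "a \<in> A"
      have "\<sigma> (- g) a \<in> A" for g
        using A(3) a(2) unfolding invariant_under_def by blast
      then show ?thesis
        using a A(2) commutantD(2)[OF t] by (auto simp: entry_alg_embed bounded_opsD[OF tb])
    qed (auto simp: entry_translation bounded_opsD[OF tb])
  qed
  have "amplification t \<in> commutant (crossed_gens \<sigma> A)"
    using comm by (intro commutantI amplification_bounded_ops[OF tb]) (metis comp_apply)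
  then have "amplification t \<circ> X = X \<circ> amplification t"
    using commutantD(2)[OF X] by auto
  then show "entry X g h (t v) = t (entry X g h v)"
    using amplification_commute_iff[OF tb Xb] by simp
qed

text \<open>Purely algebraic: \<open>\<sigma> g\<close> carries a left inverse of
  \<open>a + i\<close> to a left inverse of \<open>\<sigma> g a + i\<close>. No continuity of
  \<open>\<sigma> g\<close> enters.\<close>

lemma \<sigma>_cayley_res:
  assumes a: "a \<in> P" "adj a = a"
  shows "\<sigma> g (cayley_res a) = cayley_res (\<sigma> g a)"
proof
  fix w
  have ab: "a \<in> bounded_ops" and R: "cayley_res a \<in> P"
    using a P_closed(1) von_neumann_algebra_cayley_res_iff[OF P] by blast+
  have \<sigma>a: "\<sigma> g a \<in> bounded_ops" "adj (\<sigma> g a) = \<sigma> g a"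
    using P_closed(1)[OF \<sigma>_in_P[OF a(1)]] \<sigma>_adj[OF a(1), of g] a(2) by auto
  have i: "(\<lambda>v. \<i> *\<^sub>C id v) \<in> P"
    by (intro P_closed(2,4))
  have "cayley_res a \<circ> (\<lambda>v. a v + \<i> *\<^sub>C id v) = id"
    using cayley_res_left[OF ab a(2)] by (auto simp: fun_eq_iff)
  from arg_cong[OF this, of "\<sigma> g"]
  have "\<sigma> g (cayley_res a) \<circ> (\<lambda>v. \<sigma> g a v + \<i> *\<^sub>C id v) = id"
    by (simp only: \<sigma>_comp[OF R P_closed(3)[OF a(1) i]] \<sigma>_add[OF a(1) i] \<sigma>_scaleC[OF P_closed(2)] \<sigma>_id)
  from fun_cong[OF this, of "cayley_res (\<sigma> g a) w"]
  show "\<sigma> g (cayley_res a) w = cayley_res (\<sigma> g a) w"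
    using cayley_res_right[OF \<sigma>a, of w] by simp
qed

section \<open>Covariance of the matrix entries\<close>

lemma sqnorm2_\<sigma>: "b \<in> P \<Longrightarrow> sqnorm2 (\<sigma> g b) = sqnorm2 b"
  unfolding sqnorm2_def by (simp add: \<sigma>_adj[symmetric] \<sigma>_comp[symmetric] P_closed(6) \<tau>_\<sigma> adj_comp_in_P)

lemma invariant_P: "invariant_under \<sigma> P"
  unfolding invariant_under_def using \<sigma>_in_P by blast

text \<open>An approximant \<open>S\<close> from \<open>crossed_span\<close> has diagonal entries
  \<open>a\<close> and \<open>\<sigma> (- g) a\<close>, whose resolvents are close to those of
  \<open>x\<close> and \<open>y\<close> in \<open>sqnorm2\<close>. As \<open>\<sigma> (- g)\<close>
  preserves \<open>sqnorm2\<close> and commutes with taking resolvents, the resolvents of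
  \<open>\<sigma> (- g) x\<close> and \<open>y\<close> are arbitrarily close.\<close>

lemma diagonal_covariance_selfadjoint:
  assumes X: "X \<in> commutant (commutant (crossed_gens \<sigma> P))" "adj X = X"
  shows "entry X g g = \<sigma> (- g) (entry X 0 0)"
proof -
  define x y where "x = entry X 0 0" and "y = entry X g g"
  have Xb: "X \<in> bounded_ops"
    using X(1) commutantD(1) by blast
  have xy: "x \<in> P" "adj x = x" "y \<in> P" "adj y = y"
    unfolding x_def y_def
    using entry_in_subalgebra[OF P order_refl invariant_P X(1)] entry_adj[OF Xb] X(2) by metis+
  have \<sigma>x: "\<sigma> (- g) x \<in> P" "adj (\<sigma> (- g) x) = \<sigma> (- g) x"
    using \<sigma>_in_P \<sigma>_adj xy by metis+
  note R_in_P = von_neumann_algebra_cayley_res_iff[OF P, THEN iffD2]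
  have Rx: "cayley_res x \<in> P" and Ry: "cayley_res y \<in> P"
    using xy P_closed(1) R_in_P by blast+
  define b where "b = (\<lambda>v. \<sigma> (- g) (cayley_res x) v - cayley_res y v)"
  have b: "b \<in> P"
    unfolding b_def by (intro P_closed(7) \<sigma>_in_P Rx Ry)
  have XA: "X \<in> commutant (commutant crossed_span)"
    using X(1) commutant_antimono[OF commutant_antimono[OF crossed_gens_subset_span]] by blast
  have "sqnorm2 b \<le> 0 + e" if e: "0 < e" for e
  proof -
    \<comment> \<open>\<open>sqnorm2_add_le\<close> doubles each of the two errors, whence the
      quarter.\<close>
    have e4: "0 < e / 4"
      using e by simp
    obtain W d where W: "finite W" and d: "0 < d"
      and small: "\<And>a b. a \<in> P \<Longrightarrow> adj a = a \<Longrightarrow> b \<in> P \<Longrightarrow> adj b = b \<Longrightarrow>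
        \<forall>w\<in>W. norm (a (cayley_res b w) - b (cayley_res b w)) \<le> d \<Longrightarrow>
        sqnorm2 (\<lambda>v. cayley_res a v - cayley_res b v) \<le> e / 4"
      by (rule sqnorm2_cayley_res_diff_small[OF e4]) (rule that)
    \<comment> \<open>One \<open>S\<close> must approximate \<open>X\<close> in the columns
      \<open>0\<close> and \<open>g\<close> at once, at the vectors tested by the resolvent
      estimates for \<open>x\<close> and for \<open>y\<close>.\<close>
    define I where "I = single_ell2 0 ` cayley_res x ` W \<union> single_ell2 g ` cayley_res y ` W"
    obtain S where S: "S \<in> crossed_span" "adj S = S" "\<And>u. u \<in> I \<Longrightarrow> norm (S u - X u) < d"
      using selfadjoint_approximation[OF crossed_span_unital_star_algebra XA X(2), of I d] W d
      unfolding I_def by (metis finite_UnI finite_imageI)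
    have Sb: "S \<in> bounded_ops"
      using S(1) crossed_span_bounded by blast
    define a where "a = entry S 0 0"
    have a: "a \<in> P" "adj a = a" "entry S g g = \<sigma> (- g) a"
      unfolding a_def using crossed_span_diagonal[OF S(1)] entry_adj[OF Sb] S(2) by metis+
    have close: "norm (entry S h h u - entry X h h u) \<le> d" if "single_ell2 h u \<in> I" for h u
      using norm_component_le_norm_ell2[of "S (single_ell2 h u) - X (single_ell2 h u)" h] S(3)[OF that]
      by (simp add: entry_def)
    have 1: "sqnorm2 (\<lambda>v. cayley_res a v - cayley_res x v) \<le> e / 4"
      using close[of 0] by (intro small a xy) (auto simp: a_def x_def I_def)
    have \<sigma>a: "\<sigma> (- g) a \<in> P" "adj (\<sigma> (- g) a) = \<sigma> (- g) a"
      using \<sigma>_in_P \<sigma>_adj a by metis+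
    have 2: "sqnorm2 (\<lambda>v. cayley_res (\<sigma> (- g) a) v - cayley_res y v) \<le> e / 4"
      using close[of g] by (intro small \<sigma>a xy) (auto simp: y_def I_def a(3))
    have Ra: "cayley_res a \<in> P" "cayley_res (\<sigma> (- g) a) \<in> P"
      using a \<sigma>a P_closed(1) R_in_P by blast+
    define c where "c = (\<lambda>v. cayley_res a v - cayley_res x v)"
    have c: "c \<in> P" "sqnorm2 c \<le> e / 4"
      unfolding c_def by (intro P_closed(7) Ra Rx, rule 1)
    define f where "f = (\<lambda>v. cayley_res (\<sigma> (- g) a) v - cayley_res y v)"
    have f: "f \<in> P" "sqnorm2 f \<le> e / 4"
      unfolding f_def by (intro P_closed(7) Ra Ry, rule 2)
    have "b = (\<lambda>v. - \<sigma> (- g) c v + f v)"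
      unfolding b_def c_def f_def \<sigma>_diff[OF Ra(1) Rx] \<sigma>_cayley_res[OF a(1,2)] by auto
    then have "sqnorm2 b \<le> 2 * sqnorm2 c + 2 * sqnorm2 f"
      using sqnorm2_add_le[OF uminus_in_P[OF \<sigma>_in_P[OF c(1)]] f(1)]
      by (simp add: sqnorm2_uminus \<sigma>_in_P c(1) sqnorm2_\<sigma>)
    then show ?thesis
      using c(2) f(2) by simp
  qed
  then have "sqnorm2 b \<le> 0"
    by (rule field_le_epsilon)
  then have "b = (\<lambda>v. 0)"
    using sqnorm2_eq_0[OF b] sqnorm2_nonneg[OF b] by simp
  then have "cayley_res (\<sigma> (- g) x) v = cayley_res y v" for v
    using fun_cong[of b "\<lambda>v. 0" v] unfolding b_def \<sigma>_cayley_res[OF xy(1,2)] by simp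
  then have "\<sigma> (- g) x = y"
    by (intro cayley_res_inj[OF P_closed(1)[OF \<sigma>x(1)] \<sigma>x(2) P_closed(1)[OF xy(3)] xy(4)] ext)
  then show ?thesis
    by (simp add: x_def y_def)
qed

lemma bicommutant_crossed_gens:
  "von_neumann_algebra (commutant (commutant (crossed_gens \<sigma> P)))"
  by (intro bicommutant_von_neumann_algebra crossed_gens_bounded crossed_gens_adj order_refl P_closed(6))

lemma diagonal_covariance:
  assumes X: "X \<in> commutant (commutant (crossed_gens \<sigma> P))"
  shows "entry X g g = \<sigma> (- g) (entry X 0 0)"
proof -
  obtain B C where BC: "B \<in> commutant (commutant (crossed_gens \<sigma> P))" "adj B = B"
      "C \<in> commutant (commutant (crossed_gens \<sigma> P))" "adj C = C" "X = (\<lambda>\<xi>. B \<xi> + \<i> *\<^sub>C C \<xi>)"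
    by (rule cartesian_decomposition[OF von_neumann_algebra_unital_star_algebra[OF bicommutant_crossed_gens] X])
      (rule that)
  have entry: "entry X h h = (\<lambda>v. entry B h h v + \<i> *\<^sub>C entry C h h v)" for h
    unfolding BC(5) by (rule ext) (simp add: entry_def)
  note P' = entry_in_subalgebra[OF P order_refl invariant_P]
  show ?thesis
    unfolding entry diagonal_covariance_selfadjoint[OF BC(1,2), of g]
      diagonal_covariance_selfadjoint[OF BC(3,4), of g]
    by (simp add: \<sigma>_add \<sigma>_scaleC P_closed(4) P'[OF BC(1)] P'[OF BC(3)])
qed

text \<open>Right multiplication by \<open>translation (h - g)\<close> moves the entry at row
  \<open>g\<close> and column \<open>h\<close> onto the diagonal; in row \<open>0\<close> the same
  product reads column \<open>h - g\<close>.\<close>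

lemma entry_covariance:
  assumes X: "X \<in> commutant (commutant (crossed_gens \<sigma> P))"
  shows "entry X g h = \<sigma> (- g) (entry X 0 (h - g))"
proof -
  have "translation (h - g) \<in> crossed_gens \<sigma> P"
    by (simp add: crossed_gens_def)
  then have "translation (h - g) \<in> commutant (commutant (crossed_gens \<sigma> P))"
    using bicommutant_superset[OF crossed_gens_bounded[OF order_refl]] by blast
  then have "X \<circ> translation (h - g) \<in> commutant (commutant (crossed_gens \<sigma> P))"
    by (rule von_neumann_algebra_closed(5)[OF bicommutant_crossed_gens X])
  from diagonal_covariance[OF this, of g] show ?thesis
    by (simp add: entry_comp_translation)
qed

text \<open>For \<open>T\<close> in the commutant of the generators, the matrix entries of \<open>X T\<close> and \<open>T X\<close> are given by
  the same series up to the reindexing \<open>k \<mapsto> h - k + g\<close>.\<close>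

lemma bicommutant_of_covariant_entries:
  assumes A: "A \<subseteq> P" and Xb: "X \<in> bounded_ops" and X: "\<And>g h. entry X g h \<in> A"
    and cov: "\<And>g h. entry X g h = \<sigma> (- g) (entry X 0 (h - g))"
  shows "X \<in> commutant (commutant (crossed_gens \<sigma> A))"
proof (rule commutantI[OF Xb])
  fix T \<xi> assume T: "T \<in> commutant (crossed_gens \<sigma> A)"
  note Tb = commutantD(1)[OF T]
  have shift: "entry T (j + g) (j + k) v = entry T g k v" for j g k v
  proof -
    have "T (translation j (single_ell2 k v)) = translation j (T (single_ell2 k v))"
      by (rule commutantD(2)[OF T]) (simp add: crossed_gens_def)
    then show ?thesis
      by (simp add: entry_def translation_single Rep_translation add.assoc[symmetric])
  qed
  have inter: "entry T g k (\<sigma> (- k) a v) = \<sigma> (- g) a (entry T g k v)" if a: "a \<in> A" for a g k v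
  proof -
    have "alg_embed \<sigma> a \<circ> T = T \<circ> alg_embed \<sigma> a"
      using commutantD(2)[OF T, of "alg_embed \<sigma> a"] a by (auto simp: crossed_gens_def)
    then show ?thesis
      using alg_embed_commute_iff[OF _ Tb, of a] a A by auto
  qed
  have "X \<circ> T = T \<circ> X"
  proof (rule bounded_ops_entry_eqI)
    fix g h v
    have "cinner (entry (X \<circ> T) g h v) u = cinner (entry (T \<circ> X) g h v) u" for u
    proof -
      have "cinner (entry (X \<circ> T) g h v) u =
          (\<Sum>\<^sub>\<infinity>k. cinner (\<sigma> (- g) (entry X 0 (k - g)) (entry T k h v)) u)"
        unfolding entry_def[of "X \<circ> T"] comp_apply cinner_component[OF Xb] cov[of g] by (simp add: entry_def)
      also have "\<dots> = (\<Sum>\<^sub>\<infinity>k. cinner (\<sigma> (- g) (entry X 0 ((h - k + g) - g)) (entry T (h - k + g) h v)) u)"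
      proof (rule infsum_reindex_bij_betw[symmetric])
        show "bij_betw (\<lambda>k. h - k + g) UNIV UNIV"
          by (rule bij_betw_byWitness[where f' = "\<lambda>k. - (k - g) + h"])
            (auto simp: diff_add_eq_diff_diff_swap)
      qed
      \<comment> \<open>Invariance of \<open>T\<close> under the simultaneous shift by
        \<open>j = h - k\<close>: the row \<open>h - k + g\<close> is \<open>j + g\<close>, and the
        column \<open>h\<close> is \<open>j + k\<close>. The order of the summands matters, as the
        group need not be commutative.\<close>
      also have "\<dots> = (\<Sum>\<^sub>\<infinity>k. cinner (\<sigma> (- g) (entry X 0 (h - k)) (entry T g k v)) u)"
        using shift[of "h - _" g _ v] by (intro infsum_cong) (metis add_diff_cancel diff_add_cancel)
      also have "\<dots> = (\<Sum>\<^sub>\<infinity>k. cinner (entry T g k (entry X k h v)) u)"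
        using inter[OF X] by (simp add: cov[of _ h])
      also have "\<dots> = cinner (entry (T \<circ> X) g h v) u"
        unfolding entry_def[of "T \<circ> X"] comp_apply cinner_component[OF Tb] by (simp add: entry_def)
      finally show ?thesis .
    qed
    then have "cinner u (entry (X \<circ> T) g h v) = cinner u (entry (T \<circ> X) g h v)" for u
      using cinner_commute by metis
    then show "entry (X \<circ> T) g h v = entry (T \<circ> X) g h v"
      by (rule cinner_ext)
  qed (intro bounded_ops_comp Xb Tb)+
  then show "X (T \<xi>) = T (X \<xi>)"
    by (metis comp_apply)
qed

end

subsection \<open>Intermediate algebras and expectations\<close>

locale intermediate_expectation = traced_action P \<tau> \<sigma>
  for P :: "('h :: chilbert_space \<Rightarrow> 'h) set" and \<tau> :: "('h \<Rightarrow> 'h) \<Rightarrow> complex"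
    and \<sigma> :: "'g :: group_add \<Rightarrow> ('h \<Rightarrow> 'h) \<Rightarrow> ('h \<Rightarrow> 'h)" +
  fixes N :: "(('g, 'h) ell2 \<Rightarrow> ('g, 'h) ell2) set"
    and E :: "(('g, 'h) ell2 \<Rightarrow> ('g, 'h) ell2) \<Rightarrow> (('g, 'h) ell2 \<Rightarrow> ('g, 'h) ell2)"
  assumes N: "von_neumann_algebra N" and translation_in_N: "translation g \<in> N"
    and N_le: "N \<subseteq> crossed_product \<sigma> P"
    and E: "trace_preserving_conditional_expectation (canonical_trace \<tau>) (crossed_product \<sigma> P) N E"
begin

lemmas N_closed = von_neumann_algebra_closed[OF N]

section \<open>Trace identities for the expectation\<close>

lemma crossed_product_P: "crossed_product \<sigma> P = commutant (commutant (crossed_gens \<sigma> P))"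
  by (rule crossed_product_bicommutant) (auto intro: P_closed(6))

lemma crossed_product_comp:
  "X \<in> crossed_product \<sigma> P \<Longrightarrow> Y \<in> crossed_product \<sigma> P \<Longrightarrow> X \<circ> Y \<in> crossed_product \<sigma> P"
  unfolding crossed_product_P by (rule von_neumann_algebra_closed(5)[OF bicommutant_crossed_gens])

lemma alg_embed_in_crossed_product: "a \<in> P \<Longrightarrow> alg_embed \<sigma> a \<in> crossed_product \<sigma> P"
  using bicommutant_superset[OF crossed_gens_bounded[OF order_refl]]
  unfolding crossed_product_P by (auto simp: crossed_gens_def)

lemma E_in_N: "X \<in> crossed_product \<sigma> P \<Longrightarrow> E X \<in> N"
  and E_bimodule: "X \<in> crossed_product \<sigma> P \<Longrightarrow> Y \<in> N \<Longrightarrow> Z \<in> N \<Longrightarrow> E (Y \<circ> X \<circ> Z) = Y \<circ> E X \<circ> Z"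
  and E_trace: "X \<in> crossed_product \<sigma> P \<Longrightarrow> canonical_trace \<tau> (E X) = canonical_trace \<tau> X"
  using E unfolding trace_preserving_conditional_expectation_def by blast+

lemma E_right: "X \<in> crossed_product \<sigma> P \<Longrightarrow> Z \<in> N \<Longrightarrow> E (X \<circ> Z) = E X \<circ> Z"
  using E_bimodule[OF _ N_closed(2), of X Z] by simp

lemma E_left: "X \<in> crossed_product \<sigma> P \<Longrightarrow> Y \<in> N \<Longrightarrow> E (Y \<circ> X) = Y \<circ> E X"
  using E_bimodule[OF _ _ N_closed(2), of X Y] by simp

lemma canonical_trace_entry: "canonical_trace \<tau> X = \<tau> (entry X 0 0)"
proof -
  have "(\<lambda>v. Rep_ell2 (X (single_ell2 0 v)) 0) = entry X 0 0"
    by (rule ext) (simp add: entry_def)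
  then show ?thesis
    by (simp add: canonical_trace_def)
qed

lemma entry_comp_alg_embed: "a \<in> P \<Longrightarrow> entry (X \<circ> alg_embed \<sigma> a) g 0 = entry X g 0 \<circ> a"
  by (rule ext) (simp add: entry_def alg_embed_single \<sigma>_0)

lemma canonical_trace_comp_alg_embed:
  "a \<in> P \<Longrightarrow> canonical_trace \<tau> (X \<circ> alg_embed \<sigma> a) = \<tau> (entry X 0 0 \<circ> a)"
  by (simp add: canonical_trace_entry entry_comp_alg_embed)

lemma canonical_trace_alg_embed_comp:
  "a \<in> P \<Longrightarrow> b \<in> P \<Longrightarrow> canonical_trace \<tau> (alg_embed \<sigma> a \<circ> alg_embed \<sigma> b) = \<tau> (a \<circ> b)"
  by (simp add: canonical_trace_comp_alg_embed entry_alg_embed_0)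

lemma entry_in_P: "X \<in> crossed_product \<sigma> P \<Longrightarrow> entry X g h \<in> P"
  unfolding crossed_product_P by (rule entry_in_subalgebra[OF P order_refl invariant_P])

lemma eq_0_of_trace_comp_adj:
  assumes d: "d \<in> P" "\<tau> (d \<circ> adj d) = 0"
  shows "d = (\<lambda>v. 0)"
  using \<tau>_comp_commute[OF d(1) P_closed(6)[OF d(1)]] d faithful unfolding faithful_on_def by metis

lemma trace_separates:
  assumes z: "z \<in> P" and y: "y \<in> P" and eq: "\<And>a. a \<in> P \<Longrightarrow> \<tau> (z \<circ> a) = \<tau> (y \<circ> a)"
  shows "z = y"
proof -
  define d where "d = (\<lambda>v. z v - y v)"
  have d: "d \<in> P"
    unfolding d_def by (rule P_closed(7)[OF z y])
  have "d \<circ> adj d = (\<lambda>v. (z \<circ> adj d) v - (y \<circ> adj d) v)"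
    by (auto simp: d_def)
  then have "\<tau> (d \<circ> adj d) = 0"
    using \<tau>_diff[of "z \<circ> adj d" "y \<circ> adj d"] P_closed(5,6) z y d eq by auto
  then have "d = (\<lambda>v. 0)"
    by (rule eq_0_of_trace_comp_adj[OF d])
  then show ?thesis
    by (auto simp: d_def fun_eq_iff)
qed

text \<open>The off-diagonal entries \<open>e\<close> of \<open>E (alg_embed \<sigma> x)\<close> lie in \<open>Q\<close>, and \<open>\<tau> (e \<circ> q) = 0\<close> for all
  \<open>q \<in> Q\<close> because \<open>E\<close> is \<open>N\<close>-bilinear and trace preserving; take \<open>q = adj e\<close>.\<close>

lemma expectation_onto_crossed_product:
  assumes Q: "von_neumann_algebra Q" "Q \<subseteq> P" "invariant_under \<sigma> Q" and NQ: "N = crossed_product \<sigma> Q"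
    and x: "x \<in> P"
  shows "E (alg_embed \<sigma> x) \<in> alg_embed \<sigma> ` P"
proof -
  define X where "X = E (alg_embed \<sigma> x)"
  note xM = alg_embed_in_crossed_product[OF x]
  have XN: "X \<in> N"
    unfolding X_def by (rule E_in_N[OF xM])
  have XM: "X \<in> crossed_product \<sigma> P"
    using XN N_le by blast
  have Xb: "X \<in> bounded_ops"
    using XN N_closed(1) by blast
  have N_eq: "N = commutant (commutant (crossed_gens \<sigma> Q))"
    unfolding NQ using Q(2) von_neumann_algebraD(2)[OF Q(1)] by (rule crossed_product_bicommutant)
  have XQ: "entry X g h \<in> Q" for g h
    using entry_in_subalgebra[OF Q] XN N_eq by blast
  have emb_N: "alg_embed \<sigma> q \<in> N" if "q \<in> Q" for q
    using that bicommutant_superset[OF crossed_gens_bounded[OF Q(2)]] unfolding N_eq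
    by (auto simp: crossed_gens_def)
  have cov: "entry X g h = \<sigma> (- g) (entry X 0 (h - g))" for g h
    using entry_covariance XM crossed_product_P by blast
  have off: "entry X 0 k = (\<lambda>v. 0)" if k: "k \<noteq> 0" for k
  proof -
    define e where "e = entry X 0 k"
    have e: "e \<in> P" "adj e \<in> Q" "adj e \<in> P"
      using XQ[of 0 k] Q(2) von_neumann_algebraD(2)[OF Q(1)] unfolding e_def by blast+
    have Z: "translation k \<circ> alg_embed \<sigma> (adj e) \<in> N"
      by (intro N_closed(5) translation_in_N emb_N e)
    have entry: "entry (Y \<circ> (translation k \<circ> alg_embed \<sigma> (adj e))) 0 0 = entry Y 0 k \<circ> adj e" for Y
      using entry_comp_alg_embed[OF e(3), of "Y \<circ> translation k" 0]
      by (simp add: entry_comp_translation comp_assoc)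
    have "\<tau> (e \<circ> adj e) = canonical_trace \<tau> (X \<circ> (translation k \<circ> alg_embed \<sigma> (adj e)))"
      unfolding canonical_trace_entry entry by (simp only: e_def)
    also have "\<dots> = canonical_trace \<tau> (alg_embed \<sigma> x \<circ> (translation k \<circ> alg_embed \<sigma> (adj e)))"
      unfolding X_def E_right[OF xM Z, symmetric]
      using Z N_le by (intro E_trace crossed_product_comp[OF xM]) blast
    \<comment> \<open>The translation makes the trace read the entry of
      \<open>alg_embed \<sigma> x\<close> at row \<open>0\<close> and column \<open>k\<close>, which
      is off the diagonal.\<close>
    also have "\<dots> = \<tau> (\<lambda>v. 0)"
      unfolding canonical_trace_entry entry using k by (simp add: comp_def entry_alg_embed[OF x])
    finally have "\<tau> (e \<circ> adj e) = 0"
      by simp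
    then show ?thesis
      using eq_0_of_trace_comp_adj[OF e(1)] by (simp add: e_def)
  qed
  have y: "entry X 0 0 \<in> P"
    using XQ Q(2) by blast
  have "X = alg_embed \<sigma> (entry X 0 0)"
  proof (rule bounded_ops_entry_eqI[OF Xb alg_embed_bounded_ops[OF y]])
    show "entry X g h v = entry (alg_embed \<sigma> (entry X 0 0)) g h v" for g h v
      using cov[of g h] off[of "h - g"] by (auto simp: entry_alg_embed[OF y] \<sigma>_zero)
  qed
  then show ?thesis
    unfolding X_def[symmetric] using y by (metis imageI)
qed

text \<open>The intersection of \<open>P\<close> and \<open>N\<close>, transported back to operators
  on \<open>'h\<close>. Membership of \<open>alg_embed \<sigma> q\<close> in \<open>N\<close> does
  not directly control strong limits of the \<open>q\<close> on \<open>'h\<close>, so the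
  bicommutant property takes a separate argument involving \<open>E\<close>.\<close>

definition embedded_part :: "('h \<Rightarrow> 'h) set" where
  "embedded_part = {q \<in> P. alg_embed \<sigma> q \<in> N}"

lemma embedded_part_le: "embedded_part \<subseteq> P"
  by (auto simp: embedded_part_def)

lemma embedded_part_unital_star_algebra: "unital_star_algebra embedded_part"
  unfolding unital_star_algebra_def embedded_part_def
  using N_closed P_closed
  by (auto simp: alg_embed_id alg_embed_add alg_embed_scaleC alg_embed_comp simp flip: adj_alg_embed)

lemmas embedded_part_closed = unital_star_algebraD[OF embedded_part_unital_star_algebra]

text \<open>\<open>embedded_part\<close> is not yet known to be a von Neumann algebra, so the
  inversion takes place in \<open>N\<close>, on the images under
  \<open>alg_embed \<sigma>\<close>.\<close>

lemma cayley_res_in_embedded_part_iff: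
  assumes a: "a \<in> P" "adj a = a"
  shows "cayley_res a \<in> embedded_part \<longleftrightarrow> a \<in> embedded_part"
proof -
  have ab: "a \<in> bounded_ops" and R: "cayley_res a \<in> P"
    using a P_closed(1) von_neumann_algebra_cayley_res_iff[OF P] by blast+
  define c where "c = (\<lambda>v. a v + \<i> *\<^sub>C id v)"
  have i: "(\<lambda>v. \<i> *\<^sub>C id v) \<in> embedded_part"
    by (intro embedded_part_closed(2,4))
  then have iP: "(\<lambda>v. \<i> *\<^sub>C id v) \<in> P"
    using embedded_part_le by blast
  have c: "c \<in> P"
    unfolding c_def by (rule P_closed(3)[OF a(1) iP])
  have "cayley_res a \<circ> c = id" "c \<circ> cayley_res a = id"
    using cayley_res_left[OF ab a(2)] cayley_res_right[OF ab a(2)] by (auto simp: fun_eq_iff c_def)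
  then have eq: "alg_embed \<sigma> (cayley_res a) \<circ> alg_embed \<sigma> c = id"
      "alg_embed \<sigma> c \<circ> alg_embed \<sigma> (cayley_res a) = id"
    by (simp_all add: alg_embed_id R c flip: alg_embed_comp)
  show ?thesis
  proof
    assume "cayley_res a \<in> embedded_part"
    then have "alg_embed \<sigma> c \<in> N"
      using von_neumann_algebra_inverse[OF N _ alg_embed_bounded_ops[OF c] eq(2,1)]
      by (simp add: embedded_part_def)
    then have "(\<lambda>v. c v - \<i> *\<^sub>C id v) \<in> embedded_part"
      using c i by (intro embedded_part_closed(7)) (simp_all add: embedded_part_def)
    then show "a \<in> embedded_part"
      by (simp add: c_def)
  next
    assume "a \<in> embedded_part"
    then have "alg_embed \<sigma> c \<in> N"
      using embedded_part_closed(3)[OF _ i] unfolding c_def embedded_part_def by blast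
    then show "cayley_res a \<in> embedded_part"
      using von_neumann_algebra_inverse[OF N _ alg_embed_bounded_ops[OF R] eq] R
      by (simp add: embedded_part_def)
  qed
qed

lemma embedded_part_invariant: "invariant_under \<sigma> embedded_part"
  unfolding invariant_under_def
proof safe
  fix g q assume "q \<in> embedded_part"
  then have q: "q \<in> P" "alg_embed \<sigma> q \<in> N"
    by (auto simp: embedded_part_def)
  have "alg_embed \<sigma> (\<sigma> g q) = translation g \<circ> alg_embed \<sigma> q \<circ> translation (- g)"
    by (auto simp: translation_alg_embed q(1) translation_translation)
  then have "alg_embed \<sigma> (\<sigma> g q) \<in> N"
    using q(2) translation_in_N N_closed(5) by metis
  then show "\<sigma> g q \<in> embedded_part"
    using \<sigma>_in_P[OF q(1)] by (simp add: embedded_part_def)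
qed

end

section \<open>Expectations mapping the embedded algebra into itself\<close>

locale commuting_expectation = intermediate_expectation +
  assumes E_P: "E ` alg_embed \<sigma> ` P \<subseteq> alg_embed \<sigma> ` P"
begin

lemma E_alg_embed:
  assumes a: "a \<in> P"
  obtains b where "b \<in> embedded_part" "E (alg_embed \<sigma> a) = alg_embed \<sigma> b"
proof -
  obtain b where b: "b \<in> P" "E (alg_embed \<sigma> a) = alg_embed \<sigma> b"
    using E_P a by blast
  moreover have "alg_embed \<sigma> b \<in> N"
    using E_in_N[OF alg_embed_in_crossed_product[OF a]] b(2) by simp
  ultimately show ?thesis
    using that by (simp add: embedded_part_def)
qed

text \<open>The resolvents \<open>(a + i)\<inverse>\<close> of approximants \<open>a\<close> from \<open>embedded_part\<close> converge in \<open>sqnorm2\<close> to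
  \<open>(T + i)\<inverse>\<close>, while by Pythagoras no element of \<open>embedded_part\<close> is closer to it than its expectation.\<close>

lemma selfadjoint_bicommutant_in_embedded_part:
  assumes T: "T \<in> commutant (commutant embedded_part)" "adj T = T"
  shows "T \<in> embedded_part"
proof -
  have TP: "T \<in> P"
    using T(1) commutant_antimono[OF commutant_antimono[OF embedded_part_le]]
      von_neumann_algebraD(3)[OF P] by blast
  define R where "R = cayley_res T"
  have R: "R \<in> P"
    unfolding R_def using von_neumann_algebra_cayley_res_iff[OF P P_closed(1)[OF TP] T(2)] TP by blast
  obtain z where z: "z \<in> embedded_part" "E (alg_embed \<sigma> R) = alg_embed \<sigma> z"
    using E_alg_embed[OF R] by metis
  have zP: "z \<in> P"
    using z(1) embedded_part_le by blast
  define y where "y = (\<lambda>v. z v - R v)"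
  have y: "y \<in> P"
    unfolding y_def by (rule P_closed(7)[OF zP R])
  \<comment> \<open>\<open>z\<close> is the expectation of \<open>R\<close>. Moving
    \<open>adj q\<close> into \<open>E\<close> by left \<open>N\<close>-linearity and dropping
    \<open>E\<close> under the trace shows that \<open>z\<close> and \<open>R\<close> have the same
    pairing with \<open>q\<close>.\<close>
  have orth: "\<tau> (adj q \<circ> y) = 0" if q: "q \<in> embedded_part" for q
  proof -
    have qN: "adj q \<in> P" "alg_embed \<sigma> (adj q) \<in> N"
      using embedded_part_closed(6)[OF q] by (auto simp: embedded_part_def)
    have "\<tau> (adj q \<circ> z) = canonical_trace \<tau> (E (alg_embed \<sigma> (adj q) \<circ> alg_embed \<sigma> R))"
      by (simp add: E_left[OF alg_embed_in_crossed_product[OF R] qN(2)] z(2)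
          canonical_trace_alg_embed_comp qN zP)
    also have "\<dots> = \<tau> (adj q \<circ> R)"
      using E_trace[OF crossed_product_comp] alg_embed_in_crossed_product qN(1) R
      by (simp add: canonical_trace_alg_embed_comp)
    finally have "\<tau> (adj q \<circ> z) = \<tau> (adj q \<circ> R)" .
    moreover have "adj q \<circ> y = (\<lambda>v. (adj q \<circ> z) v - (adj q \<circ> R) v)"
      using bounded_opsD(4)[OF P_closed(1)[OF qN(1)]] by (auto simp: y_def)
    ultimately show ?thesis
      using \<tau>_diff[OF P_closed(5)[OF qN(1) zP] P_closed(5)[OF qN(1) R]] by simp
  qed
  have "sqnorm2 y \<le> 0 + e" if e: "0 < e" for e
  proof -
    obtain W d where W: "finite W" and d: "0 < d"
      and small: "\<And>a b. a \<in> P \<Longrightarrow> adj a = a \<Longrightarrow> b \<in> P \<Longrightarrow> adj b = b \<Longrightarrow>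
        \<forall>w\<in>W. norm (a (cayley_res b w) - b (cayley_res b w)) \<le> d \<Longrightarrow>
        sqnorm2 (\<lambda>v. cayley_res a v - cayley_res b v) \<le> e"
      by (rule sqnorm2_cayley_res_diff_small[OF e]) (rule that)
    obtain a where a: "a \<in> embedded_part" "adj a = a"
        "\<And>u. u \<in> cayley_res T ` W \<Longrightarrow> norm (a u - T u) < d"
      using selfadjoint_approximation[OF embedded_part_unital_star_algebra T, of "cayley_res T ` W" d] W d
      by (metis finite_imageI)
    have aP: "a \<in> P"
      using a(1) embedded_part_le by blast
    define q where "q = (\<lambda>v. cayley_res a v - z v)"
    have "cayley_res a \<in> embedded_part"
      using cayley_res_in_embedded_part_iff[OF aP a(2)] a(1) by blast
    then have q: "q \<in> embedded_part"
      unfolding q_def by (rule embedded_part_closed(7)[OF _ z(1)])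
    then have qP: "q \<in> P"
      using embedded_part_le by blast
    have "sqnorm2 q + sqnorm2 y = sqnorm2 (\<lambda>v. q v + y v)"
      using sqnorm2_add[OF qP y] orth[OF q] by simp
    also have "(\<lambda>v. q v + y v) = (\<lambda>v. cayley_res a v - cayley_res T v)"
      by (auto simp: q_def y_def R_def)
    also have "sqnorm2 \<dots> \<le> e"
      using a(3) by (intro small aP a TP T) (auto intro: less_imp_le)
    finally show ?thesis
      using sqnorm2_nonneg[OF qP] by simp
  qed
  then have "sqnorm2 y \<le> 0"
    by (rule field_le_epsilon)
  then have "y = (\<lambda>v. 0)"
    using sqnorm2_eq_0[OF y] sqnorm2_nonneg[OF y] by simp
  then have "R = z"
    by (auto simp: y_def fun_eq_iff)
  then show ?thesis
    using z(1) cayley_res_in_embedded_part_iff[OF TP T(2)] R_def by simp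
qed

lemma embedded_part_von_neumann_algebra: "von_neumann_algebra embedded_part"
proof -
  have b: "embedded_part \<subseteq> bounded_ops"
    using embedded_part_closed(1) by blast
  have star: "unital_star_algebra (commutant (commutant embedded_part))"
    by (intro von_neumann_algebra_unital_star_algebra bicommutant_von_neumann_algebra b
        embedded_part_closed(6))
  have "T \<in> embedded_part" if "T \<in> commutant (commutant embedded_part)" for T
  proof -
    obtain B C where "B \<in> commutant (commutant embedded_part)" "adj B = B"
        "C \<in> commutant (commutant embedded_part)" "adj C = C" and T: "T = (\<lambda>v. B v + \<i> *\<^sub>C C v)"
      by (rule cartesian_decomposition[OF star \<open>T \<in> commutant (commutant embedded_part)\<close>]) (rule that)
    then have "B \<in> embedded_part" "C \<in> embedded_part"
      using selfadjoint_bicommutant_in_embedded_part by blast+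
    then show ?thesis
      unfolding T by (intro embedded_part_closed(3,4))
  qed
  then show ?thesis
    unfolding von_neumann_algebra_def
    using b bicommutant_superset[OF b] embedded_part_closed(6) by blast
qed

lemma entry_0_0_in_embedded_part:
  assumes X: "X \<in> N"
  shows "entry X 0 0 \<in> embedded_part"
proof -
  have XM: "X \<in> crossed_product \<sigma> P"
    using X N_le by blast
  define y where "y = entry X 0 0"
  have y: "y \<in> P"
    unfolding y_def by (rule entry_in_P[OF XM])
  note emb = alg_embed_in_crossed_product
  obtain z where z: "z \<in> embedded_part" "E (alg_embed \<sigma> y) = alg_embed \<sigma> z"
    using E_alg_embed[OF y] by metis
  have zN: "z \<in> P" "alg_embed \<sigma> z \<in> N"
    using z(1) by (auto simp: embedded_part_def)
  have "\<tau> (z \<circ> a) = \<tau> (y \<circ> a)" if a: "a \<in> P" for a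
  proof -
    obtain b where b: "b \<in> embedded_part" "E (alg_embed \<sigma> a) = alg_embed \<sigma> b"
      using E_alg_embed[OF a] by metis
    have bN: "b \<in> P" "alg_embed \<sigma> b \<in> N"
      using b(1) by (auto simp: embedded_part_def)
    have "\<tau> (z \<circ> a) = canonical_trace \<tau> (E (alg_embed \<sigma> z \<circ> alg_embed \<sigma> a))"
      by (simp add: E_trace crossed_product_comp emb zN a canonical_trace_alg_embed_comp)
    \<comment> \<open>Both sides are the trace of
      \<open>alg_embed \<sigma> z \<circ> alg_embed \<sigma> b\<close>: on the left \<open>z\<close>
      is pulled out of \<open>E\<close>, on the right \<open>b\<close> is, by linearity over
      \<open>N\<close> from either side.\<close>
    also have "\<dots> = canonical_trace \<tau> (E (alg_embed \<sigma> y \<circ> alg_embed \<sigma> b))"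
      by (simp add: E_left[OF emb[OF a] zN(2)] E_right[OF emb[OF y] bN(2)] b(2) z(2))
    also have "\<dots> = \<tau> (y \<circ> b)"
      by (simp add: E_trace crossed_product_comp emb y bN canonical_trace_alg_embed_comp)
    \<comment> \<open>The trace sees only the entry of \<open>X\<close> at the neutral element, so
      \<open>X\<close> may replace \<open>y\<close>. Unlike the embedding of \<open>y\<close>, it is
      known to lie in \<open>N\<close> and can be moved inside \<open>E\<close>.\<close>
    also have "\<dots> = canonical_trace \<tau> (X \<circ> E (alg_embed \<sigma> a))"
      by (simp add: b(2) canonical_trace_comp_alg_embed bN(1) y_def)
    also have "\<dots> = \<tau> (y \<circ> a)"
      by (simp add: E_left[OF emb[OF a] X, symmetric] E_trace crossed_product_comp XM emb a
          canonical_trace_comp_alg_embed y_def)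
    finally show ?thesis .
  qed
  then have "z = y"
    by (rule trace_separates[OF zN(1) y])
  then show ?thesis
    using z(1) y_def by simp
qed

lemma N_eq_crossed_product: "N = crossed_product \<sigma> embedded_part"
proof
  have eq: "crossed_product \<sigma> embedded_part = commutant (commutant (crossed_gens \<sigma> embedded_part))"
    by (rule crossed_product_bicommutant[OF embedded_part_le embedded_part_closed(6)])
  show "N \<subseteq> crossed_product \<sigma> embedded_part"
  proof
    fix X assume X: "X \<in> N"
    have "X \<in> commutant (commutant (crossed_gens \<sigma> P))"
      using X N_le crossed_product_P by blast
    note cov = entry_covariance[OF this]
    have "entry X 0 k \<in> embedded_part" for k
      using entry_0_0_in_embedded_part[OF N_closed(5)[OF X translation_in_N[of k]]]
      by (simp add: entry_comp_translation)
    then have "entry X g h \<in> embedded_part" for g h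
      using embedded_part_invariant cov[of g h] unfolding invariant_under_def by (metis image_subset_iff)
    then show "X \<in> crossed_product \<sigma> embedded_part"
      unfolding eq
      by (rule bicommutant_of_covariant_entries[OF embedded_part_le N_closed(1)[OF X]]) (rule cov)
  qed
  show "crossed_product \<sigma> embedded_part \<subseteq> N"
    unfolding crossed_product_def using N translation_in_N
    by (intro hull_minimal) (auto simp: embedded_part_def)
qed

end

theorem theorem3p2:
  fixes P P\<^sub>0 :: "('h :: chilbert_space \<Rightarrow> 'h) set"
    and \<tau> :: "('h \<Rightarrow> 'h) \<Rightarrow> complex"
    and \<sigma> :: "'g :: {group_add, countable} \<Rightarrow> ('h \<Rightarrow> 'h) \<Rightarrow> ('h \<Rightarrow> 'h)"
    and N :: "(('g, 'h) ell2 \<Rightarrow> ('g, 'h) ell2) set"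
    and E\<^sub>N :: "(('g, 'h) ell2 \<Rightarrow> ('g, 'h) ell2) \<Rightarrow> (('g, 'h) ell2 \<Rightarrow> ('g, 'h) ell2)"
  assumes "finite_von_neumann_algebra P"
    and "trace_on P \<tau>" and "faithful_on P \<tau>" and "normal_on P \<tau>"
    and "trace_preserving_action \<sigma> P \<tau>"
    and "von_neumann_algebra P\<^sub>0" and "P\<^sub>0 \<subseteq> P" and "invariant_under \<sigma> P\<^sub>0"
    and "von_neumann_algebra N"
    and "crossed_product \<sigma> P\<^sub>0 \<subseteq> N" and "N \<subseteq> crossed_product \<sigma> P"
    and "trace_preserving_conditional_expectation (canonical_trace \<tau>) (crossed_product \<sigma> P) N E\<^sub>N"
  shows "(\<exists>Q. von_neumann_algebra Q \<and> P\<^sub>0 \<subseteq> Q \<and> Q \<subseteq> P \<and> invariant_under \<sigma> Q \<and>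
            N = crossed_product \<sigma> Q) \<longleftrightarrow>
         E\<^sub>N ` alg_embed \<sigma> ` P \<subseteq> alg_embed \<sigma> ` P"
proof -
  have gens: "alg_embed \<sigma> ` P\<^sub>0 \<union> range translation \<subseteq> N"
    using assms(10) hull_subset[of "alg_embed \<sigma> ` P\<^sub>0 \<union> range translation" von_neumann_algebra]
    unfolding crossed_product_def by blast
  interpret intermediate_expectation P \<tau> \<sigma> N E\<^sub>N
    using assms gens by unfold_locales (auto simp: finite_von_neumann_algebra_def)
  show ?thesis
  proof
    assume "\<exists>Q. von_neumann_algebra Q \<and> P\<^sub>0 \<subseteq> Q \<and> Q \<subseteq> P \<and> invariant_under \<sigma> Q \<and> N = crossed_product \<sigma> Q"
    then show "E\<^sub>N ` alg_embed \<sigma> ` P \<subseteq> alg_embed \<sigma> ` P"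
      using expectation_onto_crossed_product by blast
  next
    assume "E\<^sub>N ` alg_embed \<sigma> ` P \<subseteq> alg_embed \<sigma> ` P"
    then interpret commuting_expectation P \<tau> \<sigma> N E\<^sub>N
      by unfold_locales
    have "P\<^sub>0 \<subseteq> embedded_part"
      using gens assms(7) by (auto simp: embedded_part_def)
    then show "\<exists>Q. von_neumann_algebra Q \<and> P\<^sub>0 \<subseteq> Q \<and> Q \<subseteq> P \<and> invariant_under \<sigma> Q \<and> N = crossed_product \<sigma> Q"
      using embedded_part_von_neumann_algebra embedded_part_le embedded_part_invariant
        N_eq_crossed_product by blast
  qed
qed

end
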